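(* Let $k$ be a field of characteristic zero, $n\ge 3$ and $h\ge 2$. Let $X_4\subset\mathbb{P}^{n+1}$ be an irreducible quartic hypersurface containing an $h$-dimensional linear subspace $\Lambda\subset\mathbb{P}^{n+1}$ (defined over $k$). Assume that $\dim(\Lambda\cap\mathrm{Sing}(X_4))\le h-2$ and that $X_4$ is not a cone over a quartic of smaller dimension. Then $X_4$ is unirational over $k$.
   Context: A variety $X$ of dimension $n$ is unirational over $k$ if there is a dominant rational map $\mathbb{P}^n_k\dashrightarrow X$. *)

theory Defs
  imports Main "HOL-Library.Poly_Mapping" "HOL-Computational_Algebra.Factorial_Ring"
begin

text \<open>A polynomial in the variables x_0, x_1, ... is a finitely supported map from
monomials (finitely supported exponent vectors nat =>0 nat) to coefficients.
The library instantiates this type as a commutative ring (an integral domain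
when the coefficients form a field), with multiplication given by convolution.\<close>

type_synonym 'k mpoly = "(nat \<Rightarrow>\<^sub>0 nat) \<Rightarrow>\<^sub>0 'k"

definition Var :: "nat \<Rightarrow> 'k::comm_ring_1 mpoly" where
  "Var i = Poly_Mapping.single (Poly_Mapping.single i 1) 1"

definition Const :: "'k::comm_ring_1 \<Rightarrow> 'k mpoly" where
  "Const c = Poly_Mapping.single 0 c"

definition mdeg :: "(nat \<Rightarrow>\<^sub>0 nat) \<Rightarrow> nat" where
  "mdeg m = (\<Sum>i\<in>Poly_Mapping.keys m. Poly_Mapping.lookup m i)"

definition in_vars :: "nat \<Rightarrow> 'k::comm_ring_1 mpoly \<Rightarrow> bool" where
  "in_vars N p \<longleftrightarrow> (\<forall>m\<in>Poly_Mapping.keys p. Poly_Mapping.keys m \<subseteq> {..<N})"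

definition homogeneous :: "nat \<Rightarrow> 'k::comm_ring_1 mpoly \<Rightarrow> bool" where
  "homogeneous d p \<longleftrightarrow> (\<forall>m\<in>Poly_Mapping.keys p. mdeg m = d)"

definition subst :: "(nat \<Rightarrow> 'k::comm_ring_1 mpoly) \<Rightarrow> 'k mpoly \<Rightarrow> 'k mpoly" where
  "subst g p = (\<Sum>m\<in>Poly_Mapping.keys p. Const (Poly_Mapping.lookup p m) * (\<Prod>i\<in>Poly_Mapping.keys m. g i ^ Poly_Mapping.lookup m i))"

definition eval :: "(nat \<Rightarrow> 'k::comm_ring_1) \<Rightarrow> 'k mpoly \<Rightarrow> 'k" where
  "eval x p = (\<Sum>m\<in>Poly_Mapping.keys p. Poly_Mapping.lookup p m * (\<Prod>i\<in>Poly_Mapping.keys m. x i ^ Poly_Mapping.lookup m i))"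

definition pderiv_var :: "nat \<Rightarrow> 'k::comm_ring_1 mpoly \<Rightarrow> 'k mpoly" where
  "pderiv_var i p = (\<Sum>m\<in>Poly_Mapping.keys p.
      Poly_Mapping.single (m - Poly_Mapping.single i 1) (of_nat (Poly_Mapping.lookup m i) * Poly_Mapping.lookup p m))"

definition is_ideal :: "nat \<Rightarrow> 'k::comm_ring_1 mpoly set \<Rightarrow> bool" where
  "is_ideal N I \<longleftrightarrow> I \<subseteq> {p. in_vars N p} \<and> 0 \<in> I \<and>
     (\<forall>a\<in>I. \<forall>b\<in>I. a + b \<in> I) \<and> (\<forall>r. in_vars N r \<longrightarrow> (\<forall>a\<in>I. r * a \<in> I))"

definition is_prime_ideal :: "nat \<Rightarrow> 'k::comm_ring_1 mpoly set \<Rightarrow> bool" where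
  "is_prime_ideal N P \<longleftrightarrow> is_ideal N P \<and> 1 \<notin> P \<and>
     (\<forall>a b. in_vars N a \<longrightarrow> in_vars N b \<longrightarrow> a * b \<in> P \<longrightarrow> a \<in> P \<or> b \<in> P)"

definition gen_ideal :: "nat \<Rightarrow> 'k::comm_ring_1 mpoly set \<Rightarrow> 'k mpoly set" where
  "gen_ideal N S = \<Inter>{I. is_ideal N I \<and> S \<subseteq> I}"

definition krull_dim_le :: "nat \<Rightarrow> 'k::comm_ring_1 mpoly set \<Rightarrow> nat \<Rightarrow> bool" where
  "krull_dim_le N I d \<longleftrightarrow> \<not> (\<exists>P :: nat \<Rightarrow> 'k mpoly set.
      (\<forall>j\<le>Suc d. is_prime_ideal N (P j) \<and> I \<subseteq> P j) \<and> (\<forall>j\<le>d. P j \<subset> P (Suc j)))"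

text \<open>For a homogeneous ideal I of k[x_0, ..., x_(N-1)], the projective scheme
V(I) in P^(N-1) has dimension <= e iff the Krull dimension of the homogeneous
coordinate ring k[x]/I is <= e + 1 (with dim of the empty set = -1).\<close>
definition proj_dim_le :: "nat \<Rightarrow> 'k::comm_ring_1 mpoly set \<Rightarrow> nat \<Rightarrow> bool" where
  "proj_dim_le N S e \<longleftrightarrow> krull_dim_le N (gen_ideal N S) (Suc e)"

definition irreducible_form :: "nat \<Rightarrow> nat \<Rightarrow> 'k::field mpoly \<Rightarrow> bool" where
  "irreducible_form N d F \<longleftrightarrow> F \<noteq> 0 \<and> in_vars N F \<and> homogeneous d F \<and> irreducible F"

definition sing_eqs :: "nat \<Rightarrow> 'k::comm_ring_1 mpoly \<Rightarrow> 'k mpoly set" where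
  "sing_eqs N F = insert F {pderiv_var i F | i. i < N}"

text \<open>V(F) is a cone with vertex [v] (v a nonzero vector of k^N): F(x + t v) = F(x)
for all x and t.  (Since k is infinite and the condition is linear in v, this is the
same as being a cone with a vertex over the algebraic closure.)\<close>
definition is_cone :: "nat \<Rightarrow> 'k::field mpoly \<Rightarrow> bool" where
  "is_cone N F \<longleftrightarrow> (\<exists>v :: nat \<Rightarrow> 'k. (\<exists>i<N. v i \<noteq> 0) \<and> (\<forall>i\<ge>N. v i = 0) \<and>
      (\<forall>x t. eval (\<lambda>i. x i + t * v i) F = eval x F))"

definition indep_linear_forms :: "nat \<Rightarrow> nat \<Rightarrow> (nat \<Rightarrow> 'k::field mpoly) \<Rightarrow> bool" where
  "indep_linear_forms N c L \<longleftrightarrow>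
     (\<forall>j<c. in_vars N (L j) \<and> homogeneous 1 (L j)) \<and>
     (\<forall>a :: nat \<Rightarrow> 'k. (\<Sum>j<c. Const (a j) * L j) = 0 \<longrightarrow> (\<forall>j<c. a j = 0))"

text \<open>Unirationality of the irreducible hypersurface X = V(F) in P^(N-1) (of dimension N-2):
there is a dominant rational map P^(N-2) --> X, given by forms G_0, ..., G_(N-1)
of a common degree in the variables y_0, ..., y_(N-2), with F(G) = 0 (the map lands
in X), and dominant: the image is dense in X, i.e. every form H vanishing on the
image (H(G) = 0) vanishes on X, i.e. lies in the ideal (F) of X.\<close>
definition unirational_hypersurface :: "nat \<Rightarrow> 'k::field mpoly \<Rightarrow> bool" where
  "unirational_hypersurface N F \<longleftrightarrow> (\<exists>(G :: nat \<Rightarrow> 'k mpoly) e.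
      (\<forall>i<N. in_vars (N - 1) (G i) \<and> homogeneous e (G i)) \<and>
      (\<exists>i<N. G i \<noteq> 0) \<and>
      subst G F = 0 \<and>
      (\<forall>H. in_vars N H \<longrightarrow> subst G H = 0 \<longrightarrow> F dvd H))"

end

theory Submission
  imports Defs "HOL-Computational_Algebra.Polynomial" "HOL-Library.Function_Algebras"
begin

text \<open>Let \<open>Q\<close> be the polar form of the quartic. If \<open>p\<close> lies in the linear space \<open>\<Lambda>\<close> and
  \<open>Q p p p q = Q p p q q = 0\<close>, then the line through \<open>p\<close> and \<open>q\<close> meets the quartic three times in \<open>p\<close>, and its
  residual point depends rationally on \<open>(p, q)\<close>. The pairs \<open>(p, q)\<close> are parametrized by rational functions, because the
  two equations can be solved linearly in \<open>q\<close> (a point and a tangent direction being known), and a tangent space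
  computation shows that the resulting map is dominant, unless \<open>Q p k k q\<close> and \<open>Q p k q q\<close> vanish whenever
  \<open>Q p p p q = Q p p k q = Q p p q q = 0\<close> with \<open>k\<close> in \<open>\<Lambda>\<close>.

  In that degenerate case consider the hypersurface \<open>V\<close> of pairs \<open>(x, y)\<close> with \<open>x\<close> in \<open>\<Lambda>\<close> and \<open>Q x x x y = 0\<close>.
  It is irreducible, since the cubics \<open>Q x x x b\<close> on \<open>\<Lambda>\<close> have no common factor: such a factor would define a
  hypersurface of \<open>\<Lambda>\<close> contained in the singular locus, against the bound on the Krull dimension. Along \<open>V\<close>
  the second fundamental form vanishes, so that all these cubics factor on a hyperplane of \<open>\<Lambda>\<close>
  into a common quadric and linear forms; comparing two vectors of the hyperplane one finds \<open>v\<close> in \<open>\<Lambda>\<close> that is a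
  common vertex of the cubics, and then even a triple point of the quartic. As the quartic is not a cone,
  projection from \<open>v\<close> makes it rational.\<close>

subsection \<open>Evaluation homomorphisms\<close>

text \<open>All arguments use points rational over the ground field. It is infinite, so a polynomial
  is determined by its values, but quadratic equations need not be solvable. This shapes the proof
  twice. Dominance of a map is read off from a single point where the differential has the largest
  possible rank, and not from dimensions. Irreducibility of \<open>V\<close> is available over the
  ground field only, so a quadratic relation on \<open>V\<close> is treated according to whether its
  discriminant is a square.

  \<open>Q p k k q\<close> and \<open>Q p k q q\<close> are, up to a factor 2, the coefficients of
  \<open>Q p k q' q'\<close> as a polynomial in \<open>s\<close>, where \<open>q' = q + s k\<close>;
  this value must be nonzero for the differential to be injective. The equation of \<open>V\<close>
  has degree three in \<open>x\<close>, so an expression of smaller degree in \<open>x\<close> that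
  vanishes on \<open>V\<close> is zero. That is how statements along \<open>V\<close> become
  identities. The vector \<open>v\<close> exists because three independent vectors of
  \<open>\<Lambda>\<close> cannot all lie in one plane.\<close>

definition mon :: "(nat \<Rightarrow> 'r::comm_monoid_mult) \<Rightarrow> (nat \<Rightarrow>\<^sub>0 nat) \<Rightarrow> 'r" where
  "mon x m = (\<Prod>i\<in>Poly_Mapping.keys m. x i ^ Poly_Mapping.lookup m i)"

lemma mon_superset:
  assumes "finite A" "Poly_Mapping.keys m \<subseteq> A"
  shows "mon x m = (\<Prod>i\<in>A. x i ^ Poly_Mapping.lookup m i)"
  unfolding mon_def
  by (rule prod.mono_neutral_left) (use assms in \<open>auto simp: in_keys_iff\<close>)

lemma mon_add: "mon x (m + m') = mon x m * mon x m'"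
proof -
  let ?A = "Poly_Mapping.keys m \<union> Poly_Mapping.keys m'"
  have "Poly_Mapping.keys (m + m') \<subseteq> ?A" by (rule keys_add)
  then show ?thesis
    by (simp add: mon_superset[of ?A] lookup_add power_add prod.distrib)
qed

lemma mon_zero [simp]: "mon x 0 = 1"
  by (simp add: mon_def)

lemma mon_single [simp]: "mon x (Poly_Mapping.single i k) = x i ^ k"
  by (cases "k = 0") (simp_all add: mon_def)

lemma mon_Var: "mon Var m = (Poly_Mapping.single m 1 :: 'k::comm_ring_1 mpoly)"
proof -
  have "Poly_Mapping.single (Poly_Mapping.single i 1) (1::'k) ^ k = Poly_Mapping.single (Poly_Mapping.single i k) 1" for i k
  proof (induction k)
    case (Suc k)
    show ?case unfolding power_Suc Suc by (simp add: mult_single single_add[symmetric])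
  qed simp
  then have *: "(Var i :: 'k mpoly) ^ k = Poly_Mapping.single (Poly_Mapping.single i k) 1" for i k
    unfolding Var_def by simp
  have **: "(\<Prod>i\<in>A. Poly_Mapping.single (g i) (1::'k)) = Poly_Mapping.single (\<Sum>i\<in>A. g i) 1" if "finite A" for A :: "nat set" and g :: "nat \<Rightarrow> nat \<Rightarrow>\<^sub>0 nat"
    using that by (induction A rule: finite_induct) (simp_all add: mult_single)
  have "(\<Sum>i\<in>Poly_Mapping.keys m. Poly_Mapping.single i (Poly_Mapping.lookup m i)) = m"
    by (rule poly_mapping_eqI) (simp add: lookup_sum lookup_single when_def in_keys_iff)
  then show ?thesis unfolding mon_def * by (simp add: **)
qed

lemma mpoly_sum_single: "p = (\<Sum>m\<in>Poly_Mapping.keys p. Poly_Mapping.single m (Poly_Mapping.lookup p m))"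
  by (rule poly_mapping_eqI) (simp add: lookup_sum lookup_single when_def in_keys_iff)

lemma single_eq_Const_mon: "Poly_Mapping.single m c = Const c * mon Var m"
  by (simp add: mon_Var Const_def mult_single)

lemma mpoly_sum_mon: "p = (\<Sum>m\<in>Poly_Mapping.keys p. Const (Poly_Mapping.lookup p m) * mon Var m)"
  using mpoly_sum_single[of p] by (simp add: single_eq_Const_mon)

lemma Const_hom [simp]: "Const 0 = 0" "Const 1 = 1" "Const (a + b) = Const a + Const b"
  "Const (a * b) = Const a * Const b" "Const (- a) = - Const a" "Const (a - b) = Const a - Const b"
  by (simp_all add: Const_def single_add mult_single single_uminus single_diff)

lemma Const_eq_iff [simp]: "Const a = Const b \<longleftrightarrow> a = b"
  by (metis Const_def lookup_single_eq)

lemma Const_eq_0_iff [simp]: "Const a = 0 \<longleftrightarrow> a = 0"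
  using Const_eq_iff[of a 0] by (simp del: Const_eq_iff)

lemma mpoly_induct [case_names Const Var add mult]:
  fixes p :: "'k::comm_ring_1 mpoly"
  assumes "\<And>c. P (Const c)" "\<And>i. P (Var i)" "\<And>p q. P p \<Longrightarrow> P q \<Longrightarrow> P (p + q)" "\<And>p q. P p \<Longrightarrow> P q \<Longrightarrow> P (p * q)"
  shows "P p"
proof -
  have 0: "P 0" and 1: "P 1" using assms(1)[of 0] assms(1)[of 1] by simp_all
  have pow: "P (Var i ^ k)" for i k by (induction k) (auto simp: 1 assms)
  have prod: "P (\<Prod>i\<in>A. Var i ^ g i)" if "finite A" for A and g :: "nat \<Rightarrow> nat"
    using that by (induction A rule: finite_induct) (auto simp: 1 assms pow)
  have sum: "P (\<Sum>m\<in>A. f m)" if "finite A" "\<And>m. P (f m)" for A and f :: "(nat \<Rightarrow>\<^sub>0 nat) \<Rightarrow> 'k mpoly"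
    using that by (induction A rule: finite_induct) (auto simp: 0 assms)
  show ?thesis
    by (subst mpoly_sum_mon) (intro sum finite_keys assms(4) assms(1), simp add: mon_def prod)
qed

definition ring_map :: "('a::comm_ring_1 \<Rightarrow> 'b::comm_ring_1) \<Rightarrow> bool" where
  "ring_map f \<longleftrightarrow> f 0 = 0 \<and> f 1 = 1 \<and> (\<forall>a b. f (a + b) = f a + f b) \<and> (\<forall>a b. f (a * b) = f a * f b)"

lemma ring_mapD:
  assumes "ring_map f"
  shows "f 0 = 0" "f 1 = 1" "f (a + b) = f a + f b" "f (a * b) = f a * f b" "f (- a) = - f a" "f (a - b) = f a - f b"
    "f (a ^ k) = f a ^ k"
proof -
  show *: "f 0 = 0" "f 1 = 1" "\<And>a b. f (a + b) = f a + f b" "\<And>a b. f (a * b) = f a * f b" using assms by (auto simp: ring_map_def)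
  show **: "f (- a) = - f a" for a using *(3)[of a "-a"] *(1) by (simp add: add_eq_0_iff)
  show "f (a - b) = f a - f b" using *(3)[of a "-b"] ** by simp
  show "f (a ^ k) = f a ^ k" by (induction k) (simp_all add: *)
qed

lemma ring_map_sum: "ring_map f \<Longrightarrow> f (sum g A) = (\<Sum>i\<in>A. f (g i))"
  by (induction A rule: infinite_finite_induct) (simp_all add: ring_mapD)

lemma ring_map_prod: "ring_map f \<Longrightarrow> f (prod g A) = (\<Prod>i\<in>A. f (g i))"
  by (induction A rule: infinite_finite_induct) (simp_all add: ring_mapD)

lemma ring_map_id: "ring_map (\<lambda>x. x)" by (simp add: ring_map_def)
lemma ring_map_Const: "ring_map Const" by (simp add: ring_map_def)
lemma ring_map_pCons: "ring_map (\<lambda>c. [:c:])" by (simp add: ring_map_def)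
lemma ring_map_pCons_Const: "ring_map (\<lambda>c. [:Const c:])" by (simp add: ring_map_def)
lemma ring_map_poly: "ring_map (\<lambda>p. poly p x)" by (simp add: ring_map_def)
lemma ring_map_comp: "ring_map f \<Longrightarrow> ring_map g \<Longrightarrow> ring_map (\<lambda>x. f (g x))" by (simp add: ring_map_def)

text \<open>Values in an arbitrary commutative ring are allowed so that \<open>eval\<close>,
  \<open>subst\<close>, the univariate view \<open>toU\<close>, the rescaling \<open>shom\<close>
  and \<open>curve\<close> are all instances; identities between them then need checking only on
  constants and variables, by \<open>ring_map_eqI\<close>.\<close>

definition evalh :: "('k::comm_ring_1 \<Rightarrow> 'r::comm_ring_1) \<Rightarrow> (nat \<Rightarrow> 'r) \<Rightarrow> 'k mpoly \<Rightarrow> 'r" where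
  "evalh f x p = (\<Sum>m\<in>Poly_Mapping.keys p. f (Poly_Mapping.lookup p m) * mon x m)"

lemma evalh_superset:
  assumes "ring_map f" "finite A" "Poly_Mapping.keys p \<subseteq> A"
  shows "evalh f x p = (\<Sum>m\<in>A. f (Poly_Mapping.lookup p m) * mon x m)"
  unfolding evalh_def
  by (rule sum.mono_neutral_left) (use assms in \<open>auto simp: in_keys_iff ring_mapD\<close>)

lemma evalh_add:
  assumes "ring_map f" shows "evalh f x (p + q) = evalh f x p + evalh f x q"
proof -
  let ?A = "Poly_Mapping.keys p \<union> Poly_Mapping.keys q"
  have "Poly_Mapping.keys (p + q) \<subseteq> ?A" by (rule keys_add)
  then show ?thesis using assms
    by (simp add: evalh_superset[of f ?A] lookup_add ring_mapD sum.distrib algebra_simps)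
qed

lemma evalh_single: "ring_map f \<Longrightarrow> evalh f x (Poly_Mapping.single m c) = f c * mon x m"
  by (cases "c = 0") (simp_all add: evalh_def ring_mapD)

lemma evalh_0: "ring_map f \<Longrightarrow> evalh f x 0 = 0"
  by (simp add: evalh_def)

lemma evalh_sum: "ring_map f \<Longrightarrow> evalh f x (sum g A) = (\<Sum>a\<in>A. evalh f x (g a))"
  by (induction A rule: infinite_finite_induct) (simp_all add: evalh_0 evalh_add)

lemma evalh_mult:
  assumes "ring_map f" shows "evalh f x (p * q) = evalh f x p * evalh f x q"
proof -
  have 1: "evalh f x (Poly_Mapping.single m c * Poly_Mapping.single m' c') = evalh f x (Poly_Mapping.single m c) * evalh f x (Poly_Mapping.single m' c')" for m c m' c'
    using assms by (simp add: mult_single evalh_single mon_add ring_mapD)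
  have 2: "evalh f x (Poly_Mapping.single m c * q) = evalh f x (Poly_Mapping.single m c) * evalh f x q" for m c
    by (subst (1 2) mpoly_sum_single[of q]) (simp add: sum_distrib_left evalh_sum assms 1)
  show ?thesis
    by (subst (1 2) mpoly_sum_single[of p]) (simp add: sum_distrib_right evalh_sum assms 2)
qed

lemma ring_map_evalh: "ring_map f \<Longrightarrow> ring_map (evalh f x)"
  using evalh_single[of f x 0 1] by (simp add: ring_map_def evalh_0 evalh_add evalh_mult)

lemma evalh_Const [simp]: "ring_map f \<Longrightarrow> evalh f x (Const c) = f c"
  by (simp add: Const_def evalh_single)

lemma evalh_Var [simp]: "ring_map f \<Longrightarrow> evalh f x (Var i) = x i"
  by (simp add: Var_def evalh_single ring_mapD)

lemma ring_map_eqI: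
  fixes f g :: "'k::comm_ring_1 mpoly \<Rightarrow> 'r::comm_ring_1"
  assumes "ring_map f" "ring_map g" "\<And>c. f (Const c) = g (Const c)" "\<And>i. f (Var i) = g (Var i)"
  shows "f p = g p"
  by (induction p rule: mpoly_induct) (simp_all add: assms ring_mapD[OF assms(1)] ring_mapD[OF assms(2)])

lemma eval_evalh: "eval x = evalh (\<lambda>c. c) x"
  by (rule ext) (simp add: eval_def evalh_def mon_def)

lemma subst_evalh: "subst g = evalh Const g"
  by (rule ext) (simp add: subst_def evalh_def mon_def)

lemma ring_map_eval: "ring_map (eval x)"
  by (simp add: eval_evalh ring_map_evalh ring_map_id)

lemma ring_map_subst: "ring_map (subst g)"
  by (simp add: subst_evalh ring_map_evalh ring_map_Const)

lemmas eval_simps [simp] = ring_mapD[OF ring_map_eval] ring_map_sum[OF ring_map_eval] ring_map_prod[OF ring_map_eval]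
lemmas subst_simps [simp] = ring_mapD[OF ring_map_subst] ring_map_sum[OF ring_map_subst] ring_map_prod[OF ring_map_subst]

lemma eval_Const [simp]: "eval x (Const c) = c" and eval_Var [simp]: "eval x (Var i) = x i"
  by (simp_all add: eval_evalh ring_map_id)

lemma subst_Const [simp]: "subst g (Const c) = Const c" and subst_Var [simp]: "subst g (Var i) = g i"
  by (simp_all add: subst_evalh ring_map_Const)

lemma eval_subst: "eval x (subst g p) = eval (\<lambda>i. eval x (g i)) p"
  by (rule ring_map_eqI[of "\<lambda>p. eval x (subst g p)"]) (simp_all add: ring_map_comp ring_map_eval ring_map_subst)

lemma subst_subst: "subst g (subst g' p) = subst (\<lambda>i. subst g (g' i)) p"
  by (rule ring_map_eqI[of "\<lambda>p. subst g (subst g' p)"]) (simp_all add: ring_map_comp ring_map_subst)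

lemma subst_id [simp]: "subst Var p = p"
  by (rule ring_map_eqI[of "subst Var" "\<lambda>p. p"]) (simp_all add: ring_map_subst ring_map_id)

lemma ring_map_dvd: "ring_map f \<Longrightarrow> a dvd b \<Longrightarrow> f a dvd f b"
  by (metis dvd_def ring_mapD(4))

subsection \<open>The univariate view\<close>

text \<open>The coefficients stay in the full polynomial type, so that no ring with fewer variables
  has to be formed; that they do not involve \<open>Var v\<close> is recorded separately by
  \<open>free_of_coeff\<close>.\<close>

definition toU :: "nat \<Rightarrow> 'k::comm_ring_1 mpoly \<Rightarrow> 'k mpoly poly" where
  "toU v = evalh (\<lambda>c. [:Const c:]) (\<lambda>i. if i = v then [:0, 1:] else [:Var i:])"

abbreviation degv :: "nat \<Rightarrow> 'k::comm_ring_1 mpoly \<Rightarrow> nat" where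
  "degv v p \<equiv> degree (toU v p)"

lemma ring_map_toU: "ring_map (toU v)"
  by (simp add: toU_def ring_map_evalh ring_map_pCons_Const)

lemmas toU_simps [simp] = ring_mapD[OF ring_map_toU] ring_map_sum[OF ring_map_toU]

lemma toU_Const [simp]: "toU v (Const c) = [:Const c:]"
  and toU_Var: "toU v (Var i) = (if i = v then [:0, 1:] else [:Var i:])"
  by (simp_all add: toU_def ring_map_pCons_Const)

lemma poly_toU: "poly (toU v p) (Var v) = p"
  by (rule ring_map_eqI[of "\<lambda>p. poly (toU v p) (Var v)" "\<lambda>p. p"])
    (simp_all add: ring_map_comp[OF ring_map_poly ring_map_toU] ring_map_id toU_Var)

lemma poly_toU': "poly (toU v p) g = subst (Var(v := g)) p"
  by (rule ring_map_eqI[of "\<lambda>p. poly (toU v p) g"])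
    (simp_all add: ring_map_comp[OF ring_map_poly ring_map_toU] ring_map_subst toU_Var)

lemma toU_eq_iff [simp]: "toU v p = toU v q \<longleftrightarrow> p = q"
  by (metis poly_toU)

lemma toU_eq_0_iff [simp]: "toU v p = 0 \<longleftrightarrow> p = 0"
  using toU_eq_iff[of v p 0] by (simp del: toU_eq_iff)

definition free_of :: "nat \<Rightarrow> 'k::comm_ring_1 mpoly \<Rightarrow> bool" where
  "free_of v p \<longleftrightarrow> toU v p = [:p:]"

lemma free_of_simps [simp]: "free_of v 0" "free_of v 1" "free_of v (Const c)"
  "free_of v p \<Longrightarrow> free_of v q \<Longrightarrow> free_of v (p + q)"
  "free_of v p \<Longrightarrow> free_of v q \<Longrightarrow> free_of v (p * q)"
  "free_of v p \<Longrightarrow> free_of v (- p)"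
  "free_of v p \<Longrightarrow> free_of v q \<Longrightarrow> free_of v (p - q)"
  by (simp_all add: free_of_def)

lemma free_of_Var: "free_of v (Var i) \<longleftrightarrow> i \<noteq> v"
  by (auto simp: free_of_def toU_Var)

lemma free_of_sum: "(\<And>i. i \<in> A \<Longrightarrow> free_of v (g i)) \<Longrightarrow> free_of v (sum g A)"
  by (induction A rule: infinite_finite_induct) auto

lemma free_of_power [simp]: "free_of v p \<Longrightarrow> free_of v (p ^ k)"
  by (induction k) auto

lemma free_of_coeff: "free_of v (coeff (toU v p) k)"
proof (induction p arbitrary: k rule: mpoly_induct)
  case (Const c) show ?case by (cases k) simp_all
next
  case (Var i) show ?case by (cases k; cases "k - 1") (auto simp: toU_Var free_of_Var coeff_pCons split: nat.splits)
next
  case (mult p q)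
  then show ?case by (simp add: coeff_mult free_of_sum)
qed simp

lemma free_of_iff_degv: "free_of v p \<longleftrightarrow> degv v p = 0"
proof
  assume "degv v p = 0"
  then obtain c where c: "toU v p = [:c:]" by (meson degree_eq_zeroE)
  have "p = c" using poly_toU[of v p] c by simp
  then show "free_of v p" using c by (simp add: free_of_def)
qed (simp add: free_of_def)

lemma subst_free_of: "free_of v p \<Longrightarrow> subst (Var(v := g)) p = p"
  by (simp add: poly_toU'[symmetric] free_of_def)

lemma eval_free_of: "free_of v p \<Longrightarrow> eval (x(v := t)) p = eval x p"
proof -
  assume "free_of v p"
  then have "eval (x(v := t)) p = eval (x(v:=t)) (subst (Var(v := Const (x v))) p)" by (simp add: subst_free_of)
  also have "\<dots> = eval x p" unfolding eval_subst by (rule arg_cong[of _ _ "\<lambda>f. eval f p"]) auto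
  finally show ?thesis .
qed

text \<open>Connects the description by monomials with the ring-theoretic one. For the converse,
  putting \<open>Var v\<close> to zero deletes exactly the monomials that contain it, yet fixes a
  polynomial free of it.\<close>

lemma in_vars_iff_free_of: "in_vars N p \<longleftrightarrow> (\<forall>v\<ge>N. free_of v p)"
proof
  assume p: "in_vars N p"
  show "\<forall>v\<ge>N. free_of v p"
  proof safe
    fix v assume v: "N \<le> v"
    have "free_of v (mon Var m :: 'a mpoly)" if "m \<in> Poly_Mapping.keys p" for m
    proof -
      have m: "Poly_Mapping.keys m \<subseteq> {..<N}" using p that by (auto simp: in_vars_def)
      have *: "free_of v (\<Prod>i\<in>A. Var i ^ g i :: 'a mpoly)" if "finite A" "A \<subseteq> {..<N}" for A and g :: "nat \<Rightarrow> nat"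
        using that v by (induction A rule: finite_induct) (auto simp: free_of_Var)
      show ?thesis unfolding mon_def by (rule *[OF finite_keys m])
    qed
    then show "free_of v p" by (subst mpoly_sum_mon) (auto intro!: free_of_sum)
  qed
next
  assume fr: "\<forall>v\<ge>N. free_of v p"
  show "in_vars N p" unfolding in_vars_def
  proof safe
    fix m v assume m: "m \<in> Poly_Mapping.keys p" and v: "v \<in> Poly_Mapping.keys m"
    show "v < N"
    proof (rule ccontr)
      assume "\<not> v < N"
      then have "subst (Var(v := 0)) p = p" using fr by (simp add: subst_free_of)
      also have "subst (Var(v := 0)) p = (\<Sum>m\<in>Poly_Mapping.keys p. Const (Poly_Mapping.lookup p m) * mon (Var(v := 0)) m)"
        by (simp add: subst_evalh evalh_def)
      also have "\<dots> = (\<Sum>m\<in>Poly_Mapping.keys p. if v \<in> Poly_Mapping.keys m then 0 else Poly_Mapping.single m (Poly_Mapping.lookup p m))"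
      proof (rule sum.cong)
        fix m assume "m \<in> Poly_Mapping.keys p"
        show "Const (Poly_Mapping.lookup p m) * mon (Var(v := 0)) m = (if v \<in> Poly_Mapping.keys m then 0 else Poly_Mapping.single m (Poly_Mapping.lookup p m))"
        proof (cases "v \<in> Poly_Mapping.keys m")
          case True
          then have "mon (Var(v := 0 :: 'a mpoly)) m = 0" unfolding mon_def
            by (intro prod_zero) (auto simp: in_keys_iff zero_power intro!: bexI[of _ v])
          then show ?thesis using True by simp
        next
          case False
          then have "mon (Var(v := 0 :: 'a mpoly)) m = mon Var m" unfolding mon_def
            by (intro prod.cong) auto
          then show ?thesis using False by (simp add: single_eq_Const_mon)
        qed
      qed simp
      finally have "Poly_Mapping.lookup p m = Poly_Mapping.lookup (\<Sum>m\<in>Poly_Mapping.keys p. if v \<in> Poly_Mapping.keys m then 0 else Poly_Mapping.single m (Poly_Mapping.lookup p m)) m"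
        by simp
      also have "\<dots> = (\<Sum>m'\<in>Poly_Mapping.keys p. Poly_Mapping.lookup (if v \<in> Poly_Mapping.keys m' then 0 else Poly_Mapping.single m' (Poly_Mapping.lookup p m')) m)"
        by (simp add: lookup_sum)
      also have "\<dots> = 0" using v by (intro sum.neutral) (auto simp: lookup_single when_def)
      finally show False using m by (simp add: in_keys_iff)
    qed
  qed
qed

lemma in_vars_simps [simp]: "in_vars N 0" "in_vars N 1" "in_vars N (Const c)"
  "in_vars N p \<Longrightarrow> in_vars N q \<Longrightarrow> in_vars N (p + q)"
  "in_vars N p \<Longrightarrow> in_vars N q \<Longrightarrow> in_vars N (p * q)"
  "in_vars N p \<Longrightarrow> in_vars N (- p)"
  "in_vars N p \<Longrightarrow> in_vars N q \<Longrightarrow> in_vars N (p - q)"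
  "in_vars N p \<Longrightarrow> in_vars N (p ^ k)"
  by (simp_all add: in_vars_iff_free_of)

lemma in_vars_Var [simp]: "in_vars N (Var i) \<longleftrightarrow> i < N"
  unfolding in_vars_iff_free_of free_of_Var by (metis linorder_not_le)

lemma in_vars_sum: "(\<And>i. i \<in> A \<Longrightarrow> in_vars N (g i)) \<Longrightarrow> in_vars N (sum g A)"
  by (induction A rule: infinite_finite_induct) auto

lemma in_vars_mono: "in_vars N p \<Longrightarrow> N \<le> M \<Longrightarrow> in_vars M p"
  by (simp add: in_vars_iff_free_of)

lemma ex_in_vars: "\<exists>N. in_vars N p"
proof (induction p rule: mpoly_induct)
  case (Var i) then show ?case by (intro exI[of _ "Suc i"]) simp
next
  case (add p q)
  then obtain N M where "in_vars N p" "in_vars M q" by auto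
  then show ?case by (intro exI[of _ "max N M"] in_vars_simps) (auto elim!: in_vars_mono)
next
  case (mult p q)
  then obtain N M where "in_vars N p" "in_vars M q" by auto
  then show ?case by (intro exI[of _ "max N M"] in_vars_simps) (auto elim!: in_vars_mono)
qed auto

lemma mon_cong: "(\<And>i. i \<in> Poly_Mapping.keys m \<Longrightarrow> x i = y i) \<Longrightarrow> mon x m = mon y m"
  unfolding mon_def by (rule prod.cong) auto

lemma evalh_cong:
  assumes "in_vars N p" "\<And>i. i < N \<Longrightarrow> x i = y i"
  shows "evalh f x p = evalh f y p"
  unfolding evalh_def
proof (rule sum.cong)
  fix m assume "m \<in> Poly_Mapping.keys p"
  then have "Poly_Mapping.keys m \<subseteq> {..<N}" using assms(1) by (auto simp: in_vars_def)
  then have "mon x m = mon y m" using assms(2) by (intro mon_cong) auto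
  then show "f (Poly_Mapping.lookup p m) * mon x m = f (Poly_Mapping.lookup p m) * mon y m" by simp
qed simp

lemma eval_cong: "in_vars N p \<Longrightarrow> (\<And>i. i < N \<Longrightarrow> x i = y i) \<Longrightarrow> eval x p = eval y p"
  unfolding eval_evalh by (rule evalh_cong)

lemma subst_cong: "in_vars N p \<Longrightarrow> (\<And>i. i < N \<Longrightarrow> x i = y i) \<Longrightarrow> subst x p = subst y p"
  unfolding subst_evalh by (rule evalh_cong)

lemma free_of_subst: "(\<And>i. i < N \<Longrightarrow> free_of v (g i)) \<Longrightarrow> in_vars N p \<Longrightarrow> free_of v (subst g p)"
proof -
  assume g: "\<And>i. i < N \<Longrightarrow> free_of v (g i)" and p: "in_vars N p"
  define g' where "g' = (\<lambda>i. if i < N then g i else 0)"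
  have "free_of v (subst g' q)" for q
    by (induction q rule: mpoly_induct) (auto simp: g'_def g)
  moreover have "subst g' p = subst g p" by (rule subst_cong[OF p]) (simp add: g'_def)
  ultimately show ?thesis by metis
qed

lemma in_vars_subst: "(\<And>i. i < N \<Longrightarrow> in_vars M (g i)) \<Longrightarrow> in_vars N p \<Longrightarrow> in_vars M (subst g p)"
  unfolding in_vars_iff_free_of[of M] by (intro allI impI free_of_subst) auto

lemma in_vars_coeff: "in_vars N p \<Longrightarrow> in_vars N (coeff (toU v p) k)"
proof -
  assume p: "in_vars N p"
  \<comment> \<open>Structural induction does not stay among polynomials in \<open>N\<close>
    variables; composing with the truncation of the variables from \<open>N\<close> on makes the
    claim true for every \<open>q\<close>.\<close>
  have *: "free_of u (coeff (toU v (subst (\<lambda>i. if i < N then Var i else 0) q)) k)" if u: "u \<ge> N" for u k and q :: "'a mpoly"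
  proof (induction q arbitrary: k rule: mpoly_induct)
    case (Const c) show ?case by (cases k) simp_all
  next
    case (Var i) show ?case using u by (cases k; cases "k - 1") (auto simp: toU_Var free_of_Var coeff_pCons split: nat.splits)
  next
    case (mult p q)
    then show ?case by (simp add: coeff_mult free_of_sum)
  qed simp
  have "subst (\<lambda>i. if i < N then Var i else 0) p = p"
    using subst_cong[OF p, of "\<lambda>i. if i < N then Var i else 0" Var] by simp
  then show ?thesis using *[of _ p] by (simp add: in_vars_iff_free_of)
qed

lemma ring_map_map_poly: "ring_map f \<Longrightarrow> ring_map (map_poly f)"
  unfolding ring_map_def
  by (auto simp: poly_eq_iff coeff_map_poly coeff_mult ring_map_sum[of f, unfolded ring_map_def] map_poly_1')

lemma poly_toU_eval: "poly (map_poly (eval x) (toU v p)) t = eval (x(v := t)) p"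
proof (rule ring_map_eqI[of "\<lambda>p. poly (map_poly (eval x) (toU v p)) t"])
  show "ring_map (\<lambda>p. poly (map_poly (eval x) (toU v p)) t)"
    by (rule ring_map_comp[OF ring_map_poly ring_map_comp[OF ring_map_map_poly[OF ring_map_eval] ring_map_toU]])
  show "poly (map_poly (eval x) (toU v (Const c))) t = eval (x(v := t)) (Const c)" for c
    by (simp add: map_poly_pCons)
  show "poly (map_poly (eval x) (toU v (Var i))) t = eval (x(v := t)) (Var i)" for i
    by (simp add: map_poly_pCons toU_Var)
qed (rule ring_map_eval)

text \<open>The field is infinite, so a univariate polynomial without nonzero value is zero; by
  induction on the number of variables this applies to the coefficients with respect to the last
  one. Polynomial identities may therefore be proved pointwise.\<close>

lemma eval_eq_0_imp_eq_0:
  fixes p :: "'k::field_char_0 mpoly"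
  assumes "\<And>x. eval x p = 0"
  shows "p = 0"
proof -
  have "in_vars N p \<Longrightarrow> (\<And>x. eval x p = 0) \<Longrightarrow> p = 0" for N and p :: "'k mpoly"
  proof (induction N arbitrary: p)
    case 0
    have "p = (\<Sum>m\<in>Poly_Mapping.keys p. Poly_Mapping.single 0 (Poly_Mapping.lookup p m))"
    proof (subst mpoly_sum_single, rule sum.cong)
      fix m assume "m \<in> Poly_Mapping.keys p"
      then have "m = 0" using 0(1) by (auto simp: in_vars_def)
      then show "Poly_Mapping.single m (Poly_Mapping.lookup p m) = Poly_Mapping.single 0 (Poly_Mapping.lookup p m)" by simp
    qed simp
    also have "\<dots> = Const (\<Sum>m\<in>Poly_Mapping.keys p. Poly_Mapping.lookup p m)"
      unfolding Const_def by (simp add: ring_map_sum[OF ring_map_Const, unfolded Const_def])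
    finally obtain c where "p = Const c" by blast
    then show ?case using 0(2)[of undefined] by simp
  next
    case (Suc N)
    have "coeff (toU N p) k = 0" for k
    proof (rule Suc.IH)
      show "in_vars N (coeff (toU N p) k)"
        using in_vars_coeff[OF Suc.prems(1), of N k] free_of_coeff[of N p k]
        unfolding in_vars_iff_free_of by (metis Suc_leI le_neq_implies_less)
      fix x
      have "\<forall>t. poly (map_poly (eval x) (toU N p)) t = 0"
        using Suc.prems(2) by (simp add: poly_toU_eval)
      then have "map_poly (eval x) (toU N p) = 0" by (simp only: poly_all_0_iff_0)
      then have "coeff (map_poly (eval x) (toU N p)) k = 0" by simp
      then show "eval x (coeff (toU N p) k) = 0"
        by (simp add: coeff_map_poly)
    qed
    then have "toU N p = 0" by (simp add: poly_eq_iff)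
    then show ?case by simp
  qed
  then show ?thesis using ex_in_vars[of p] assms by blast
qed

lemma mpoly_eqI:
  fixes p q :: "'k::field_char_0 mpoly"
  shows "(\<And>x. eval x p = eval x q) \<Longrightarrow> p = q"
  using eval_eq_0_imp_eq_0[of "p - q"] by simp

subsection \<open>Irreducible polynomials are prime\<close>

text \<open>The variables in \<open>I\<close> are multiplied by a new parameter, whose degree is
  then the degree in these variables: the total degree for \<open>I = UNIV\<close>, the degree in
  the \<open>y\<close>-coordinates for \<open>I = {..<c}\<close>.\<close>

definition shom :: "nat set \<Rightarrow> 'k::comm_ring_1 mpoly \<Rightarrow> 'k mpoly poly" where
  "shom I = evalh (\<lambda>c. [:Const c:]) (\<lambda>i. if i \<in> I then [:0, Var i:] else [:Var i:])"

lemma ring_map_shom: "ring_map (shom I)"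
  by (simp add: shom_def ring_map_evalh ring_map_pCons_Const)

lemmas shom_simps [simp] = ring_mapD[OF ring_map_shom] ring_map_sum[OF ring_map_shom]

lemma shom_Const [simp]: "shom I (Const c) = [:Const c:]"
  and shom_Var: "shom I (Var i) = (if i \<in> I then [:0, Var i:] else [:Var i:])"
  by (simp_all add: shom_def ring_map_pCons_Const)

lemma poly_shom: "poly (shom I p) g = subst (\<lambda>i. if i \<in> I then g * Var i else Var i) p"
  by (rule ring_map_eqI[of "\<lambda>p. poly (shom I p) g"])
    (simp_all add: ring_map_comp[OF ring_map_poly ring_map_shom] ring_map_subst shom_Var)

lemma poly_shom_1 [simp]: "poly (shom I p) 1 = p"
  unfolding poly_shom by (simp cong: if_cong)

lemma shom_eq_0_iff [simp]: "shom I p = 0 \<longleftrightarrow> p = 0"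
  by (metis poly_shom_1 shom_simps(1) poly_0)

lemma degree_shom_0:
  assumes "degree (shom I p) = 0"
  shows "p = subst (\<lambda>i. if i \<in> I then 0 else Var i) p"
proof -
  obtain c where c: "shom I p = [:c:]" using assms by (meson degree_eq_zeroE)
  have "p = c" using poly_shom_1[of I p] c by simp
  moreover have "subst (\<lambda>i. if i \<in> I then 0 else Var i) p = c"
    using poly_shom[of I p 0] c by (simp cong: if_cong)
  ultimately show ?thesis by simp
qed

abbreviation tdeg :: "'k::comm_ring_1 mpoly \<Rightarrow> nat" where
  "tdeg p \<equiv> degree (shom UNIV p)"

lemma subst_zero_Const: "\<exists>c. subst (\<lambda>i. 0) p = Const c"
proof (induction p rule: mpoly_induct)
  case (Const c) show ?case by (intro exI[of _ c]) simp
next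
  case (Var i) show ?case by (intro exI[of _ 0]) simp
next
  case (add p q)
  then obtain a b where "subst (\<lambda>i. 0) p = Const a" "subst (\<lambda>i. 0) q = Const b" by auto
  then show ?case by (intro exI[of _ "a + b"]) simp
next
  case (mult p q)
  then obtain a b where "subst (\<lambda>i. 0) p = Const a" "subst (\<lambda>i. 0) q = Const b" by auto
  then show ?case by (intro exI[of _ "a * b"]) simp
qed

lemma tdeg_0_Const: "tdeg p = 0 \<Longrightarrow> \<exists>c. p = Const c"
  using degree_shom_0[of UNIV p] subst_zero_Const[of p] by simp

lemma tdeg_mult: "p \<noteq> 0 \<Longrightarrow> q \<noteq> 0 \<Longrightarrow> tdeg (p * q) = tdeg p + tdeg (q :: 'k::field mpoly)"
  by (simp add: degree_mult_eq)

lemma degv_mult: "p \<noteq> 0 \<Longrightarrow> q \<noteq> 0 \<Longrightarrow> degv v (p * q) = degv v p + degv v (q :: 'k::field mpoly)"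
  by (simp add: degree_mult_eq)

lemma unit_Const: "c \<noteq> 0 \<Longrightarrow> Const (c::'k::field) dvd 1"
  by (rule dvdI[of _ _ "Const (1 / c)"]) (simp flip: Const_hom)

lemma unit_iff: "(p :: 'k::field mpoly) dvd 1 \<longleftrightarrow> p \<noteq> 0 \<and> tdeg p = 0"
proof
  assume "p dvd 1"
  then obtain q where q: "p * q = 1" by (metis dvdE)
  then have "p \<noteq> 0" "q \<noteq> 0" by auto
  then have "tdeg p + tdeg q = tdeg (1 :: 'k mpoly)" using tdeg_mult[of p q] q by simp
  then show "p \<noteq> 0 \<and> tdeg p = 0" using \<open>p \<noteq> 0\<close> by simp
next
  assume "p \<noteq> 0 \<and> tdeg p = 0"
  then show "p dvd 1" using tdeg_0_Const[of p] by (auto simp: unit_Const)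
qed

lemma unit_iff_Const: "(p :: 'k::field mpoly) dvd 1 \<longleftrightarrow> (\<exists>c. c \<noteq> 0 \<and> p = Const c)"
  by (metis Const_eq_0_iff tdeg_0_Const unit_Const unit_iff)

lemma free_of_factor:
  fixes p q :: "'k::field mpoly"
  assumes "free_of v (p * q)" "p * q \<noteq> 0"
  shows "free_of v p"
  using assms degv_mult[of p q v] by (auto simp: free_of_iff_degv)

lemma in_vars_factor:
  fixes p q :: "'k::field mpoly"
  shows "in_vars N (p * q) \<Longrightarrow> p * q \<noteq> 0 \<Longrightarrow> in_vars N p"
  unfolding in_vars_iff_free_of using free_of_factor by blast

lemma ex_irreducible_factor:
  fixes c :: "'k::field mpoly"
  assumes "c \<noteq> 0" "\<not> c dvd 1"
  shows "\<exists>p d. irreducible p \<and> c = p * d"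
  using assms
proof (induction "tdeg c" arbitrary: c rule: less_induct)
  case less
  show ?case
  proof (cases "irreducible c")
    case True then show ?thesis by (intro exI[of _ c] exI[of _ 1]) simp
  next
    case False
    then obtain a b where ab: "c = a * b" "\<not> a dvd 1" "\<not> b dvd 1" using less.prems by (auto simp: irreducible_def)
    then have nz: "a \<noteq> 0" "b \<noteq> 0" using less.prems by auto
    then have "tdeg b \<noteq> 0" using ab(3) by (simp add: unit_iff)
    then have "tdeg a < tdeg c" using tdeg_mult[OF nz] ab(1) by simp
    then obtain p d where "irreducible p" "a = p * d" using less.hyps nz ab by blast
    then show ?thesis using ab by (intro exI[of _ p] exI[of _ "d * b"]) (simp add: mult.assoc)
  qed
qed

section \<open>Gauss's lemma, by induction on the number of variables\<close>

definition primes_in :: "nat \<Rightarrow> 'k::field itself \<Rightarrow> bool" where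
  "primes_in N T \<longleftrightarrow> (\<forall>p a b :: 'k mpoly. irreducible p \<longrightarrow> in_vars N p \<longrightarrow> in_vars N a \<longrightarrow> in_vars N b \<longrightarrow>
      p dvd a * b \<longrightarrow> p dvd a \<or> p dvd b)"

lemma dvd_iff_coeffs:
  fixes p a :: "'k::field mpoly"
  assumes "free_of v p"
  shows "p dvd a \<longleftrightarrow> (\<forall>k. p dvd coeff (toU v a) k)"
proof -
  have "p dvd a \<longleftrightarrow> [:p:] dvd toU v a"
  proof
    assume "p dvd a"
    then show "[:p:] dvd toU v a" using ring_map_dvd[OF ring_map_toU, of p a v] assms by (simp add: free_of_def)
  next
    assume "[:p:] dvd toU v a"
    then show "p dvd a" using ring_map_dvd[OF ring_map_poly, of "[:p:]" "toU v a" "Var v"] by (simp add: poly_toU)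
  qed
  then show ?thesis by (simp add: const_poly_dvd_iff)
qed

lemma in_vars_coeff_Suc: "in_vars (Suc N) p \<Longrightarrow> in_vars N (coeff (toU N p) k)"
  using in_vars_coeff[of "Suc N" p N k] free_of_coeff[of N p k]
  unfolding in_vars_iff_free_of by (metis Suc_leI le_neq_implies_less)

text \<open>Gauss's lemma: let \<open>i\<close> and \<open>j\<close> be the least indices at which
  \<open>p\<close> fails to divide the coefficients of \<open>a\<close> and \<open>b\<close> in the
  last variable. The coefficient of index \<open>i + j\<close> of the product is the product of
  these two plus multiples of \<open>p\<close>.\<close>

lemma prime_lower:
  fixes p a b :: "'k::field mpoly"
  assumes N: "primes_in N TYPE('k)" and p: "irreducible p" "in_vars N p"
    and ab: "in_vars (Suc N) a" "in_vars (Suc N) b" and dvd: "p dvd a * b"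
  shows "p dvd a \<or> p dvd b"
proof (rule ccontr)
  let ?a = "\<lambda>i. coeff (toU N a) i" and ?b = "\<lambda>i. coeff (toU N b) i"
  assume contra: "\<not> (p dvd a \<or> p dvd b)"
  have fr: "free_of N p" using p by (simp add: in_vars_iff_free_of)
  from contra obtain i0 j0 where "\<not> p dvd ?a i0" "\<not> p dvd ?b j0"
    using dvd_iff_coeffs[OF fr, of a] dvd_iff_coeffs[OF fr, of b] by blast
  define i where "i = (LEAST i. \<not> p dvd ?a i)"
  define j where "j = (LEAST j. \<not> p dvd ?b j)"
  have i: "\<not> p dvd ?a i"
    unfolding i_def by (rule LeastI[of "\<lambda>i. \<not> p dvd ?a i", OF \<open>\<not> p dvd ?a i0\<close>])
  have i': "p dvd ?a k" if "k < i" for k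
    using not_less_Least[of k "\<lambda>i. \<not> p dvd ?a i"] that unfolding i_def by simp
  have j: "\<not> p dvd ?b j"
    unfolding j_def by (rule LeastI[of "\<lambda>i. \<not> p dvd ?b i", OF \<open>\<not> p dvd ?b j0\<close>])
  have j': "p dvd ?b k" if "k < j" for k
    using not_less_Least[of k "\<lambda>i. \<not> p dvd ?b i"] that unfolding j_def by simp
  have "p dvd coeff (toU N (a * b)) (i + j)" using dvd dvd_iff_coeffs[OF fr, of "a * b"] by blast
  also have "coeff (toU N (a * b)) (i + j) = (\<Sum>k\<le>i+j. ?a k * ?b (i + j - k))" by (simp add: coeff_mult)
  also have "\<dots> = ?a i * ?b j + (\<Sum>k\<in>{..i+j}-{i}. ?a k * ?b (i + j - k))"
    by (subst sum.remove[of _ i]) auto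
  finally have "p dvd ?a i * ?b j + (\<Sum>k\<in>{..i+j}-{i}. ?a k * ?b (i + j - k))" .
  moreover have "p dvd (\<Sum>k\<in>{..i+j}-{i}. ?a k * ?b (i + j - k))"
  proof (rule dvd_sum)
    fix k assume "k \<in> {..i+j}-{i}"
    then have "k < i \<or> i + j - k < j" by auto
    then show "p dvd ?a k * ?b (i + j - k)" using i'[of k] j'[of "i + j - k"] by (auto intro: dvd_mult dvd_mult2)
  qed
  ultimately have "p dvd ?a i * ?b j" by (simp add: dvd_add_left_iff)
  then show False
    using N[unfolded primes_in_def, rule_format, OF p in_vars_coeff_Suc[OF ab(1)] in_vars_coeff_Suc[OF ab(2)]] i j by blast
qed

lemma irreducible_dvd_irreducible:
  fixes p q :: "'k::field mpoly"
  assumes "irreducible p" "irreducible q" "p dvd q" shows "q dvd p"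
proof -
  obtain r where r: "q = p * r" using assms(3) by (metis dvdE)
  then have "r dvd 1" using assms irreducibleD irreducible_not_unit by metis
  then obtain s where "r * s = 1" by (metis dvdE)
  then have "p = q * s" using r by (metis mult.assoc mult.right_neutral)
  then show ?thesis by simp
qed

text \<open>Irreducible factors of \<open>c\<close> are removed one at a time. Such a factor is
  prime by \<open>prime_lower\<close>, and it cannot divide \<open>p\<close>, being otherwise an
  associate of \<open>p\<close>, which involves the last variable; hence it divides the
  cofactor.\<close>

lemma cancel_lower:
  fixes p b c :: "'k::field mpoly"
  assumes N: "primes_in N TYPE('k)" and p: "irreducible p" "in_vars (Suc N) p" "\<not> in_vars N p"
    and "c \<noteq> 0" "in_vars N c" "in_vars (Suc N) b" "p dvd c * b"
  shows "p dvd b"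
  using assms(5-)
proof (induction "tdeg c" arbitrary: c rule: less_induct)
  case less
  show ?case
  proof (cases "c dvd 1")
    case True
    then obtain e where "1 = c * e" by (rule dvdE)
    then have "b = (c * e) * b" by simp
    then have "b = e * (c * b)" by (simp only: ac_simps)
    then show ?thesis using less.prems by (metis dvd_mult)
  next
    case False
    then obtain q d where q: "irreducible q" "c = q * d" using ex_irreducible_factor less.prems by blast
    have nz: "q \<noteq> 0" "d \<noteq> 0" using q less.prems by auto
    have iv: "in_vars N q" "in_vars N d" using less.prems in_vars_factor[of N q d] in_vars_factor[of N d q] q by (auto simp: mult.commute)
    obtain w where w: "c * b = p * w" using less.prems by (metis dvdE)
    show ?thesis
    proof (cases "b = 0")
      case False
      have "w * p = c * b" using w by (simp add: mult.commute)
      then have "in_vars (Suc N) (w * p)" "w * p \<noteq> 0"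
        using less.prems False in_vars_mono[OF less.prems(2), of "Suc N"] by simp_all
      then have "in_vars (Suc N) w" by (rule in_vars_factor)
      have "q dvd p * w" using w[symmetric] q by simp
      then have "q dvd p \<or> q dvd w" using prime_lower[OF N q(1) iv(1)] p \<open>in_vars (Suc N) w\<close> by blast
      moreover have "\<not> q dvd p"
      proof
        assume "q dvd p"
        then have "p dvd q" using irreducible_dvd_irreducible p q by blast
        then obtain r where "q = p * r" by (metis dvdE)
        then show False using in_vars_factor[of N p r] iv nz p by simp
      qed
      ultimately obtain w' where "w = q * w'" by (metis dvdE)
      then have "q * (d * b) = q * (p * w')" using w q by (simp add: ac_simps)
      then have "d * b = p * w'" using nz by simp
      moreover have "tdeg d < tdeg c" using tdeg_mult[OF nz] q nz by (auto simp: unit_iff irreducible_def)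
      ultimately show ?thesis using less.hyps[of d] nz iv less.prems by simp
    qed simp
  qed
qed

text \<open>Clears the denominator \<open>c\<close> of a factorization over the field of fractions:
  each irreducible factor of \<open>c\<close> divides \<open>q\<close> or \<open>g\<close> and is
  moved there.\<close>

lemma split_lower:
  fixes p q g c :: "'k::field mpoly"
  assumes N: "primes_in N TYPE('k)" and "c \<noteq> 0" "in_vars N c" "in_vars (Suc N) q" "in_vars (Suc N) g" "c * p = q * g"
  shows "\<exists>c1 c2 q' g'. in_vars N c1 \<and> in_vars N c2 \<and> p = q' * g' \<and> q = c1 * q' \<and> g = c2 * g'"
  using assms(2-)
proof (induction "tdeg c" arbitrary: c q g rule: less_induct)
  case less
  show ?case
  proof (cases "c dvd 1")
    case True
    then obtain k where k: "k \<noteq> 0" "c = Const k" by (auto simp: unit_iff_Const)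
    define e where "e = (Const (1 / k) :: 'k mpoly)"
    have e: "e * c = 1" using k by (simp add: e_def flip: Const_hom)
    have "p = (e * c) * p" by (simp add: e)
    also have "\<dots> = (e * q) * g" using less.prems(5) by (simp add: mult.assoc)
    finally have 1: "p = (e * q) * g" .
    have "q = (e * c) * q" by (simp add: e)
    then have 2: "q = c * (e * q)" by (simp only: ac_simps)
    show ?thesis
      by (intro exI[of _ c] exI[of _ 1] exI[of _ "e * q"] exI[of _ g]) (use 1 2 less.prems in simp)
  next
    case False
    then obtain r d where r: "irreducible r" "c = r * d" using ex_irreducible_factor less.prems by blast
    have nz: "r \<noteq> 0" "d \<noteq> 0" using r less.prems by auto
    have iv: "in_vars N r" "in_vars N d" using less.prems in_vars_factor[of N r d] in_vars_factor[of N d r] r by (auto simp: mult.commute)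
    have td: "tdeg d < tdeg c" using tdeg_mult[OF nz] r nz by (auto simp: unit_iff irreducible_def)
    have "r dvd q * g" using less.prems(5)[symmetric] r by simp
    then consider q' where "q = r * q'" | g' where "g = r * g'"
      using prime_lower[OF N r(1) iv(1) less.prems(3,4)] by (metis dvdE)
    then show ?thesis
    proof cases
      case 1
      then have "r * (d * p) = r * (q' * g)" using less.prems(5) r by (simp add: ac_simps)
      then have eq: "d * p = q' * g" using nz by simp
      have "in_vars (Suc N) q'" using 1 in_vars_factor[of "Suc N" q' r] less.prems by (cases "q' = 0") (auto simp: mult.commute nz)
      then obtain c1 c2 q'' g'' where *: "in_vars N c1" "in_vars N c2" "p = q'' * g''" "q' = c1 * q''" "g = c2 * g''"
        using less.hyps[OF td nz(2) iv(2) _ less.prems(4) eq] by blast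
      show ?thesis by (intro exI[of _ "r * c1"] exI[of _ c2] exI[of _ q''] exI[of _ g'']) (use * 1 iv in \<open>simp add: mult.assoc\<close>)
    next
      case 2
      then have "r * (d * p) = r * (q * g')" using less.prems(5) r by (simp add: ac_simps)
      then have eq: "d * p = q * g'" using nz by simp
      have "in_vars (Suc N) g'" using 2 in_vars_factor[of "Suc N" g' r] less.prems by (cases "g' = 0") (auto simp: mult.commute nz)
      then obtain c1 c2 q'' g'' where *: "in_vars N c1" "in_vars N c2" "p = q'' * g''" "q = c1 * q''" "g' = c2 * g''"
        using less.hyps[OF td nz(2) iv(2) less.prems(3) _ eq] by blast
      show ?thesis by (intro exI[of _ c1] exI[of _ "r * c2"] exI[of _ q''] exI[of _ g'']) (use * 2 iv in \<open>simp add: mult.assoc\<close>)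
    qed
  qed
qed

text \<open>Multiplication by powers of the leading coefficient of \<open>g\<close> replaces
  division over the field of fractions of the lower polynomials.\<close>

lemma pseudo_division:
  fixes f g :: "'k::field mpoly"
  assumes "g \<noteq> 0" "in_vars (Suc N) g" "in_vars (Suc N) f"
  shows "\<exists>c q r. c \<noteq> 0 \<and> in_vars N c \<and> in_vars (Suc N) q \<and> c * f = q * g + r \<and> (r = 0 \<or> degv N r < degv N g)"
  using assms(3)
proof (induction "degv N f" arbitrary: f rule: less_induct)
  case less
  show ?case
  proof (cases "degv N f < degv N g \<or> f = 0")
    case True
    then show ?thesis by (intro exI[of _ 1] exI[of _ 0] exI[of _ f]) auto
  next
    case False
    define a where "a = lead_coeff (toU N g)"
    define b where "b = lead_coeff (toU N f)"
    define e where "e = degv N f - degv N g"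
    define f1 where "f1 = a * f - b * Var N ^ e * g"
    have ab: "in_vars N a" "in_vars N b" unfolding a_def b_def using in_vars_coeff_Suc assms less.prems by auto
    have ab': "in_vars (Suc N) a" "in_vars (Suc N) b" using ab in_vars_mono le_SucI by blast+
    have nz: "a \<noteq> 0" "b \<noteq> 0" using assms False by (simp_all add: a_def b_def)
    have tab: "toU N a = [:a:]" "toU N b = [:b:]" using ab by (simp_all add: in_vars_iff_free_of free_of_def)
    have f1: "in_vars (Suc N) f1" unfolding f1_def using assms less.prems ab' by simp
    have tf1: "toU N f1 = smult a (toU N f) - smult b (monom 1 e * toU N g)"
      by (simp add: f1_def tab toU_Var monom_altdef)
    have e: "degv N f = e + degv N g" using False by (simp add: e_def)
    have deg1: "degv N f1 \<le> degv N f"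
      unfolding tf1 using e
      by (intro degree_diff_le) (auto intro!: order.trans[OF degree_smult_le] simp: degree_mult_eq assms degree_monom_eq)
    have co: "coeff (toU N f1) (degv N f) = 0"
    proof -
      have "coeff (toU N f1) (e + degv N g) = 0"
        unfolding tf1 by (simp add: coeff_monom_mult a_def b_def e)
      then show ?thesis by (simp add: e)
    qed
    have "f1 = 0 \<or> degv N f1 < degv N f \<or> degv N f1 = 0"
      using deg1 co by (metis leading_coeff_0_iff le_neq_implies_less toU_eq_0_iff)
    show ?thesis
    proof (cases "degv N f1 < degv N f")
      case True
      then obtain c q r where *: "c \<noteq> 0" "in_vars N c" "in_vars (Suc N) q" "c * f1 = q * g + r" "r = 0 \<or> degv N r < degv N g"
        using less.hyps[OF _ f1] by blast
      have c': "in_vars (Suc N) c" using * in_vars_mono le_SucI by blast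
      have "(c * a) * f = (q + c * b * Var N ^ e) * g + r" using *(4) by (simp add: f1_def algebra_simps)
      then show ?thesis using * nz ab ab' c'
        by (intro exI[of _ "c * a"] exI[of _ "q + c * b * Var N ^ e"] exI[of _ r]) simp
    next
      case False
      then have "f1 = 0" using deg1 co by (metis leading_coeff_0_iff le_neq_implies_less toU_eq_0_iff)
      then have "a * f = b * Var N ^ e * g + 0" by (simp add: f1_def)
      then show ?thesis using nz ab ab' by (intro exI[of _ a] exI[of _ "b * Var N ^ e"] exI[of _ 0]) simp
    qed
  qed
qed

text \<open>Bezout over the field of fractions: an element \<open>g\<close> of least degree in the
  ideal of \<open>p\<close> and \<open>a\<close> divides both up to lower factors. If
  \<open>g\<close> still involved the last variable, \<open>split_lower\<close> and the
  irreducibility of \<open>p\<close> would give \<open>p dvd g\<close>, hence \<open>p dvd a\<close>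
  after cancelling.\<close>

lemma elimination_aux:
  fixes p a :: "'k::field mpoly"
  assumes N: "primes_in N TYPE('k)" and p: "irreducible p" "in_vars (Suc N) p" "\<not> in_vars N p"
    and a: "in_vars (Suc N) a" "\<not> p dvd a"
  shows "\<exists>R x y. R \<noteq> 0 \<and> in_vars N R \<and> R = x * p + y * a \<and> in_vars (Suc N) x \<and> in_vars (Suc N) y"
proof -
  define J where "J = {g. g \<noteq> 0 \<and> (\<exists>x y. g = x * p + y * a \<and> in_vars (Suc N) x \<and> in_vars (Suc N) y)}"
  have pJ: "p \<in> J" 
  proof -
    have "p \<noteq> 0" using p by (simp add: irreducible_def)
    moreover have "p = 1 * p + 0 * a" by simp
    ultimately show ?thesis unfolding J_def using in_vars_simps(1,2) by blast
  qed
  obtain g where g: "g \<in> J" "\<And>g'. g' \<in> J \<Longrightarrow> degv N g \<le> degv N g'"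
    using ex_has_least_nat[of "\<lambda>g. g \<in> J" p "degv N"] pJ by blast
  then obtain x y where xy: "g = x * p + y * a" "in_vars (Suc N) x" "in_vars (Suc N) y" "g \<noteq> 0" by (auto simp: J_def)
  have gv: "in_vars (Suc N) g" using xy p a by simp
  have dv: "\<exists>c q. c \<noteq> 0 \<and> in_vars N c \<and> in_vars (Suc N) q \<and> c * f = q * g"
    if f: "in_vars (Suc N) f" "f = x' * p + y' * a" "in_vars (Suc N) x'" "in_vars (Suc N) y'" for f x' y'
  proof -
    obtain c q r where *: "c \<noteq> 0" "in_vars N c" "in_vars (Suc N) q" "c * f = q * g + r" "r = 0 \<or> degv N r < degv N g"
      using pseudo_division[OF xy(4) gv f(1)] by blast
    have c': "in_vars (Suc N) c" using * in_vars_mono le_SucI by blast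
    have "r = (c * x' - q * x) * p + (c * y' - q * y) * a"
      using *(4) unfolding f(2) xy(1) by (simp add: algebra_simps)
    moreover have "in_vars (Suc N) (c * x' - q * x)" "in_vars (Suc N) (c * y' - q * y)" using c' * f xy by simp_all
    ultimately have "r = 0 \<or> r \<in> J" unfolding J_def by blast
    then have "r = 0" using g(2)[of r] *(5) by auto
    then show ?thesis using * by auto
  qed
  have "degv N g = 0"
  proof (rule ccontr)
    assume deg: "degv N g \<noteq> 0"
    obtain c q where cq: "c \<noteq> 0" "in_vars N c" "in_vars (Suc N) q" "c * p = q * g"
      using dv[OF p(2), of 1 0] by auto
    obtain c1 c2 q' g' where s: "in_vars N c1" "in_vars N c2" "p = q' * g'" "q = c1 * q'" "g = c2 * g'"
      using split_lower[OF N cq(1,2,3) gv cq(4)] by blast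
    have nz: "c2 \<noteq> 0" "g' \<noteq> 0" using s xy by auto
    have "\<not> g' dvd 1"
    proof
      assume "g' dvd 1"
      then obtain k where "g' = Const k" by (auto simp: unit_iff_Const)
      then have "in_vars N g" using s by simp
      then show False using deg by (simp add: in_vars_iff_free_of free_of_iff_degv)
    qed
    then have "q' dvd 1" using s(3) p(1) irreducibleD by blast
    then obtain k where "k * q' = 1" by (metis dvdE mult.commute)
    then have "k * p = g'" using s(3) by (metis mult.assoc mult.left_neutral)
    then have "p dvd g" using s by (metis dvd_triv_right dvd_mult)
    moreover obtain d w where dw: "d \<noteq> 0" "in_vars N d" "d * a = w * g" using dv[OF a(1), of 0 1] by auto
    ultimately have "p dvd d * a" by simp
    then have "p dvd a" using cancel_lower[OF N p dw(1,2) a(1)] by blast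
    then show False using a by blast
  qed
  then have "in_vars N g" using gv unfolding in_vars_iff_free_of
    by (metis Suc_leI free_of_iff_degv le_neq_implies_less)
  then show ?thesis using xy by blast
qed

text \<open>If \<open>p\<close> involves the last variable and does not divide \<open>a\<close>,
  some \<open>R = x * p + y * a\<close> is free of that variable. Then \<open>p\<close> divides
  \<open>R * b\<close>, and \<open>R\<close> can be cancelled.\<close>

lemma primes_in: "primes_in N TYPE('k::field)"
proof (induction N)
  case 0
  show ?case unfolding primes_in_def
  proof (intro allI impI)
    fix p a b :: "'k mpoly" assume p: "irreducible p" "in_vars 0 p"
    have "subst (\<lambda>i. 0) p = p" using subst_cong[OF p(2), of "\<lambda>i. 0" Var] by simp
    then obtain c where "p = Const c" using subst_zero_Const[of p] by metis
    then have False using p unit_iff_Const[of p] by (auto simp: irreducible_def)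
    then show "p dvd a \<or> p dvd b" ..
  qed
next
  case (Suc N)
  show ?case unfolding primes_in_def
  proof (intro allI impI)
    fix p a b :: "'k mpoly"
    assume p: "irreducible p" "in_vars (Suc N) p" and ab: "in_vars (Suc N) a" "in_vars (Suc N) b" "p dvd a * b"
    show "p dvd a \<or> p dvd b"
    proof (cases "in_vars N p")
      case True then show ?thesis using prime_lower[OF Suc p(1)] ab by blast
    next
      case pN: False
      show ?thesis
      proof (cases "p dvd a")
        case False
        then obtain R x y where R: "R \<noteq> 0" "in_vars N R" "R = x * p + y * a"
          using elimination_aux[OF Suc p pN ab(1)] by blast
        have "R * b = x * b * p + y * (a * b)" using R by (simp add: algebra_simps)
        then have "p dvd R * b" using ab by simp
        then show ?thesis using cancel_lower[OF Suc p pN R(1,2) ab(2)] by blast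
      qed simp
    qed
  qed
qed

lemma irreducible_dvd_mult_iff:
  fixes p :: "'k::field mpoly"
  assumes "irreducible p" shows "p dvd a * b \<longleftrightarrow> p dvd a \<or> p dvd b"
proof
  assume d: "p dvd a * b"
  obtain N1 N2 N3 where "in_vars N1 p" "in_vars N2 a" "in_vars N3 b" using ex_in_vars by metis
  then have "in_vars (max N1 (max N2 N3)) p" "in_vars (max N1 (max N2 N3)) a" "in_vars (max N1 (max N2 N3)) b"
    by (auto elim!: in_vars_mono)
  then show "p dvd a \<or> p dvd b" using primes_in d assms unfolding primes_in_def by blast
qed auto

lemma ring_map_irreducible:
  fixes f g :: "'k::field mpoly \<Rightarrow> 'k mpoly"
  assumes "ring_map f" "ring_map g" "\<And>p. g (f p) = p" "\<And>p. f (g p) = p" "irreducible p"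
  shows "irreducible (f p)"
proof (rule irreducibleI)
  show "f p \<noteq> 0" using assms(3)[of p] assms(5) ring_mapD(1)[OF assms(2)] by (auto simp: irreducible_def)
  show "\<not> f p dvd 1" using ring_map_dvd[OF assms(2), of "f p" 1] assms(3)[of p] assms(5) ring_mapD(2)[OF assms(2)] by (auto simp: irreducible_def)
  fix a b assume "f p = a * b"
  then have "p = g a * g b" using assms(3)[of p] ring_mapD(4)[OF assms(2)] by metis
  then have "g a dvd 1 \<or> g b dvd 1" using assms(5) irreducibleD by blast
  then show "a dvd 1 \<or> b dvd 1"
    using ring_map_dvd[OF assms(1), of "g a" 1] ring_map_dvd[OF assms(1), of "g b" 1] assms(4) ring_mapD(2)[OF assms(1)] by auto
qed

text \<open>The elimination step is carried out in the last variable, so \<open>v\<close> is first exchanged with it.\<close>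

lemma elimination:
  fixes p a :: "'k::field mpoly"
  assumes p: "irreducible p" "\<not> free_of v p" and a: "\<not> p dvd a"
  shows "\<exists>R x y. R \<noteq> 0 \<and> free_of v R \<and> R = x * p + y * a"
proof -
  obtain N1 N2 where "in_vars N1 p" "in_vars N2 a" using ex_in_vars by metis
  define N where "N = max v (max N1 N2)"
  have N: "in_vars (Suc N) p" "in_vars (Suc N) a" "v \<le> N"
    using \<open>in_vars N1 p\<close> \<open>in_vars N2 a\<close> by (auto simp: N_def elim!: in_vars_mono)
  define \<sigma> :: "'k mpoly \<Rightarrow> 'k mpoly" where "\<sigma> = subst (\<lambda>i. Var (if i = v then N else if i = N then v else i))"
  have inv: "\<sigma> (\<sigma> q) = q" for q
  proof -
    have "\<sigma> (\<sigma> q) = subst Var q" unfolding \<sigma>_def subst_subst by (rule arg_cong[of _ _ "\<lambda>f. subst f q"]) auto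
    then show ?thesis by simp
  qed
  have rm: "ring_map \<sigma>" unfolding \<sigma>_def by (rule ring_map_subst)
  have iv: "in_vars (Suc N) (\<sigma> q)" if "in_vars (Suc N) q" for q
    unfolding \<sigma>_def by (rule in_vars_subst[OF _ that]) (use N in auto)
  have fr: "free_of v (\<sigma> q)" if "in_vars N q" for q
    unfolding \<sigma>_def by (rule free_of_subst[OF _ that]) (use N in \<open>auto simp: free_of_Var\<close>)
  have "\<not> in_vars N (\<sigma> p)" using fr[of "\<sigma> p"] p inv by auto
  moreover have "\<not> \<sigma> p dvd \<sigma> a" using ring_map_dvd[OF rm, of "\<sigma> p" "\<sigma> a"] inv a by auto
  ultimately obtain R x y where R: "R \<noteq> 0" "in_vars N R" "R = x * \<sigma> p + y * \<sigma> a"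
    using elimination_aux[OF primes_in ring_map_irreducible[OF rm rm inv inv p(1)] iv[OF N(1)] _ iv[OF N(2)]] by blast
  have "\<sigma> R = \<sigma> x * p + \<sigma> y * a" using R(3) by (simp add: ring_mapD[OF rm] inv)
  moreover have "\<sigma> R \<noteq> 0" using inv[of R] R(1) ring_mapD(1)[OF rm] by metis
  ultimately show ?thesis using fr[OF R(2)] by blast
qed

subsection \<open>Linear algebra in coordinates\<close>

definition vscale :: "'k::comm_ring_1 \<Rightarrow> (nat \<Rightarrow> 'k) \<Rightarrow> nat \<Rightarrow> 'k" (infixr "*v" 75) where
  "t *v x = (\<lambda>i. t * x i)"

lemma vscale_apply [simp]: "(t *v x) i = t * x i" by (simp add: vscale_def)

lemma vscale_simps [simp]: "1 *v x = x" "0 *v x = 0" "t *v 0 = 0" "s *v (t *v x) = (s * t) *v x"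
  by (auto simp: mult.assoc)

definition uvec :: "nat \<Rightarrow> nat \<Rightarrow> 'k::comm_ring_1" where
  "uvec i = (\<lambda>j. if j = i then 1 else 0)"

lemma sum_fun_apply: "(\<Sum>i\<in>A. f i) j = (\<Sum>i\<in>A. f i j)" for f :: "'a \<Rightarrow> 'b \<Rightarrow> 'c::comm_monoid_add"
  by (induction A rule: infinite_finite_induct) auto

lemma sum_uvec: "(\<Sum>i<N. x i * uvec i j) = (if j < N then x j else 0)"
  by (simp add: uvec_def if_distrib[of "(*) _"] cong: if_cong)

lemma homogeneous_system:
  fixes f :: "'a \<Rightarrow> 'b \<Rightarrow> 'k::field"
  assumes "finite I" "finite J" "card I < card J"
  shows "\<exists>x. (\<exists>j\<in>J. x j \<noteq> 0) \<and> (\<forall>i\<in>I. (\<Sum>j\<in>J. x j * f j i) = 0)"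
  using assms
proof (induction I arbitrary: J f rule: finite_induct)
  case empty
  then obtain j where "j \<in> J" by fastforce
  then show ?case by (intro exI[of _ "\<lambda>_. 1"]) auto
next
  case (insert i I)
  show ?case
  proof (cases "\<forall>j\<in>J. f j i = 0")
    case True
    obtain x where "\<exists>j\<in>J. x j \<noteq> 0" "\<forall>i\<in>I. (\<Sum>j\<in>J. x j * f j i) = 0"
      using insert.IH[of J f] insert.prems insert.hyps by (metis Suc_lessD card_insert_disjoint)
    then show ?thesis using True by (intro exI[of _ x]) auto
  next
    case False
    then obtain j0 where j0: "j0 \<in> J" "f j0 i \<noteq> 0" by auto
    define J' where "J' = J - {j0}"
    have J: "J = insert j0 J'" "j0 \<notin> J'" "finite J'" using j0 insert by (auto simp: J'_def)
    have "card I < card J'" using insert J by simp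
    then obtain x where x: "\<exists>j\<in>J'. x j \<noteq> 0" "\<And>i'. i' \<in> I \<Longrightarrow> (\<Sum>j\<in>J'. x j * (f j i' - f j i / f j0 i * f j0 i')) = 0"
      using insert.IH[of J' "\<lambda>j i'. f j i' - f j i / f j0 i * f j0 i'"] J by auto
    define s where "s = (\<Sum>j\<in>J'. x j * f j i)"
    define x' where "x' = x(j0 := - s / f j0 i)"
    have *: "(\<Sum>j\<in>J. x' j * f j k) = (\<Sum>j\<in>J'. x j * f j k) - s / f j0 i * f j0 k" for k
    proof -
      have "(\<Sum>j\<in>J'. x' j * f j k) = (\<Sum>j\<in>J'. x j * f j k)"
        by (rule sum.cong) (use J in \<open>auto simp: x'_def\<close>)
      then show ?thesis using J by (simp add: x'_def)
    qed
    have "(\<Sum>j\<in>J. x' j * f j k) = 0" if "k \<in> insert i I" for k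
    proof (cases "k = i")
      case True then show ?thesis unfolding * using j0 by (simp add: s_def)
    next
      case False
      have "(\<Sum>j\<in>J'. x j * (f j k - f j i / f j0 i * f j0 k)) = (\<Sum>j\<in>J'. x j * f j k) - s / f j0 i * f j0 k"
        unfolding s_def sum_divide_distrib sum_distrib_right by (simp add: algebra_simps sum_subtractf)
      then show ?thesis unfolding * using x(2)[of k] False that by simp
    qed
    moreover have "\<exists>j\<in>J. x' j \<noteq> 0" using x(1) J by (auto simp: x'_def)
    ultimately show ?thesis by blast
  qed
qed

text \<open>Vectors are functions on all of \<open>nat\<close> of which only the entries below
  \<open>N\<close> matter, so relations are required in these entries only.\<close>

definition indep_family :: "nat \<Rightarrow> nat \<Rightarrow> (nat \<Rightarrow> nat \<Rightarrow> 'k::field) \<Rightarrow> bool" where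
  "indep_family N d f \<longleftrightarrow> (\<forall>x. (\<forall>i<N. (\<Sum>j<d. x j * f j i) = 0) \<longrightarrow> (\<forall>j<d. x j = 0))"

lemma indep_familyD: "indep_family N d f \<Longrightarrow> (\<And>i. i < N \<Longrightarrow> (\<Sum>j<d. x j * f j i) = 0) \<Longrightarrow> j < d \<Longrightarrow> x j = 0"
  by (auto simp: indep_family_def)

lemma indep_family_spans:
  fixes f :: "nat \<Rightarrow> nat \<Rightarrow> 'k::field"
  assumes "indep_family N N f"
  shows "\<exists>x. \<forall>i<N. z i = (\<Sum>j<N. x j * f j i)"
proof -
  define f' where "f' = f(N := z)"
  obtain x j where x: "j < Suc N" "x j \<noteq> 0" "\<And>i. i < N \<Longrightarrow> (\<Sum>j<Suc N. x j * f' j i) = 0"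
    using homogeneous_system[of "{..<N}" "{..<Suc N}" f'] by auto
  have *: "(\<Sum>j<N. x j * f j i) + x N * z i = 0" if "i < N" for i
    using x(3)[OF that] by (simp add: f'_def)
  have "x N \<noteq> 0"
  proof
    assume "x N = 0"
    then have "x j = 0" if "j < N" for j using indep_familyD[OF assms, of x] * that by simp
    then show False using x \<open>x N = 0\<close> by (auto simp: less_Suc_eq)
  qed
  then have "z i = (\<Sum>j<N. - x j / x N * f j i)" if "i < N" for i
    using *[OF that] by (simp add: sum_negf add_eq_0_iff field_simps flip: sum_divide_distrib)
  then show ?thesis by (intro exI[of _ "\<lambda>j. - x j / x N"]) simp
qed

text \<open>Otherwise all \<open>N\<close> unit vectors would be combinations of
  \<open>d < N\<close> vectors; a nontrivial relation between their coefficient vectors would be a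
  nontrivial relation between unit vectors.\<close>

lemma indep_family_extend_one:
  fixes f :: "nat \<Rightarrow> nat \<Rightarrow> 'k::field"
  assumes f: "indep_family N d f" and "d < N"
  shows "\<exists>i. indep_family N (Suc d) (f(d := uvec i))"
proof (rule ccontr)
  assume contra: "\<not> ?thesis"
  have "\<exists>a. \<forall>k<N. uvec i k = (\<Sum>j<d. a j * f j k)" if "i < N" for i
  proof -
    obtain x j where x: "j < Suc d" "x j \<noteq> 0" "\<And>k. k < N \<Longrightarrow> (\<Sum>j<Suc d. x j * (f(d := uvec i)) j k) = 0"
      using contra unfolding indep_family_def by blast
    have *: "(\<Sum>j<d. x j * f j k) + x d * uvec i k = 0" if "k < N" for k
      using x(3)[OF that] by simp
    have "x d \<noteq> 0"
    proof
      assume "x d = 0"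
      then have "x j = 0" if "j < d" for j using indep_familyD[OF f, of x] * that by simp
      then show False using x \<open>x d = 0\<close> by (auto simp: less_Suc_eq)
    qed
    then have "uvec i k = (\<Sum>j<d. - x j / x d * f j k)" if "k < N" for k
      using *[OF that] by (simp add: sum_negf add_eq_0_iff field_simps flip: sum_divide_distrib)
    then show ?thesis by (intro exI[of _ "\<lambda>j. - x j / x d"]) simp
  qed
  then obtain a where a: "\<And>i k. i < N \<Longrightarrow> k < N \<Longrightarrow> uvec i k = (\<Sum>j<d. a i j * f j k)" by metis
  obtain y i where y: "i < N" "y i \<noteq> 0" "\<And>j. j < d \<Longrightarrow> (\<Sum>i<N. y i * a i j) = 0"
    using homogeneous_system[of "{..<d}" "{..<N}" a] \<open>d < N\<close> by auto
  have "y i = (\<Sum>k<N. y k * uvec k i)" using y(1) by (simp add: sum_uvec)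
  also have "\<dots> = (\<Sum>k<N. \<Sum>j<d. y k * a k j * f j i)"
    by (rule sum.cong) (use a y(1) in \<open>auto simp: sum_distrib_left mult.assoc\<close>)
  also have "\<dots> = (\<Sum>j<d. (\<Sum>k<N. y k * a k j) * f j i)"
    by (subst sum.swap) (simp add: sum_distrib_right)
  also have "\<dots> = 0" using y(3) by simp
  finally show False using y(2) by simp
qed

lemma indep_family_extend:
  fixes f :: "nat \<Rightarrow> nat \<Rightarrow> 'k::field"
  assumes "indep_family N d f" "d \<le> N"
  shows "\<exists>f'. indep_family N N f' \<and> (\<forall>j<d. f' j = f j)"
  using assms
proof (induction "N - d" arbitrary: d f)
  case 0 then show ?case by auto
next
  case (Suc m)
  have "d < N" using Suc.hyps(2) by simp
  then obtain i where "indep_family N (Suc d) (f(d := uvec i))" using indep_family_extend_one[of N d f] Suc.prems by blast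
  moreover have "m = N - Suc d" "Suc d \<le> N" using Suc.hyps(2) by simp_all
  ultimately obtain f' where "indep_family N N f'" "\<forall>j<Suc d. f' j = (f(d := uvec i)) j"
    using Suc.hyps(1)[of "Suc d" "f(d := uvec i)"] by blast
  then show ?case by (intro exI[of _ f']) auto
qed

text \<open>\<open>b\<close> is the inverse matrix. Expressing unit vectors by the rows of
  \<open>l\<close> shows that its columns are independent as well, hence span.\<close>

lemma dual_family:
  fixes l :: "nat \<Rightarrow> nat \<Rightarrow> 'k::field"
  assumes "indep_family N N l"
  shows "\<exists>b. \<forall>i<N. \<forall>j<N. (\<Sum>k<N. l i k * b j k) = (if i = j then 1 else 0)"
proof -
  have "\<exists>a. \<forall>k<N. uvec i k = (\<Sum>j<N. a j * l j k)" for i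
    using indep_family_spans[OF assms] by auto
  then obtain a where a: "\<And>i k. k < N \<Longrightarrow> uvec i k = (\<Sum>j<N. a i j * l j k)" by metis
  have "indep_family N N (\<lambda>k i. l i k)" unfolding indep_family_def
  proof (intro allI impI)
    fix x j assume x: "\<forall>i<N. (\<Sum>k<N. x k * l i k) = 0" and j: "j < N"
    have "x j = (\<Sum>k<N. x k * uvec j k)" using j by (simp add: uvec_def if_distrib[of "(*) _"] cong: if_cong)
    also have "\<dots> = (\<Sum>k<N. \<Sum>i<N. a j i * (x k * l i k))"
      by (rule sum.cong) (auto simp: a sum_distrib_left ac_simps)
    also have "\<dots> = (\<Sum>i<N. a j i * (\<Sum>k<N. x k * l i k))"
      by (subst sum.swap) (simp add: sum_distrib_left)
    also have "\<dots> = 0" using x by simp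
    finally show "x j = 0" .
  qed
  then have "\<exists>b. \<forall>i<N. uvec j i = (\<Sum>k<N. b k * l i k)" for j
    using indep_family_spans by blast
  then obtain b where b: "\<And>j i. i < N \<Longrightarrow> uvec j i = (\<Sum>k<N. b j k * l i k)" by metis
  show ?thesis by (intro exI[of _ b]) (auto simp: uvec_def mult.commute[of "l _ _"] simp flip: b)
qed

subsection \<open>Polynomial functions and first-order jets\<close>

definition PF :: "nat \<Rightarrow> ((nat \<Rightarrow> 'k::comm_ring_1) \<Rightarrow> 'k) \<Rightarrow> bool" where
  "PF n f \<longleftrightarrow> (\<exists>p. in_vars n p \<and> (\<forall>x. f x = eval x p))"

lemma PF_const [intro!]: "PF n (\<lambda>x. c)"
  unfolding PF_def by (intro exI[of _ "Const c"]) simp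

lemma PF_coord [intro]: "i < n \<Longrightarrow> PF n (\<lambda>x. x i)"
  unfolding PF_def by (intro exI[of _ "Var i"]) simp

lemma PF_add [intro!]: "PF n f \<Longrightarrow> PF n g \<Longrightarrow> PF n (\<lambda>x. f x + g x)"
  unfolding PF_def
proof (elim exE conjE)
  fix p q assume "in_vars n p" "in_vars n q" "\<forall>x. f x = eval x p" "\<forall>x. g x = eval x q"
  then show "\<exists>p. in_vars n p \<and> (\<forall>x. f x + g x = eval x p)" by (intro exI[of _ "p + q"]) simp
qed

lemma PF_mult [intro!]: "PF n f \<Longrightarrow> PF n g \<Longrightarrow> PF n (\<lambda>x. f x * g x)"
  unfolding PF_def
proof (elim exE conjE)
  fix p q assume "in_vars n p" "in_vars n q" "\<forall>x. f x = eval x p" "\<forall>x. g x = eval x q"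
  then show "\<exists>p. in_vars n p \<and> (\<forall>x. f x * g x = eval x p)" by (intro exI[of _ "p * q"]) simp
qed

lemma PF_diff [intro!]: "PF n f \<Longrightarrow> PF n g \<Longrightarrow> PF n (\<lambda>x. f x - g x)"
  unfolding PF_def
proof (elim exE conjE)
  fix p q assume "in_vars n p" "in_vars n q" "\<forall>x. f x = eval x p" "\<forall>x. g x = eval x q"
  then show "\<exists>p. in_vars n p \<and> (\<forall>x. f x - g x = eval x p)" by (intro exI[of _ "p - q"]) simp
qed

lemma PF_uminus [intro!]: "PF n f \<Longrightarrow> PF n (\<lambda>x. - f x)"
  using PF_diff[OF PF_const[of n 0]] by simp

lemma PF_sum [intro!]: "(\<And>i. i \<in> A \<Longrightarrow> PF n (f i)) \<Longrightarrow> PF n (\<lambda>x. \<Sum>i\<in>A. f i x)"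
  by (induction A rule: infinite_finite_induct) (auto intro: PF_const)

text \<open>Derivatives at 0 are taken formally, as the linear coefficient of a polynomial
  representing the function; this makes sense over any field.\<close>

definition jet :: "('k::comm_ring_1 \<Rightarrow> 'k) \<Rightarrow> 'k \<Rightarrow> 'k \<Rightarrow> bool" where
  "jet f a b \<longleftrightarrow> (\<exists>P. f = poly P \<and> coeff P 0 = a \<and> coeff P 1 = b)"

lemma jet_const: "jet (\<lambda>e. c) c 0"
  unfolding jet_def by (intro exI[of _ "[:c:]"]) auto

lemma jet_id: "jet (\<lambda>e. e) 0 1"
  unfolding jet_def by (intro exI[of _ "[:0, 1:]"]) auto

lemma jet_add: "jet f a b \<Longrightarrow> jet g c d \<Longrightarrow> jet (\<lambda>e. f e + g e) (a + c) (b + d)"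
proof -
  assume "jet f a b" "jet g c d"
  then obtain P R where "f = poly P" "coeff P 0 = a" "coeff P 1 = b" "g = poly R" "coeff R 0 = c" "coeff R 1 = d"
    unfolding jet_def by blast
  then show ?thesis unfolding jet_def by (intro exI[of _ "P + R"]) (simp add: fun_eq_iff)
qed

lemma jet_diff: "jet f a b \<Longrightarrow> jet g c d \<Longrightarrow> jet (\<lambda>e. f e - g e) (a - c) (b - d)"
proof -
  assume "jet f a b" "jet g c d"
  then obtain P R where "f = poly P" "coeff P 0 = a" "coeff P 1 = b" "g = poly R" "coeff R 0 = c" "coeff R 1 = d"
    unfolding jet_def by blast
  then show ?thesis unfolding jet_def by (intro exI[of _ "P - R"]) (simp add: fun_eq_iff)
qed

lemma jet_mult: "jet f a b \<Longrightarrow> jet g c d \<Longrightarrow> jet (\<lambda>e. f e * g e) (a * c) (a * d + b * c)"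
proof -
  assume "jet f a b" "jet g c d"
  then obtain P R where "f = poly P" "coeff P 0 = a" "coeff P 1 = b" "g = poly R" "coeff R 0 = c" "coeff R 1 = d"
    unfolding jet_def by blast
  then show ?thesis unfolding jet_def by (intro exI[of _ "P * R"]) (simp add: coeff_mult fun_eq_iff)
qed

lemma jet_sum: "(\<And>i. i \<in> A \<Longrightarrow> jet (f i) (a i) (b i)) \<Longrightarrow> jet (\<lambda>e. \<Sum>i\<in>A. f i e) (sum a A) (sum b A)"
  by (induction A rule: infinite_finite_induct) (simp_all add: jet_const jet_add)

lemma jet_unique:
  fixes f :: "'k::field_char_0 \<Rightarrow> 'k"
  shows "jet f a b \<Longrightarrow> jet f c d \<Longrightarrow> a = c \<and> b = d"
  unfolding jet_def by (auto simp: poly_eq_poly_eq_iff)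

lemma jet_eq: "jet f a b \<Longrightarrow> a = c \<Longrightarrow> b = d \<Longrightarrow> jet f c d" by simp

section \<open>Polynomial curves and directional derivatives\<close>

abbreviation curve :: "(nat \<Rightarrow> 'k::comm_ring_1 poly) \<Rightarrow> 'k mpoly \<Rightarrow> 'k poly" where
  "curve z \<equiv> evalh (\<lambda>c. [:c:]) z"

lemma ring_map_curve: "ring_map (curve z)" by (simp add: ring_map_evalh ring_map_pCons)

lemmas curve_simps [simp] = ring_mapD[OF ring_map_curve]

lemma poly_curve: "poly (curve z p) e = eval (\<lambda>i. poly (z i) e) p"
  by (rule ring_map_eqI[of "\<lambda>p. poly (curve z p) e"])
    (simp_all add: ring_map_comp[OF ring_map_poly ring_map_curve] ring_map_eval ring_map_pCons)

definition grad :: "'k::comm_ring_1 mpoly \<Rightarrow> (nat \<Rightarrow> 'k) \<Rightarrow> (nat \<Rightarrow> 'k) \<Rightarrow> 'k" where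
  "grad p x z = coeff (curve (\<lambda>i. [:x i, z i:]) p) 1"

lemma grad_simps [simp]: "grad (Const c) x z = 0" "grad (Var i) x z = z i" "grad (p + q) x z = grad p x z + grad q x z"
  "grad (p * q) x z = eval x p * grad q x z + grad p x z * eval x q"
proof -
  have "coeff (curve (\<lambda>i. [:x i, z i:]) p) 0 = eval x p" for p
    using poly_curve[of "\<lambda>i. [:x i, z i:]" p 0] by (simp add: poly_0_coeff_0)
  then show "grad (p * q) x z = eval x p * grad q x z + grad p x z * eval x q"
    by (simp add: grad_def coeff_mult)
qed (simp_all add: grad_def ring_map_pCons)

lemma grad_linear: "grad p x (z + z') = grad p x z + grad p x z'" "grad p x (t *v z) = t * grad p x z"
  by (induction p rule: mpoly_induct) (simp_all add: algebra_simps)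

lemma jet_curve:
  assumes "\<And>i. jet (w i) (a i) (b i)"
  shows "jet (\<lambda>e. eval (\<lambda>i. w i e) p) (eval a p) (grad p a b)"
proof (induction p rule: mpoly_induct)
  case (mult p q) then show ?case using jet_mult[OF mult] by simp
next
  case (add p q) then show ?case using jet_add[OF add] by simp
qed (use assms in \<open>auto intro: jet_const\<close>)

lemma jet_line: "jet (\<lambda>e. eval (x + e *v z) p) (eval x p) (grad p x z)"
proof -
  have "jet (\<lambda>e. x i + e * z i) (x i) (z i)" for i
    by (rule jet_eq[OF jet_add[OF jet_const jet_mult[OF jet_id jet_const]]]) simp_all
  from jet_curve[of "\<lambda>i e. x i + e * z i", OF this, of p] show ?thesis
    by (simp add: plus_fun_def vscale_def)
qed

lemma grad_linear_sum: "grad p x (\<Sum>i\<in>A. c i *v z i) = (\<Sum>i\<in>A. c i * grad p x (z i))"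
proof -
  have "grad p x 0 = 0" using grad_linear(2)[of p x 0 0] by simp
  then show ?thesis by (induction A rule: infinite_finite_induct) (simp_all add: grad_linear)
qed

lemma grad_cong: "in_vars N p \<Longrightarrow> (\<And>i. i < N \<Longrightarrow> x i = x' i) \<Longrightarrow> (\<And>i. i < N \<Longrightarrow> z i = z' i) \<Longrightarrow> grad p x z = grad p x' z'"
  unfolding grad_def by (subst evalh_cong[of N p _ "\<lambda>i. [:x' i, z' i:]"]) auto

lemma grad_expand: "in_vars N p \<Longrightarrow> grad p x z = (\<Sum>i<N. z i * grad p x (uvec i))"
proof -
  assume "in_vars N p"
  then have "grad p x z = grad p x (\<Sum>i<N. z i *v uvec i)"
    by (rule grad_cong) (simp_all add: sum_fun_apply sum_uvec)
  then show ?thesis by (simp add: grad_linear_sum)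
qed

subsection \<open>Homogeneity\<close>

lemma mdeg_superset: "finite A \<Longrightarrow> Poly_Mapping.keys m \<subseteq> A \<Longrightarrow> mdeg m = (\<Sum>i\<in>A. Poly_Mapping.lookup m i)"
  unfolding mdeg_def by (rule sum.mono_neutral_left) (auto simp: in_keys_iff)

lemma mdeg_add: "mdeg (m + m') = mdeg m + mdeg m'"
proof -
  let ?A = "Poly_Mapping.keys m \<union> Poly_Mapping.keys m'"
  have "Poly_Mapping.keys (m + m') \<subseteq> ?A" by (rule keys_add)
  then show ?thesis by (simp add: mdeg_superset[of ?A] lookup_add sum.distrib)
qed

lemma mdeg_single [simp]: "mdeg (Poly_Mapping.single i k) = k"
  by (cases "k = 0") (simp_all add: mdeg_def)

lemma mon_scale: "mon (\<lambda>i. s * x i) m = s ^ mdeg m * mon x m"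
  by (simp add: mon_def mdeg_def power_mult_distrib prod.distrib power_sum)

lemma eval_mon: "eval x p = (\<Sum>m\<in>Poly_Mapping.keys p. Poly_Mapping.lookup p m * mon x m)"
  by (simp add: eval_evalh evalh_def)

lemma eval_single: "eval x (Poly_Mapping.single m c) = c * mon x m"
  by (simp add: eval_evalh evalh_single ring_map_id)

lemma eval_homogeneous:
  assumes "homogeneous d p" shows "eval (s *v x) p = s ^ d * eval x p"
  unfolding eval_mon vscale_def mon_scale sum_distrib_left
  by (rule sum.cong) (use assms in \<open>auto simp: homogeneous_def\<close>)

definition homogenize :: "nat \<Rightarrow> nat \<Rightarrow> 'k::comm_ring_1 mpoly \<Rightarrow> 'k mpoly" where
  "homogenize v e p = (\<Sum>m\<in>Poly_Mapping.keys p. Poly_Mapping.single (m + Poly_Mapping.single v (e - mdeg m)) (Poly_Mapping.lookup p m))"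

lemma keys_homogenize: "Poly_Mapping.keys (homogenize v e p) \<subseteq> (\<lambda>m. m + Poly_Mapping.single v (e - mdeg m)) ` Poly_Mapping.keys p"
proof
  fix k assume "k \<in> Poly_Mapping.keys (homogenize v e p)"
  then have "Poly_Mapping.lookup (homogenize v e p) k \<noteq> 0" by (simp add: in_keys_iff)
  then obtain m where "m \<in> Poly_Mapping.keys p"
    "Poly_Mapping.lookup (Poly_Mapping.single (m + Poly_Mapping.single v (e - mdeg m)) (Poly_Mapping.lookup p m)) k \<noteq> 0"
    unfolding homogenize_def lookup_sum by (meson sum.not_neutral_contains_not_neutral)
  then show "k \<in> (\<lambda>m. m + Poly_Mapping.single v (e - mdeg m)) ` Poly_Mapping.keys p"
    by (auto simp: lookup_single when_def split: if_splits)
qed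

lemma homogenize:
  assumes p: "in_vars n p" and e: "\<And>m. m \<in> Poly_Mapping.keys p \<Longrightarrow> mdeg m \<le> e"
  shows "homogeneous e (homogenize n e p)" "in_vars (Suc n) (homogenize n e p)"
    "eval (\<lambda>i. if i = n then s else s * x i) (homogenize n e p) = s ^ e * eval x p"
proof -
  show "homogeneous e (homogenize n e p)"
    unfolding homogeneous_def 
  proof
    fix k assume "k \<in> Poly_Mapping.keys (homogenize n e p)"
    then obtain m where "m \<in> Poly_Mapping.keys p" "k = m + Poly_Mapping.single n (e - mdeg m)"
      using keys_homogenize[of n e p] by blast
    then show "mdeg k = e" using e[of m] by (simp add: mdeg_add)
  qed
  have "Poly_Mapping.keys (m + Poly_Mapping.single n (e - mdeg m)) \<subseteq> {..<Suc n}" if "m \<in> Poly_Mapping.keys p" for m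
  proof -
    have "Poly_Mapping.keys m \<subseteq> {..<Suc n}" using p that unfolding in_vars_def by fastforce
    moreover have "Poly_Mapping.keys (Poly_Mapping.single n (e - mdeg m)) \<subseteq> {..<Suc n}" by simp
    ultimately show ?thesis by (intro order.trans[OF keys_add Un_least])
  qed
  then show "in_vars (Suc n) (homogenize n e p)"
    unfolding in_vars_def using keys_homogenize[of n e p] by blast
  let ?x = "\<lambda>i. if i = n then s else s * x i"
  have "Poly_Mapping.lookup p m * mon ?x (m + Poly_Mapping.single n (e - mdeg m)) = s ^ e * (Poly_Mapping.lookup p m * mon x m)"
    if m: "m \<in> Poly_Mapping.keys p" for m
  proof -
    have "mon ?x m = mon (\<lambda>i. s * x i) m" by (rule mon_cong) (use p m in \<open>auto simp: in_vars_def\<close>)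
    then have "Poly_Mapping.lookup p m * mon ?x (m + Poly_Mapping.single n (e - mdeg m)) =
        (s ^ mdeg m * s ^ (e - mdeg m)) * (Poly_Mapping.lookup p m * mon x m)"
      by (simp add: mon_add mon_scale)
    also have "s ^ mdeg m * s ^ (e - mdeg m) = s ^ e" using e[OF m] by (simp flip: power_add)
    finally show ?thesis .
  qed
  then show "eval ?x (homogenize n e p) = s ^ e * eval x p"
    unfolding homogenize_def
    by (simp add: eval_mon[of x p] sum_distrib_left eval_single)
qed

text \<open>\<open>p0\<close> is the equation of the tangent cone at the origin: along a curve
  leaving the origin with velocity \<open>z\<close> at 0, the first possibly nonzero coefficient of
  \<open>p\<close> is the value of \<open>p0\<close> at that velocity.\<close>

lemma lowest_form:
  fixes p :: "'k::comm_ring_1 mpoly"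
  assumes "p \<noteq> 0"
  shows "\<exists>d p0. p0 \<noteq> 0 \<and> (\<forall>z. \<exists>W. curve (\<lambda>i. [:0, 1:] * z i) p = [:0, 1:] ^ d * W \<and> poly W 0 = eval (\<lambda>i. poly (z i) 0) p0)"
proof -
  have "Poly_Mapping.keys p \<noteq> {}" using assms by simp
  define d where "d = Min (mdeg ` Poly_Mapping.keys p)"
  have d: "d \<le> mdeg m" if "m \<in> Poly_Mapping.keys p" for m using that by (simp add: d_def)
  have "d \<in> mdeg ` Poly_Mapping.keys p" unfolding d_def by (rule Min_in) (use \<open>Poly_Mapping.keys p \<noteq> {}\<close> in auto)
  then obtain m0 where m0: "m0 \<in> Poly_Mapping.keys p" "mdeg m0 = d" by auto
  define p0 where "p0 = (\<Sum>m\<in>Poly_Mapping.keys p. if mdeg m = d then Poly_Mapping.single m (Poly_Mapping.lookup p m) else 0)"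
  have "Poly_Mapping.lookup p0 m0 = (\<Sum>m\<in>Poly_Mapping.keys p. if m = m0 then Poly_Mapping.lookup p m0 else 0)"
    unfolding p0_def lookup_sum by (rule sum.cong) (auto simp: m0 lookup_single when_def)
  also have "\<dots> \<noteq> 0" using m0 by (simp add: in_keys_iff)
  finally have "p0 \<noteq> 0" by auto
  moreover have "\<exists>W. curve (\<lambda>i. [:0, 1:] * z i) p = [:0, 1:] ^ d * W \<and> poly W 0 = eval (\<lambda>i. poly (z i) 0) p0" for z :: "nat \<Rightarrow> 'k poly"
  proof -
    define W where "W = (\<Sum>m\<in>Poly_Mapping.keys p. [:Poly_Mapping.lookup p m:] * [:0, 1:] ^ (mdeg m - d) * mon z m)"
    have "curve (\<lambda>i. [:0, 1:] * z i) p = [:0, 1:] ^ d * W"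
      unfolding evalh_def mon_scale W_def sum_distrib_left
    proof (rule sum.cong)
      fix m assume "m \<in> Poly_Mapping.keys p"
      then have "[:0, 1:] ^ mdeg m = [:0, 1::'k:] ^ d * [:0, 1:] ^ (mdeg m - d)" using d[of m] by (simp flip: power_add)
      then show "[:Poly_Mapping.lookup p m:] * ([:0, 1:] ^ mdeg m * mon z m) = [:0, 1:] ^ d * ([:Poly_Mapping.lookup p m:] * [:0, 1:] ^ (mdeg m - d) * mon z m)"
        by (simp only: ac_simps)
    qed simp
    moreover have "poly W 0 = eval (\<lambda>i. poly (z i) 0) p0"
    proof -
      have mon: "poly (mon z m) 0 = mon (\<lambda>i. poly (z i) 0) m" for m by (simp add: mon_def poly_prod)
      have "poly W 0 = (\<Sum>m\<in>Poly_Mapping.keys p. if mdeg m = d then Poly_Mapping.lookup p m * mon (\<lambda>i. poly (z i) 0) m else 0)"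
        unfolding W_def poly_sum
      proof (rule sum.cong)
        fix m assume "m \<in> Poly_Mapping.keys p"
        then have "mdeg m = d \<or> 0 < mdeg m - d" using d[of m] by linarith
        then have "(0::'k) ^ (mdeg m - d) = (if mdeg m = d then 1 else 0)" by (auto simp: zero_power)
        then show "poly ([:Poly_Mapping.lookup p m:] * [:0, 1:] ^ (mdeg m - d) * mon z m) 0
          = (if mdeg m = d then Poly_Mapping.lookup p m * mon (\<lambda>i. poly (z i) 0) m else 0)"
          by (simp add: mon)
      qed simp
      also have "\<dots> = eval (\<lambda>i. poly (z i) 0) p0"
        unfolding p0_def by (simp add: ring_map_sum[OF ring_map_eval])
          (rule sum.cong, auto simp: eval_evalh evalh_single ring_map_id evalh_0)
      finally show ?thesis .
    qed
    ultimately show ?thesis by blast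
  qed
  ultimately show ?thesis by blast
qed

subsection \<open>A differential criterion for unirationality\<close>

text \<open>The points obtained from forms of degree \<open>e\<close> are scaled by
  \<open>e\<close>-th powers only. These need not exhaust the field, but the powers of the positive
  integers are already infinitely many.\<close>

lemma poly_eq_0_of_powers:
  fixes P :: "'k::field_char_0 poly"
  assumes "e > 0" "\<And>s. s \<noteq> 0 \<Longrightarrow> poly P (s ^ e) = 0"
  shows "P = 0"
proof (rule ccontr)
  assume "P \<noteq> 0"
  then have "finite {x. poly P x = 0}" by (rule poly_roots_finite)
  moreover have "(\<lambda>k::nat. (of_nat (Suc k) :: 'k) ^ e) ` UNIV \<subseteq> {x. poly P x = 0}"
    using assms(2) by (auto simp del: of_nat_Suc)
  ultimately have "finite ((\<lambda>k::nat. (of_nat (Suc k) :: 'k) ^ e) ` UNIV)" by (rule rev_finite_subset)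
  moreover have "inj (\<lambda>k::nat. (of_nat (Suc k) :: 'k) ^ e)"
  proof (rule injI)
    fix a b :: nat assume "(of_nat (Suc a) :: 'k) ^ e = of_nat (Suc b) ^ e"
    then have "(of_nat (Suc a ^ e) :: 'k) = of_nat (Suc b ^ e)" by (simp only: of_nat_power)
    then have "Suc a ^ e = Suc b ^ e" by (simp only: of_nat_eq_iff)
    then have "Suc a = Suc b" using assms(1) power_eq_imp_eq_base[of "Suc a" e "Suc b"] by simp
    then show "a = b" by simp
  qed
  ultimately show False by (simp add: finite_image_iff)
qed

text \<open>If a polynomial \<open>R\<close> vanishes on the image of a map whose differential has the hyperplane
  tangent to \<open>F\<close> as image, then the lowest form of \<open>R\<close> at the image point vanishes on
  that hyperplane; \<open>R\<close> is therefore zero as soon as it is independent of a coordinate transversal to it.\<close>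

lemma tangent_cone_argument:
  fixes R :: "'k::field_char_0 mpoly"
  assumes R: "free_of v R" "v < N"
    and g: "\<And>u i. i < N \<Longrightarrow> jet (\<lambda>\<epsilon>. g (t0 + \<epsilon> *v u) i) (g t0 i) (D u i)"
    and van: "\<And>s t w. (\<And>i. i < N \<Longrightarrow> w i = s * g t i) \<Longrightarrow> eval w R = 0"
    and surj: "\<And>z. \<exists>s u \<rho>. \<forall>i<N. z i = s * g t0 i + D u i + \<rho> * uvec v i"
  shows "R = 0"
proof (rule ccontr)
  assume "R \<noteq> 0"
  define a where "a i = (if i < N then g t0 i else 0)" for i
  define R' where "R' = subst (\<lambda>i. Var i + Const (a i)) R"
  have "subst (\<lambda>i. Var i - Const (a i)) R' = R"
  proof -
    have "subst (\<lambda>i. Var i - Const (a i)) R' = subst Var R"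
      unfolding R'_def subst_subst by (rule arg_cong[of _ _ "\<lambda>f. subst f R"]) auto
    then show ?thesis by simp
  qed
  then have "R' \<noteq> 0" using \<open>R \<noteq> 0\<close> by auto
  then obtain d p0 where p0: "p0 \<noteq> 0"
    "\<And>z. \<exists>W. curve (\<lambda>i. [:0, 1:] * z i) R' = [:0, 1:] ^ d * W \<and> poly W 0 = eval (\<lambda>i. poly (z i) 0) p0"
    using lowest_form by metis
  have "eval z p0 = 0" for z
  proof -
    obtain s u \<rho> where z: "\<And>i. i < N \<Longrightarrow> z i = s * g t0 i + D u i + \<rho> * uvec v i" using surj by metis
    have "\<exists>P. \<forall>i<N. (\<lambda>\<epsilon>. g (t0 + \<epsilon> *v u) i) = poly (P i) \<and> coeff (P i) 0 = g t0 i \<and> coeff (P i) 1 = D u i"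
      using g[of _ u] unfolding jet_def by metis
    then obtain P where P: "\<And>i. i < N \<Longrightarrow> (\<lambda>\<epsilon>. g (t0 + \<epsilon> *v u) i) = poly (P i)"
      "\<And>i. i < N \<Longrightarrow> coeff (P i) 0 = g t0 i" "\<And>i. i < N \<Longrightarrow> coeff (P i) 1 = D u i" by blast
    \<comment> \<open>\<open>poly_shift 1\<close> is the difference quotient at 0. With this choice
      the curve through \<open>g t0\<close> with increment \<open>\<epsilon> * \<zeta>\<close> is
      \<open>(1 + s * \<epsilon>) * g (t0 + \<epsilon> *v u)\<close>, except for the term in
      \<open>\<rho>\<close> in the coordinate \<open>v\<close>.\<close>
    define \<zeta> where "\<zeta> i = (if i < N then poly_shift 1 (P i) + smult s (P i) + [:\<rho> * uvec v i:] else [:z i:])" for i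
    have P_eq: "P i = pCons (g t0 i) (poly_shift 1 (P i))" if "i < N" for i
      using P(2)[OF that] by (auto simp: poly_eq_iff coeff_poly_shift coeff_pCons split: nat.splits)
    have \<zeta>0: "poly (\<zeta> i) 0 = z i" for i
      using P(2,3)[of i] z[of i] by (cases "i < N") (simp_all add: \<zeta>_def poly_0_coeff_0 coeff_poly_shift algebra_simps)
    obtain W where W: "curve (\<lambda>i. [:0, 1:] * \<zeta> i) R' = [:0, 1:] ^ d * W" "poly W 0 = eval (\<lambda>i. poly (\<zeta> i) 0) p0"
      using p0(2) by blast
    have "poly (curve (\<lambda>i. [:0, 1:] * \<zeta> i) R') \<epsilon> = 0" for \<epsilon>
    proof -
      define w where "w i = \<epsilon> * poly (\<zeta> i) \<epsilon> + a i" for i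
      have "poly (curve (\<lambda>i. [:0, 1:] * \<zeta> i) R') \<epsilon> = eval w R"
        unfolding poly_curve R'_def eval_subst by (simp add: w_def[abs_def])
      \<comment> \<open>\<open>R\<close> does not see the coordinate \<open>v\<close>, so the term
        in \<open>\<rho>\<close> may be dropped; the point then lies on the cone over the
        image.\<close>
      also have "\<dots> = eval (w(v := (1 + s * \<epsilon>) * g (t0 + \<epsilon> *v u) v)) R" using eval_free_of[OF R(1)] by simp
      also have "\<dots> = 0"
      proof (rule van)
        fix i assume i: "i < N"
        have "g (t0 + \<epsilon> *v u) i = poly (P i) \<epsilon>" using P(1)[OF i] by metis
        also have "\<dots> = g t0 i + \<epsilon> * poly (poly_shift 1 (P i)) \<epsilon>" by (subst P_eq[OF i]) simp
        finally have gi: "g (t0 + \<epsilon> *v u) i = g t0 i + \<epsilon> * poly (poly_shift 1 (P i)) \<epsilon>" "poly (P i) \<epsilon> = g (t0 + \<epsilon> *v u) i"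
          using P(1)[OF i] by metis+
        have "w i = (1 + s * \<epsilon>) * g (t0 + \<epsilon> *v u) i" if "i \<noteq> v"
          using i that by (simp add: w_def \<zeta>_def a_def gi(2) uvec_def) (simp add: gi(1) algebra_simps)
        then show "(w(v := (1 + s * \<epsilon>) * g (t0 + \<epsilon> *v u) v)) i = (1 + s * \<epsilon>) * g (t0 + \<epsilon> *v u) i" by simp
      qed
      finally show ?thesis .
    qed
    then have "curve (\<lambda>i. [:0, 1:] * \<zeta> i) R' = 0" by (metis poly_all_0_iff_0)
    then have "W = 0" using W(1) by simp
    then show ?thesis using W(2) by (simp add: \<zeta>0)
  qed
  then show False using p0(1) eval_eq_0_imp_eq_0 by blast
qed

lemma Var_neq_0: "Var i \<noteq> (0 :: 'k::comm_ring_1 mpoly)"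
proof
  assume "Var i = (0 :: 'k mpoly)"
  then have "eval (\<lambda>_. 1) (Var i) = eval (\<lambda>_. 1) (0 :: 'k mpoly)" by simp
  then show False by (simp only: eval_Var eval_simps one_neq_zero)
qed

text \<open>\<open>inj\<close> says that \<open>g t0\<close> and the \<open>n\<close> partial
  derivatives of \<open>g\<close> are independent, so that they span the tangent hyperplane of
  \<open>F\<close> at the smooth point \<open>g t0\<close>. If \<open>H\<close> vanished on the
  image without being divisible by \<open>F\<close>, eliminating a coordinate transversal to that
  hyperplane would give a nonzero \<open>R\<close> that contradicts
  \<open>tangent_cone_argument\<close>.\<close>

lemma unirational_of_param:
  fixes F :: "'k::field_char_0 mpoly"
  assumes F: "irreducible_form (n + 2) d F"
    and g: "\<And>i. i < n + 2 \<Longrightarrow> PF n (\<lambda>t. g t i)"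
    and Fg: "\<And>t. eval (g t) F = 0"
    and inj: "\<And>s u D. (\<And>i. i < n + 2 \<Longrightarrow> jet (\<lambda>\<epsilon>. g (t0 + \<epsilon> *v u) i) (g t0 i) (D i)) \<Longrightarrow>
        (\<And>i. i < n + 2 \<Longrightarrow> s * g t0 i + D i = 0) \<Longrightarrow> s = 0 \<and> (\<forall>j<n. u j = 0)"
    and smooth: "grad F (g t0) z \<noteq> 0"
  shows "unirational_hypersurface (n + 2) F"
proof -
  let ?N = "n + 2"
  have irr: "irreducible F" and Fv: "in_vars ?N F" and Fh: "homogeneous d F" using F by (auto simp: irreducible_form_def)
  obtain p where p: "\<And>i. i < ?N \<Longrightarrow> in_vars n (p i)" "\<And>i t. i < ?N \<Longrightarrow> g t i = eval t (p i)"
    using g unfolding PF_def by metis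
  define D where "D u i = grad (p i) t0 u" for u i
  have jetg: "jet (\<lambda>\<epsilon>. g (t0 + \<epsilon> *v u) i) (g t0 i) (D u i)" if "i < ?N" for u i
    using jet_line[of t0 u "p i"] by (simp add: p(2)[OF that] D_def)
  \<comment> \<open>A common bound for the degrees, made positive by \<open>Suc\<close> because
    \<open>poly_eq_0_of_powers\<close> is applied with this exponent.\<close>
  define e where "e = Suc (Max (insert 0 (mdeg ` (\<Union>i<?N. Poly_Mapping.keys (p i)))))"
  have e: "mdeg m \<le> e" if "m \<in> Poly_Mapping.keys (p i)" "i < ?N" for i m
  proof -
    have "mdeg m \<le> Max (insert 0 (mdeg ` (\<Union>i<?N. Poly_Mapping.keys (p i))))"
      by (rule Max_ge) (use that in auto)
    then show ?thesis by (simp add: e_def)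
  qed
  define G where "G i = homogenize n e (p i)" for i
  have Gh: "homogeneous e (G i)" and Gv: "in_vars (Suc n) (G i)"
    and Ge: "eval (\<lambda>i. if i = n then s else s * t i) (G i) = s ^ e * g t i" if "i < ?N" for i s t
    using homogenize[OF p(1)[OF that] e[OF _ that]] p(2)[OF that] by (auto simp: G_def)
  have Ge': "eval t (G i) = t n ^ e * g (\<lambda>i. t i / t n) i" if "i < ?N" "t n \<noteq> 0" for i t
  proof -
    have "(\<lambda>i. if i = n then t n else t n * (t i / t n)) = t" using that by auto
    then show ?thesis using Ge[OF that(1), of "t n" "\<lambda>i. t i / t n"] by simp
  qed
  have cone: "eval w F = 0" if "\<And>i. i < ?N \<Longrightarrow> w i = s * g t i" for w s t
  proof -
    have "eval w F = eval (s *v g t) F" by (rule eval_cong[OF Fv]) (use that in simp)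
    then show ?thesis by (simp add: eval_homogeneous[OF Fh] Fg)
  qed
  have "subst G F = 0"
  proof -
    have "eval t (Var n * subst G F) = 0" for t
      by (cases "t n = 0") (auto simp: eval_subst intro!: cone[of _ "t n ^ e" "\<lambda>i. t i / t n"] Ge')
    then have "Var n * subst G F = 0" by (rule eval_eq_0_imp_eq_0)
    then show ?thesis by (simp add: Var_neq_0)
  qed
  moreover have "\<exists>i<?N. G i \<noteq> 0"
  proof (rule ccontr)
    assume "\<not> ?thesis"
    then have "g t0 i = 0" if "i < ?N" for i using Ge[OF that, of 1 t0] that by auto
    moreover have "D 0 i = 0" for i using grad_linear(2)[of "p i" t0 0 0] by (simp add: D_def)
    ultimately show False using inj[OF jetg, of 1 0] by simp
  qed
  moreover have "F dvd H" if H: "in_vars ?N H" "subst G H = 0" for H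
  proof (rule ccontr)
    assume ndvd: "\<not> F dvd H"
    have vanH: "eval w H = 0" if w: "\<And>i. i < ?N \<Longrightarrow> w i = s * g t i" for w s t
    proof -
      define P where "P = curve (\<lambda>i. [:0, g t i:]) H"
      have "poly P (s ^ e) = 0" for s
      proof -
        have "poly P (s ^ e) = eval (\<lambda>i. s ^ e * g t i) H" by (simp add: P_def poly_curve)
        also have "\<dots> = eval (\<lambda>i. eval (\<lambda>i. if i = n then s else s * t i) (G i)) H"
          by (rule eval_cong[OF H(1)]) (simp add: Ge)
        also have "\<dots> = 0" using eval_subst[of _ G H] H(2) by simp
        finally show ?thesis .
      qed
      then have "P = 0" by (intro poly_eq_0_of_powers[of e]) (auto simp: e_def)
      then have "eval (\<lambda>i. s * g t i) H = 0" using poly_curve[of "\<lambda>i. [:0, g t i:]" H s] by (simp add: P_def)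
      then show ?thesis using eval_cong[OF H(1), of w "\<lambda>i. s * g t i"] w by simp
    qed
    obtain v where v: "v < ?N" "grad F (g t0) (uvec v) \<noteq> 0"
      using smooth grad_expand[OF Fv, of "g t0" z] by (metis (no_types, lifting) lessThan_iff mult_zero_right sum.neutral)
    have "\<not> free_of v F"
    proof
      assume fr: "free_of v F"
      have "eval (g t0 + \<epsilon> *v uvec v) F = eval (g t0) F" for \<epsilon>
      proof -
        have "g t0 + \<epsilon> *v uvec v = (g t0)(v := g t0 v + \<epsilon>)" by (auto simp: uvec_def)
        then show ?thesis by (simp add: eval_free_of[OF fr])
      qed
      then have "grad F (g t0) (uvec v) = 0"
        using jet_unique[OF jet_line[of "g t0" "uvec v" F], of "eval (g t0) F" 0] jet_const[of "eval (g t0) F"] by simp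
      then show False using v(2) by simp
    qed
    then obtain R x y where R: "R \<noteq> 0" "free_of v R" "R = x * F + y * H"
      using elimination[OF irr _ ndvd] by blast
    have tangent: "grad F (g t0) (\<lambda>i. s * g t0 i + D u i) = 0" for s u
    proof -
      let ?w = "\<lambda>i \<epsilon>. if i < ?N then (1 + s * \<epsilon>) * g (t0 + \<epsilon> *v u) i else 0"
      have "jet (?w i) (if i < ?N then g t0 i else 0) (if i < ?N then s * g t0 i + D u i else 0)" for i
      proof (cases "i < ?N")
        case True
        have "jet (\<lambda>\<epsilon>. 1 + s * \<epsilon>) 1 s"
          by (rule jet_eq[OF jet_add[OF jet_const jet_mult[OF jet_const jet_id]]]) simp_all
        from jet_mult[OF this jetg[OF True, of u]] show ?thesis using True by (simp add: add.commute)
      qed (simp add: jet_const)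
      note J = jet_curve[of ?w, OF this, of F]
      have "eval (\<lambda>i. ?w i \<epsilon>) F = 0" for \<epsilon>
        by (rule cone[of _ "1 + s * \<epsilon>" "t0 + \<epsilon> *v u"]) simp
      then have "grad F (\<lambda>i. if i < ?N then g t0 i else 0) (\<lambda>i. if i < ?N then s * g t0 i + D u i else 0) = 0"
        using J jet_unique[OF _ jet_const[of 0]] by (simp only:) blast
      then show ?thesis
        using grad_cong[OF Fv, of "\<lambda>i. if i < ?N then g t0 i else 0" "g t0" "\<lambda>i. if i < ?N then s * g t0 i + D u i else 0" "\<lambda>i. s * g t0 i + D u i"] by simp
    qed
    \<comment> \<open>The partial derivatives, the point itself and the transversal unit vector:
      \<open>n + 2\<close> vectors, independent because all but the last lie in the tangent
      hyperplane.\<close>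
    define f where "f j i = (if j < n then D (uvec j) i else if j = n then g t0 i else uvec v i)" for j i
    have sumf: "(\<Sum>j<?N. x j * f j i) = x n * g t0 i + D x i + x (Suc n) * uvec v i" if "i < ?N" for x i
    proof -
      have "(\<Sum>j<n. x j * f j i) = D x i" unfolding D_def grad_expand[OF p(1)[OF that], of t0 x]
        by (rule sum.cong) (auto simp: f_def D_def)
      then show ?thesis by (simp add: f_def numeral_2_eq_2)
    qed
    have "indep_family ?N ?N f" unfolding indep_family_def
    proof (intro allI impI)
      fix x j assume x0: "\<forall>i<?N. (\<Sum>j<?N. x j * f j i) = 0" and j: "j < ?N"
      then have x: "x n * g t0 i + D x i + x (Suc n) * uvec v i = 0" if "i < ?N" for i
        using sumf[OF that, of x] x0 that by metis
      have "grad F (g t0) (\<lambda>i. x n * g t0 i + D x i) = grad F (g t0) ((- x (Suc n)) *v uvec v)"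
        by (rule grad_cong[OF Fv]) (use x in \<open>auto simp: eq_neg_iff_add_eq_0\<close>)
      then have "x (Suc n) = 0" using tangent[of "x n" x] v(2) unfolding grad_linear(2) by simp
      then have "x n = 0 \<and> (\<forall>j<n. x j = 0)" using x by (intro inj[OF jetg]) auto
      then show "x j = 0" using \<open>x (Suc n) = 0\<close> j by (auto simp: less_Suc_eq numeral_2_eq_2)
    qed
    note indep = this
    have surj: "\<exists>s u \<rho>. \<forall>i<?N. z i = s * g t0 i + D u i + \<rho> * uvec v i" for z
    proof -
      obtain x where x: "\<forall>i<?N. z i = (\<Sum>j<?N. x j * f j i)" using indep_family_spans[OF indep] by blast
      show ?thesis by (intro exI[of _ "x n"] exI[of _ x] exI[of _ "x (Suc n)"]) (use x sumf in presburger)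
    qed
    have "R = 0"
    proof (rule tangent_cone_argument[OF R(2) v(1) jetg _ surj])
      show "eval w R = 0" if "\<And>i. i < ?N \<Longrightarrow> w i = s * g t i" for w s t
        using cone[OF that] vanH[OF that] by (simp add: R(3))
    qed
    then show False using R(1) by simp
  qed
  ultimately show ?thesis unfolding unirational_hypersurface_def
    by (intro exI[of _ G] exI[of _ e]) (use Gh Gv in auto)
qed

subsection \<open>The polar form of a quartic\<close>

definition PFV :: "nat \<Rightarrow> ((nat \<Rightarrow> 'k::comm_ring_1) \<Rightarrow> nat \<Rightarrow> 'k) \<Rightarrow> bool" where
  "PFV n f \<longleftrightarrow> (\<forall>i. PF n (\<lambda>x. f x i))"

definition jetV :: "('k::comm_ring_1 \<Rightarrow> nat \<Rightarrow> 'k) \<Rightarrow> (nat \<Rightarrow> 'k) \<Rightarrow> (nat \<Rightarrow> 'k) \<Rightarrow> bool" where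
  "jetV f a b \<longleftrightarrow> (\<forall>i. jet (\<lambda>e. f e i) (a i) (b i))"

lemma PFV_const [intro!]: "PFV n (\<lambda>x. a)"
  and PFV_add [intro!]: "PFV n f \<Longrightarrow> PFV n g \<Longrightarrow> PFV n (\<lambda>x. f x + g x)"
  and PFV_scale [intro!]: "PF n c \<Longrightarrow> PFV n g \<Longrightarrow> PFV n (\<lambda>x. c x *v g x)"
  by (auto simp: PFV_def)

lemma PFV_sum [intro!]: "(\<And>i. i \<in> A \<Longrightarrow> PFV n (f i)) \<Longrightarrow> PFV n (\<lambda>x. \<Sum>i\<in>A. f i x)"
  by (auto simp: PFV_def sum_fun_apply)

lemma jetV_const: "jetV (\<lambda>e. a) a 0"
  and jetV_add: "jetV f a b \<Longrightarrow> jetV g c d \<Longrightarrow> jetV (\<lambda>e. f e + g e) (a + c) (b + d)"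
  and jetV_scale: "jet h s t \<Longrightarrow> jetV g c d \<Longrightarrow> jetV (\<lambda>e. h e *v g e) (s *v c) (s *v d + t *v c)"
  by (auto simp: jetV_def jet_const jet_add jet_mult)

lemma jetV_sum: "(\<And>i. i \<in> A \<Longrightarrow> jetV (f i) (a i) (b i)) \<Longrightarrow> jetV (\<lambda>e. \<Sum>i\<in>A. f i e) (sum a A) (sum b A)"
  by (auto simp: jetV_def sum_fun_apply intro: jet_sum)

lemma jetV_eq: "jetV f a b \<Longrightarrow> a = c \<Longrightarrow> b = d \<Longrightarrow> jetV f c d" by simp

text \<open>Closure under polynomial functions and the product rule are assumed abstractly, so the
  coefficients of the quartic appear only in the construction of \<open>Q\<close>. By
  \<open>cong\<close> and symmetry, entries from \<open>N\<close> on do not matter in any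
  argument.\<close>

locale quartic_form =
  fixes N :: nat and Q :: "(nat \<Rightarrow> 'k::field_char_0) \<Rightarrow> (nat \<Rightarrow> 'k) \<Rightarrow> (nat \<Rightarrow> 'k) \<Rightarrow> (nat \<Rightarrow> 'k) \<Rightarrow> 'k"
  assumes add: "Q (a + a') b c d = Q a b c d + Q a' b c d"
    and scale: "Q (t *v a) b c d = t * Q a b c d"
    and sym1: "Q a b c d = Q b a c d" and sym2: "Q a b c d = Q a c b d" and sym3: "Q a b c d = Q a b d c"
    and cong: "(\<And>i. i < N \<Longrightarrow> a i = a' i) \<Longrightarrow> Q a b c d = Q a' b c d"
    and PF: "PFV n f1 \<Longrightarrow> PFV n f2 \<Longrightarrow> PFV n f3 \<Longrightarrow> PFV n f4 \<Longrightarrow> PF n (\<lambda>x. Q (f1 x) (f2 x) (f3 x) (f4 x))"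
    and jets: "jetV g1 a a' \<Longrightarrow> jetV g2 b b' \<Longrightarrow> jetV g3 c c' \<Longrightarrow> jetV g4 d d' \<Longrightarrow>
      jet (\<lambda>e. Q (g1 e) (g2 e) (g3 e) (g4 e)) (Q a b c d) (Q a' b c d + Q a b' c d + Q a b c' d + Q a b c d')"
begin

lemma add2: "Q a (b + b') c d = Q a b c d + Q a b' c d" by (metis add sym1)
lemma add3: "Q a b (c + c') d = Q a b c d + Q a b c' d" by (metis add2 sym2)
lemma add4: "Q a b c (d + d') = Q a b c d + Q a b c d'" by (metis add3 sym3)
lemma scale2: "Q a (t *v b) c d = t * Q a b c d" by (metis scale sym1)
lemma scale3: "Q a b (t *v c) d = t * Q a b c d" by (metis scale2 sym2)
lemma scale4: "Q a b c (t *v d) = t * Q a b c d" by (metis scale3 sym3)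
lemmas symmetric = sym1 sym2 sym3
lemma cong4: "(\<And>i. i < N \<Longrightarrow> d i = d' i) \<Longrightarrow> Q a b c d = Q a b c d'" 
  using cong[of d d' a b c] by (metis symmetric)

lemma zero: "Q 0 b c d = 0" using scale[of 0 0 b c d] by simp
lemma zero2: "Q a 0 c d = 0" using scale2[of a 0 0 c d] by simp
lemma zero3: "Q a b 0 d = 0" using scale3[of a b 0 0 d] by simp
lemma zero4: "Q a b c 0 = 0" using scale4[of a b c 0 0] by simp

lemmas multilinear = add add2 add3 add4 scale scale2 scale3 scale4 zero zero2 zero3 zero4

text \<open>On \<open>s a + t b\<close> the quartic equals
  \<open>s ^ 3 * (s * Q a a a a + 4 * t * Q b a a a)\<close>; the coefficients of \<open>x\<close>
  are the zero of the linear factor.\<close>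

lemma third_point:
  assumes "Q b b b a = 0" "Q b b a a = 0" "Q b b b b = 0"
  defines "x \<equiv> (4 * Q b a a a) *v a + (- Q a a a a) *v b"
  shows "Q x x x x = 0"
  using assms(1-3) unfolding x_def by (simp add: multilinear symmetric)

end

lemma mon_split:
  assumes "mdeg m = Suc d"
  shows "\<exists>i m'. i \<in> Poly_Mapping.keys m \<and> (\<forall>x :: nat \<Rightarrow> 'b::comm_monoid_mult. mon x m = x i * mon x m') \<and> mdeg m' = d \<and> Poly_Mapping.keys m' \<subseteq> Poly_Mapping.keys m"
proof -
  have "Poly_Mapping.keys m \<noteq> {}" using assms by (auto simp: mdeg_def)
  then obtain i where i: "i \<in> Poly_Mapping.keys m" by blast
  define m' where "m' = m - Poly_Mapping.single i 1"
  have m: "m = Poly_Mapping.single i 1 + m'"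
    by (rule poly_mapping_eqI) (use i in \<open>auto simp: m'_def lookup_add lookup_minus lookup_single when_def in_keys_iff\<close>)
  have "mdeg m' = d" using assms mdeg_add[of "Poly_Mapping.single i 1" m'] m by simp
  moreover have "mon x m = x i * mon x m'" for x :: "nat \<Rightarrow> 'b" by (subst m) (simp add: mon_add)
  moreover have "Poly_Mapping.keys m' \<subseteq> Poly_Mapping.keys m"
    by (auto simp: m'_def in_keys_iff lookup_minus)
  ultimately show ?thesis using i by blast
qed

lemma mon_split4:
  assumes "mdeg m = 4" "Poly_Mapping.keys m \<subseteq> {..<N}"
  shows "\<exists>i j k l. i < N \<and> j < N \<and> k < N \<and> l < N \<and> (\<forall>x :: nat \<Rightarrow> 'b::comm_monoid_mult. mon x m = x i * x j * x k * x l)"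
proof -
  have 0: "mdeg m = Suc (Suc (Suc (Suc 0)))" using assms by simp
  obtain i m1 where 1: "i \<in> Poly_Mapping.keys m \<and> (\<forall>x :: nat \<Rightarrow> 'b. mon x m = x i * mon x m1) \<and> mdeg m1 = Suc (Suc (Suc 0)) \<and> Poly_Mapping.keys m1 \<subseteq> Poly_Mapping.keys m"
    using mon_split[where 'b = 'b, OF 0] by (elim exE)
  obtain j m2 where 2: "j \<in> Poly_Mapping.keys m1 \<and> (\<forall>x :: nat \<Rightarrow> 'b. mon x m1 = x j * mon x m2) \<and> mdeg m2 = Suc (Suc 0) \<and> Poly_Mapping.keys m2 \<subseteq> Poly_Mapping.keys m1"
    using mon_split[where 'b = 'b, OF 1[THEN conjunct2, THEN conjunct2, THEN conjunct1]] by (elim exE)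
  obtain k m3 where 3: "k \<in> Poly_Mapping.keys m2 \<and> (\<forall>x :: nat \<Rightarrow> 'b. mon x m2 = x k * mon x m3) \<and> mdeg m3 = Suc 0 \<and> Poly_Mapping.keys m3 \<subseteq> Poly_Mapping.keys m2"
    using mon_split[where 'b = 'b, OF 2[THEN conjunct2, THEN conjunct2, THEN conjunct1]] by (elim exE)
  obtain l m4 where 4: "l \<in> Poly_Mapping.keys m3 \<and> (\<forall>x :: nat \<Rightarrow> 'b. mon x m3 = x l * mon x m4) \<and> mdeg m4 = 0 \<and> Poly_Mapping.keys m4 \<subseteq> Poly_Mapping.keys m3"
    using mon_split[where 'b = 'b, OF 3[THEN conjunct2, THEN conjunct2, THEN conjunct1]] by (elim exE)
  have "m4 = 0" using 4 by (simp add: mdeg_def) (auto simp: in_keys_iff poly_mapping_eq_iff fun_eq_iff)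
  then have "mon x m = x i * x j * x k * x l" for x :: "nat \<Rightarrow> 'b" using 1 2 3 4 by (simp add: mult.assoc)
  moreover have sub: "Poly_Mapping.keys m1 \<subseteq> {..<N}" "Poly_Mapping.keys m2 \<subseteq> {..<N}" "Poly_Mapping.keys m3 \<subseteq> {..<N}"
    using 1 2 3 assms(2) by (meson order.trans)+
  moreover have "i < N" "j < N" "k < N" "l < N"
    using 1 2 3 4 assms(2) sub by (meson lessThan_iff subset_iff)+
  ultimately show ?thesis by blast
qed

lemma ex_quartic_form:
  fixes F :: "'k::field_char_0 mpoly"
  assumes "in_vars N F" "homogeneous 4 F"
  obtains Q where "quartic_form N Q" "\<And>x. eval x F = Q x x x x"
proof -
  let ?K = "Poly_Mapping.keys F"
  have "\<exists>i j k l. i < N \<and> j < N \<and> k < N \<and> l < N \<and> (\<forall>x::nat\<Rightarrow>'k. mon x m = x i * x j * x k * x l)" if "m \<in> ?K" for m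
    by (rule mon_split4) (use assms that in \<open>auto simp: in_vars_def homogeneous_def\<close>)
  then obtain i j k l where ijkl: "\<And>m. m \<in> ?K \<Longrightarrow> i m < N \<and> j m < N \<and> k m < N \<and> l m < N"
    "\<And>m x. m \<in> ?K \<Longrightarrow> mon (x::nat\<Rightarrow>'k) m = x (i m) * x (j m) * x (k m) * x (l m)" by metis
  define R where "R a b c d = (\<Sum>m\<in>?K. Poly_Mapping.lookup F m * (a (i m) * b (j m) * c (k m) * d (l m)))" for a b c d :: "nat \<Rightarrow> 'k"
  \<comment> \<open>Symmetrization over the 24 permutations in two stages: \<open>T\<close> permutes
    the last three arguments, \<open>Q\<close> distributes the first place. Dividing by 24 keeps the
    values on the diagonal.\<close>
  define T where "T a b c d = R a b c d + R a b d c + R a c b d + R a c d b + R a d b c + R a d c b" for a b c d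
  define Q where "Q a b c d = (1/24) * (T a b c d + T b a c d + T c a b d + T d a b c)" for a b c d
  have R_add: "R (a + a') b c d = R a b c d + R a' b c d" "R a (b + b') c d = R a b c d + R a b' c d"
    "R a b (c + c') d = R a b c d + R a b c' d" "R a b c (d + d') = R a b c d + R a b c d'" for a a' b b' c c' d d'
    by (simp_all add: R_def algebra_simps sum.distrib)
  have R_scale: "R (t *v a) b c d = t * R a b c d" "R a (t *v b) c d = t * R a b c d"
    "R a b (t *v c) d = t * R a b c d" "R a b c (t *v d) = t * R a b c d" for t a b c d
    by (simp_all add: R_def sum_distrib_left ac_simps)
  have R_cong: "R a b c d = R a' b c d" "R b a c d = R b a' c d" "R b c a d = R b c a' d" "R b c d a = R b c d a'"
    if "\<And>i. i < N \<Longrightarrow> a i = a' i" for a a' b c d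
    using ijkl(1) that by (auto simp: R_def intro!: sum.cong)
  have R_PF: "PF n (\<lambda>x. R (f1 x) (f2 x) (f3 x) (f4 x))" if "PFV n f1" "PFV n f2" "PFV n f3" "PFV n f4" for n f1 f2 f3 f4
    using that unfolding R_def PFV_def by (intro PF_sum PF_mult PF_const) auto
  have R_jet: "jet (\<lambda>e. R (g1 e) (g2 e) (g3 e) (g4 e)) (R a b c d) (R a' b c d + R a b' c d + R a b c' d + R a b c d')"
    if g: "jetV g1 a a'" "jetV g2 b b'" "jetV g3 c c'" "jetV g4 d d'" for g1 g2 g3 g4 a b c d a' b' c' d'
  proof -
    have "jet (\<lambda>e. Poly_Mapping.lookup F m * (g1 e (i m) * g2 e (j m) * g3 e (k m) * g4 e (l m)))
       (Poly_Mapping.lookup F m * (a (i m) * b (j m) * c (k m) * d (l m)))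
       (Poly_Mapping.lookup F m * (a' (i m) * b (j m) * c (k m) * d (l m)) + Poly_Mapping.lookup F m * (a (i m) * b' (j m) * c (k m) * d (l m))
        + Poly_Mapping.lookup F m * (a (i m) * b (j m) * c' (k m) * d (l m)) + Poly_Mapping.lookup F m * (a (i m) * b (j m) * c (k m) * d' (l m)))" for m
      using g unfolding jetV_def
      by (intro jet_eq[OF jet_mult[OF jet_const jet_mult[OF jet_mult[OF jet_mult]]]])
        (auto simp: algebra_simps)
    from jet_sum[where A = ?K, OF this] show ?thesis unfolding R_def by (simp add: sum.distrib)
  qed
  have Q_jet: "jet (\<lambda>e. Q (g1 e) (g2 e) (g3 e) (g4 e)) (Q a b c d) (Q a' b c d + Q a b' c d + Q a b c' d + Q a b c d')"
    if g: "jetV g1 a a'" "jetV g2 b b'" "jetV g3 c c'" "jetV g4 d d'" for g1 g2 g3 g4 a b c d a' b' c' d'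
  proof -
    have T: "jet (\<lambda>e. T (g1 e) (g2 e) (g3 e) (g4 e)) (T a b c d) (T a' b c d + T a b' c d + T a b c' d + T a b c d')"
      if g: "jetV g1 a a'" "jetV g2 b b'" "jetV g3 c c'" "jetV g4 d d'" for g1 g2 g3 g4 a b c d a' b' c' d'
      unfolding T_def
      by (rule jet_eq[OF jet_add[OF jet_add[OF jet_add[OF jet_add[OF jet_add[OF
            R_jet[OF g(1,2,3,4)] R_jet[OF g(1,2,4,3)]] R_jet[OF g(1,3,2,4)]] R_jet[OF g(1,3,4,2)]] R_jet[OF g(1,4,2,3)]] R_jet[OF g(1,4,3,2)]]])
        (simp_all add: ac_simps)
    show ?thesis unfolding Q_def
      by (rule jet_eq[OF jet_mult[OF jet_const jet_add[OF jet_add[OF jet_add[OF T[OF g(1,2,3,4)] T[OF g(2,1,3,4)]] T[OF g(3,1,2,4)]] T[OF g(4,1,2,3)]]]])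
        (simp_all add: algebra_simps)
  qed
  have "quartic_form N Q"
  proof
    show "Q (a + a') b c d = Q a b c d + Q a' b c d" for a a' b c d
      by (simp add: Q_def T_def R_add algebra_simps)
    show "Q (t *v a) b c d = t * Q a b c d" for t a b c d
      by (simp add: Q_def T_def R_scale algebra_simps)
    show "Q a b c d = Q b a c d" "Q a b c d = Q a c b d" "Q a b c d = Q a b d c" for a b c d
      by (simp_all add: Q_def T_def ac_simps)
    show "Q a b c d = Q a' b c d" if "\<And>i. i < N \<Longrightarrow> a i = a' i" for a a' b c d
      unfolding Q_def T_def
      using R_cong[of a a' b c d, OF that] R_cong[of a a' b d c, OF that] R_cong[of a a' c b d, OF that]
        R_cong[of a a' c d b, OF that] R_cong[of a a' d b c, OF that] R_cong[of a a' d c b, OF that] by simp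
    show "PF n (\<lambda>x. Q (f1 x) (f2 x) (f3 x) (f4 x))" if "PFV n f1" "PFV n f2" "PFV n f3" "PFV n f4" for n f1 f2 f3 f4
      unfolding Q_def T_def using that by (intro PF_mult PF_const PF_add R_PF)
  qed (rule Q_jet)
  moreover have "eval x F = Q x x x x" for x
  proof -
    have "eval x F = R x x x x" unfolding eval_mon R_def by (rule sum.cong) (auto simp: ijkl(2))
    also have "\<dots> = Q x x x x" by (simp add: Q_def T_def)
    finally show ?thesis .
  qed
  ultimately show ?thesis using that by blast
qed

subsection \<open>Two parametrizations\<close>

locale quartic_hypersurface = quartic_form "n + 2" Q
  for n :: nat and Q :: "(nat \<Rightarrow> 'k::field_char_0) \<Rightarrow> (nat \<Rightarrow> 'k) \<Rightarrow> (nat \<Rightarrow> 'k) \<Rightarrow> (nat \<Rightarrow> 'k) \<Rightarrow> 'k" +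
  fixes F :: "'k mpoly"
  assumes F: "irreducible_form (n + 2) 4 F" and eval_F: "eval x F = Q x x x x"
begin

lemma grad_F: "grad F x z = 4 * Q x x x z"
proof -
  have "jetV (\<lambda>e. x + e *v z) x z"
    by (rule jetV_eq[OF jetV_add[OF jetV_const jetV_scale[OF jet_id jetV_const]]]) simp_all
  note J = jets[OF this this this this]
  show ?thesis
    using jet_unique[OF jet_line[of x z F, unfolded eval_F] J] by (simp add: symmetric)
qed

lemma jetV_line_sum:
  "jetV (\<lambda>e. x + (\<Sum>j<m. (0 + e *v u) (h j) *v f j)) x (\<Sum>j<m. u (h j) *v f j)"
proof -
  have *: "jet (\<lambda>e. (0 + e *v u) (h j)) 0 (u (h j))" for j
    using jet_mult[OF jet_id jet_const[of "u (h j)"]] by simp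
  have "jetV (\<lambda>e. x + (\<Sum>j<m. (0 + e *v u) (h j) *v f j)) (x + (\<Sum>j<m. 0 *v f j)) (0 + (\<Sum>j<m. 0 *v 0 + u (h j) *v f j))"
    by (intro jetV_add jetV_const jetV_sum jetV_scale *)
  then show ?thesis by simp
qed

text \<open>Projection from \<open>v\<close>: a line through a triple point meets the quartic in one
  further point. The \<open>n\<close>-dimensional affine space through \<open>x0\<close>, with
  directions independent of \<open>v\<close> and \<open>x0\<close>, parametrizes the lines through
  \<open>v\<close>.\<close>

lemma unirational_triple_point:
  assumes v: "i < n + 2" "v i \<noteq> 0" and triple: "\<And>a b. Q v v a b = 0" and x0: "Q v x0 x0 x0 \<noteq> 0"
  shows "unirational_hypersurface (n + 2) F"
proof -
  define f0 where "f0 j = (if j = 0 then v else x0)" for j :: nat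
  have "indep_family (n + 2) 2 f0" unfolding indep_family_def
  proof (intro allI impI)
    fix y j assume y: "\<forall>i<n + 2. (\<Sum>j<2. y j * f0 j i) = 0" and j: "j < (2::nat)"
    have y': "(y 0 *v v + y 1 *v x0) i = (0 :: nat \<Rightarrow> 'k) i" if "i < n + 2" for i
      using y that by (simp add: f0_def numeral_2_eq_2)
    have "Q v x0 x0 (y 0 *v v + y 1 *v x0) = Q v x0 x0 0" by (rule cong4) (rule y')
    then have "y 1 = 0" using x0 triple[of x0 x0] by (simp add: multilinear symmetric)
    moreover then have "y 0 = 0" using y'[OF v(1)] v(2) by simp
    ultimately show "y j = 0" using j by (auto simp: less_2_cases_iff)
  qed
  then obtain f where f: "indep_family (n + 2) (n + 2) f" "\<And>j. j < 2 \<Longrightarrow> f j = f0 j"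
    using indep_family_extend[of "n + 2" 2 f0] by auto
  have f01: "f 0 = v" "f (Suc 0) = x0" using f(2)[of 0] f(2)[of 1] by (auto simp: f0_def)
  define x where "x t = x0 + (\<Sum>j<n. t j *v f (Suc (Suc j)))" for t
  define g where "g t = (4 * Q v (x t) (x t) (x t)) *v x t + (- Q (x t) (x t) (x t) (x t)) *v v" for t
  have x0': "x 0 = x0" by (simp add: x_def)
  show ?thesis
  proof (rule unirational_of_param[OF F, of g 0 v])
    fix i show "PF n (\<lambda>t. g t i)"
    proof -
      have "PFV n x" unfolding x_def[abs_def] by (intro PFV_add PFV_const PFV_sum PFV_scale PF_coord) simp
      then have "PFV n g" unfolding g_def[abs_def]
        by (intro PFV_add PFV_const PFV_scale PF_mult PF_const PF_uminus PF)
      then show ?thesis by (simp add: PFV_def)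
    qed
  next
    show "eval (g t) F = 0" for t
      unfolding eval_F g_def by (rule third_point) (use triple in auto)
  next
    have g0: "Q v (g 0) (g 0) (g 0) = (4 * Q v x0 x0 x0) ^ 3 * Q v x0 x0 x0"
      unfolding g_def x0' using triple by (simp add: multilinear power3_eq_cube) (simp add: symmetric multilinear triple)
    then show "grad F (g 0) v \<noteq> 0" using x0 unfolding grad_F by (simp add: symmetric)
    fix s u D
    assume jet: "\<And>i. i < n + 2 \<Longrightarrow> jet (\<lambda>e. g (0 + e *v u) i) (g 0 i) (D i)"
      and eq: "\<And>i. i < n + 2 \<Longrightarrow> s * g 0 i + D i = 0"
    define V where "V = (\<Sum>j<n. u j *v f (Suc (Suc j)))"
    have jx: "jetV (\<lambda>e. x (0 + e *v u)) x0 V"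
      unfolding x_def V_def by (rule jetV_line_sum)
    define T where "T = 4 * Q v x0 x0 x0"
    obtain T' where T': "jet (\<lambda>e. 4 * Q v (x (0 + e *v u)) (x (0 + e *v u)) (x (0 + e *v u))) T T'"
      using jet_mult[OF jet_const[of 4] jets[OF jetV_const[of v] jx jx jx]] by (auto simp: T_def)
    obtain S' where S': "jet (\<lambda>e. - Q (x (0 + e *v u)) (x (0 + e *v u)) (x (0 + e *v u)) (x (0 + e *v u))) (- Q x0 x0 x0 x0) S'"
      using jet_diff[OF jet_const[of 0] jets[OF jx jx jx jx]] by auto
    have "jetV (\<lambda>e. g (0 + e *v u)) (T *v x0 + (- Q x0 x0 x0 x0) *v v) ((T *v V + T' *v x0) + ((- Q x0 x0 x0 x0) *v 0 + S' *v v))"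
      unfolding g_def by (rule jetV_add[OF jetV_scale[OF T' jx] jetV_scale[OF S' jetV_const]])
    then have D: "D i = T * V i + T' * x0 i + S' * v i" if "i < n + 2" for i
      using jet_unique[OF jet[OF that]] unfolding jetV_def by fastforce
    \<comment> \<open>The coefficients of the vector \<open>s * g 0 + D\<close> in the basis
      \<open>f\<close>; being zero they give \<open>u = 0\<close>.\<close>
    define y where "y j = (case j of 0 \<Rightarrow> S' - s * Q x0 x0 x0 x0 | Suc 0 \<Rightarrow> T' + s * T | Suc (Suc j) \<Rightarrow> T * u j)" for j
    have "(\<Sum>j<n+2. y j * f j i) = 0" if "i < n + 2" for i
    proof -
      have "(\<Sum>j<n+2. y j * f j i) = (S' - s * Q x0 x0 x0 x0) * v i + ((T' + s * T) * x0 i + (\<Sum>j<n. T * u j * f (Suc (Suc j)) i))"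
        by (simp add: sum.lessThan_Suc_shift y_def f01 del: sum.lessThan_Suc)
      also have "(\<Sum>j<n. T * u j * f (Suc (Suc j)) i) = T * V i"
        by (simp add: V_def sum_fun_apply sum_distrib_left mult.assoc)
      also have "(S' - s * Q x0 x0 x0 x0) * v i + ((T' + s * T) * x0 i + T * V i) = s * g 0 i + D i"
        by (simp add: D[OF that] g_def x0' T_def algebra_simps)
      finally show ?thesis using eq[OF that] by simp
    qed
    then have y0: "y j = 0" if "j < n + 2" for j using indep_familyD[OF f(1)] that by blast
    have T: "T \<noteq> 0" using x0 by (simp add: T_def)
    have u0: "u j = 0" if "j < n" for j using y0[of "Suc (Suc j)"] that T by (simp add: y_def)
    then have "x (0 + e *v u) = x0" for e by (simp add: x_def)
    then have gc: "g (0 + e *v u) = g 0" for e by (simp add: g_def x0')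
    have "D i = 0" if "i < n + 2" for i using jet[OF that] jet_unique[OF _ jet_const] unfolding gc by blast
    then have "s * g 0 i = 0" if "i < n + 2" for i using eq[OF that] that by simp
    then have "s = 0 \<or> (\<forall>i<n+2. g 0 i = (0 :: nat \<Rightarrow> 'k) i)" by auto
    moreover have "\<not> (\<forall>i<n+2. g 0 i = (0 :: nat \<Rightarrow> 'k) i)"
    proof
      assume "\<forall>i<n+2. g 0 i = (0 :: nat \<Rightarrow> 'k) i"
      then have "Q v (g 0) (g 0) (g 0) = Q v (g 0) (g 0) 0" by (intro cong4) blast
      then show False using g0 x0 by (simp add: multilinear)
    qed
    ultimately show "s = 0 \<and> (\<forall>j<n. u j = 0)" using u0 by blast
  qed
qed

text \<open>For \<open>p\<close> in the linear space and \<open>q\<close> with \<open>Q p p p q = Q p p q q = 0\<close> the line joining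
  \<open>p\<close> and \<open>q\<close> meets the quartic three times at \<open>p\<close>; its fourth point depends rationally on
  \<open>(p, q)\<close>. Here \<open>p\<close> moves in the plane spanned by \<open>p, k, r\<close>, while \<open>q\<close> is corrected
  along \<open>w\<close> and \<open>r\<close> so as to satisfy the two equations.\<close>

lemma unirational_tangent_lines:
  assumes n: "n = m + 2"
    and S: "\<And>a b c d. a \<in> {p, k, r} \<Longrightarrow> b \<in> {p, k, r} \<Longrightarrow> c \<in> {p, k, r} \<Longrightarrow> d \<in> {p, k, r} \<Longrightarrow> Q a b c d = 0"
    and h1: "Q p p p q = 0" and h2: "Q k p p q = 0" and h3: "Q r p p q \<noteq> 0" and h4: "Q p p q q = 0"
    and h5: "Q k p q q \<noteq> 0" and h6: "Q p q q q \<noteq> 0" and h7: "Q q q q q = 0" and h8: "Q p p p w \<noteq> 0"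
  shows "unirational_hypersurface (n + 2) F"
proof -
  note S0 = S[of p p p p, simplified] S[of p p p k, simplified] S[of p p p r, simplified]
  \<comment> \<open>Independence of \<open>p, r, w, q\<close> is triangular: pairing a relation with
    \<open>p p p\<close>, \<open>p p q\<close>, \<open>p q q\<close> and \<open>q q q\<close>
    isolates the coefficients of \<open>w\<close>, \<open>r\<close>, \<open>q\<close> and
    \<open>p\<close> in turn.\<close>
  define f0 where "f0 j = (if j = 0 then p else if j = 1 then r else if j = 2 then w else q)" for j :: nat
  have "indep_family (n + 2) 4 f0" unfolding indep_family_def
  proof (intro allI impI)
    fix y j assume y: "\<forall>i<n + 2. (\<Sum>j<4. y j * f0 j i) = 0" and j: "j < (4::nat)"
    let ?v = "y 0 *v p + y 1 *v r + y 2 *v w + y 3 *v q"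
    have y': "?v i = (0 :: nat \<Rightarrow> 'k) i" if "i < n + 2" for i
      using y that by (simp add: f0_def numeral_eq_Suc)
    have z: "Q a b c ?v = 0" for a b c
      using cong4[of ?v 0 a b c, OF y'] by (simp add: multilinear)
    have 2: "y 2 = 0" using z[of p p p] h1 h8 S0 by (simp add: multilinear symmetric)
    have 1: "y 1 = 0" using z[of p p q] h1 h3 h4 2 by (simp add: multilinear symmetric)
    have 3: "y 3 = 0" using z[of p q q] h4 h6 1 2 by (simp add: multilinear symmetric)
    have 0: "y 0 = 0" using z[of q q q] h6 1 2 3 by (simp add: multilinear symmetric)
    have "j = 0 \<or> j = 1 \<or> j = 2 \<or> j = 3" using j by linarith
    then show "y j = 0" using 0 1 2 3 by auto
  qed
  then obtain f where f: "indep_family (n + 2) (n + 2) f" "\<And>j. j < 4 \<Longrightarrow> f j = f0 j"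
    using indep_family_extend[of "n + 2" 4 f0] n by auto
  have f0123: "f 0 = p" "f (Suc 0) = r" "f (Suc (Suc 0)) = w" "f (Suc (Suc (Suc 0))) = q"
    using f(2)[of 0] f(2)[of 1] f(2)[of 2] f(2)[of 3] by (auto simp: f0_def numeral_eq_Suc)
  define P where "P t = p + (t 0 *v k + t 1 *v r)" for t :: "nat \<Rightarrow> 'k"
  define U where "U t = q + (\<Sum>j<m. t (Suc (Suc j)) *v f (Suc (Suc (Suc (Suc j)))))" for t
  define q1 where "q1 t = Q (P t) (P t) (P t) w *v U t + (- Q (P t) (P t) (P t) (U t)) *v w" for t
  \<comment> \<open>On combinations of \<open>q1\<close> and \<open>r\<close> the form
    \<open>Q P P\<close> has no square term in \<open>r\<close>, since \<open>P\<close> and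
    \<open>r\<close> lie in the linear space. One zero, \<open>r\<close>, is thus known, and the
    other is given by a linear equation.\<close>
  define q2 where "q2 t = (2 * Q (P t) (P t) r (q1 t)) *v q1 t + (- Q (P t) (P t) (q1 t) (q1 t)) *v r" for t
  define g where "g t = (4 * Q (P t) (q2 t) (q2 t) (q2 t)) *v q2 t + (- Q (q2 t) (q2 t) (q2 t) (q2 t)) *v P t" for t
  have SP: "Q (P t) (P t) (P t) (P t) = 0" "Q (P t) (P t) (P t) r = 0" "Q (P t) (P t) r r = 0" for t
    unfolding P_def by (simp_all add: multilinear S)
  have c1: "Q (P t) (P t) (P t) (q1 t) = 0" for t
    unfolding q1_def by (simp add: multilinear)
  have c2: "Q (P t) (P t) (P t) (q2 t) = 0" for t
    unfolding q2_def by (simp add: multilinear c1 SP)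
  have c3: "Q (P t) (P t) (q2 t) (q2 t) = 0" for t
  proof -
    have "Q (P t) (P t) (q1 t) r = Q (P t) (P t) r (q1 t)" by (rule sym3)
    then show ?thesis unfolding q2_def by (simp add: multilinear SP algebra_simps)
  qed
  have P0: "P 0 = p" and U0: "U 0 = q" by (simp_all add: P_def U_def)
  \<comment> \<open>At the base point \<open>q\<close> satisfies both equations and lies on the
    quartic, so no correction occurs and \<open>q1 0\<close>, \<open>q2 0\<close>,
    \<open>g 0\<close> are nonzero multiples of \<open>q\<close>.\<close>
  define e1 where "e1 = Q p p p w"
  have q10: "q1 0 = e1 *v q" by (simp add: q1_def P0 U0 h1 e1_def)
  define b where "b = 2 * Q p p r (e1 *v q)"
  have q20: "q2 0 = (b * e1) *v q" by (simp add: q2_def P0 q10 b_def multilinear h4)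
  define e2 where "e2 = b * e1"
  have nz: "e1 \<noteq> 0" "b \<noteq> 0" "e2 \<noteq> 0"
    using h3 h8 by (simp_all add: e1_def b_def e2_def multilinear symmetric)
  define \<alpha> where "\<alpha> = 4 * Q p (q2 0) (q2 0) (q2 0)"
  have \<alpha>: "\<alpha> \<noteq> 0" using h6 nz by (simp add: \<alpha>_def q20 e2_def[symmetric] multilinear)
  have g0: "g 0 = \<alpha> *v q2 0" by (simp add: g_def P0 \<alpha>_def[symmetric]) (simp add: q20 multilinear h7)
  show ?thesis
  proof (rule unirational_of_param[OF F, of g 0 p])
    fix i show "PF n (\<lambda>t. g t i)"
    proof -
      have P: "PFV n P" unfolding P_def[abs_def] using n by (intro PFV_add PFV_const PFV_scale PF_coord) simp_all
      have U: "PFV n U" unfolding U_def[abs_def] using n by (intro PFV_add PFV_const PFV_sum PFV_scale PF_coord) simp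
      have 1: "PFV n q1" unfolding q1_def[abs_def] by (intro PFV_add PFV_const PFV_scale PF_uminus PF P U)
      have 2: "PFV n q2" unfolding q2_def[abs_def] by (intro PFV_add PFV_const PFV_scale PF_mult PF_const PF_uminus PF P 1)
      have "PFV n g" unfolding g_def[abs_def] by (intro PFV_add PFV_scale PF_mult PF_const PF_uminus PF P 2)
      then show ?thesis by (simp add: PFV_def)
    qed
  next
    show "eval (g t) F = 0" for t
      unfolding eval_F g_def by (rule third_point) (use c2 c3 SP in auto)
  next
    show "grad F (g 0) p \<noteq> 0"
      using \<alpha> nz h6 unfolding grad_F g0 q20 e2_def[symmetric] by (simp add: multilinear symmetric)
    fix s u D
    assume jet: "\<And>i. i < n + 2 \<Longrightarrow> jet (\<lambda>e. g (0 + e *v u) i) (g 0 i) (D i)"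
      and eq: "\<And>i. i < n + 2 \<Longrightarrow> s * g 0 i + D i = 0"
    define V where "V = (\<Sum>j<m. u (Suc (Suc j)) *v f (Suc (Suc (Suc (Suc j)))))"
    define P' where "P' = u 0 *v k + u 1 *v r"
    let ?t = "\<lambda>e. 0 + e *v u"
    have jU: "jetV (\<lambda>e. U (?t e)) q V"
      unfolding U_def V_def by (rule jetV_line_sum[where h = "\<lambda>j. Suc (Suc j)"])
    have jt: "jet (\<lambda>e. ?t e j) 0 (u j)" for j
      using jet_mult[OF jet_id jet_const[of "u j"]] by simp
    have jP: "jetV (\<lambda>e. P (?t e)) p P'"
      unfolding P_def P'_def
      by (rule jetV_eq[OF jetV_add[OF jetV_const jetV_add[OF jetV_scale[OF jt jetV_const] jetV_scale[OF jt jetV_const]]]]) simp_all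
    have neg: "\<exists>b'. jet (\<lambda>e. - h e) (- a) b'" if "jet h a b" for h a b
      using jet_diff[OF jet_const[of 0] that] by auto
    obtain a1 where a1: "jet (\<lambda>e. Q (P (?t e)) (P (?t e)) (P (?t e)) w) e1 a1"
      using jets[OF jP jP jP jetV_const[of w]] by (auto simp: e1_def)
    obtain a2 where a2: "jet (\<lambda>e. - Q (P (?t e)) (P (?t e)) (P (?t e)) (U (?t e))) 0 a2"
      using neg[OF jets[OF jP jP jP jU]] h1 by auto
    define q1' where "q1' = e1 *v V + a1 *v q + a2 *v w"
    have j1: "jetV (\<lambda>e. q1 (?t e)) (e1 *v q) q1'"
      unfolding q1_def q1'_def
      by (rule jetV_eq[OF jetV_add[OF jetV_scale[OF a1 jU] jetV_scale[OF a2 jetV_const]]]) simp_all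
    obtain a3 where a3: "jet (\<lambda>e. 2 * Q (P (?t e)) (P (?t e)) r (q1 (?t e))) b a3"
      using jet_mult[OF jet_const[of 2] jets[OF jP jP jetV_const[of r] j1]] by (auto simp: b_def)
    obtain a4 where a4: "jet (\<lambda>e. - Q (P (?t e)) (P (?t e)) (q1 (?t e)) (q1 (?t e))) 0 a4"
      using neg[OF jets[OF jP jP j1 j1]] h4 by (auto simp: multilinear)
    define q2' where "q2' = b *v q1' + (a3 * e1) *v q + a4 *v r"
    have j2: "jetV (\<lambda>e. q2 (?t e)) (e2 *v q) q2'"
      unfolding q2_def q2'_def e2_def
      by (rule jetV_eq[OF jetV_add[OF jetV_scale[OF a3 j1] jetV_scale[OF a4 jetV_const]]]) simp_all
    have q20': "q2 0 = e2 *v q" by (simp add: q20 e2_def)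
    obtain a5 where a5: "jet (\<lambda>e. 4 * Q (P (?t e)) (q2 (?t e)) (q2 (?t e)) (q2 (?t e))) \<alpha> a5"
      using jet_mult[OF jet_const[of 4] jets[OF jP j2 j2 j2]] by (auto simp: \<alpha>_def q20')
    obtain a6 where a6: "jet (\<lambda>e. - Q (q2 (?t e)) (q2 (?t e)) (q2 (?t e)) (q2 (?t e))) 0 a6"
      using neg[OF jets[OF j2 j2 j2 j2]] h7 by (auto simp: multilinear)
    have "jetV (\<lambda>e. g (?t e)) (\<alpha> *v (e2 *v q) + 0 *v p) ((\<alpha> *v q2' + a5 *v (e2 *v q)) + (0 *v P' + a6 *v p))"
      unfolding g_def by (rule jetV_add[OF jetV_scale[OF a5 j2] jetV_scale[OF a6 jP]])
    then have D: "D i = \<alpha> * q2' i + a5 * e2 * q i + a6 * p i" if "i < n + 2" for i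
      using jet_unique[OF jet[OF that]] unfolding jetV_def by fastforce
    \<comment> \<open>The relation \<open>s * g 0 + D = 0\<close> is solved for the derivative
      \<open>q2'\<close> of \<open>q2\<close>, which is thereby a combination of \<open>q\<close>
      and \<open>p\<close>.\<close>
    define x1 where "x1 = - (a5 * e2 + s * \<alpha> * e2) / \<alpha>"
    define x2 where "x2 = - a6 / \<alpha>"
    have ax: "\<alpha> * x1 = - (a5 * e2 + s * \<alpha> * e2)" "\<alpha> * x2 = - a6" using \<alpha> by (simp_all add: x1_def x2_def)
    have q2'i: "q2' i = x1 * q i + x2 * p i" if "i < n + 2" for i
    proof -
      have "\<alpha> * q2' i + a5 * e2 * q i + a6 * p i + s * \<alpha> * e2 * q i = 0"
        using eq[OF that] D[OF that] by (simp add: g0 q20' algebra_simps)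
      then have "\<alpha> * q2' i = - (a5 * e2 * q i + a6 * p i + s * \<alpha> * e2 * q i)"
        by (simp only: eq_neg_iff_add_eq_0 add.assoc)
      also have "\<dots> = - (a5 * e2 + s * \<alpha> * e2) * q i + - a6 * p i" by (simp add: algebra_simps)
      also have "\<dots> = \<alpha> * (x1 * q i + x2 * p i)" by (simp only: distrib_left mult.assoc[symmetric] ax)
      finally show ?thesis using \<alpha> by simp
    qed
    have Qq2': "Q a c d q2' = x1 * Q a c d q + x2 * Q a c d p" for a c d
      using cong4[of q2' "x1 *v q + x2 *v p" a c d] q2'i by (simp add: multilinear)
    \<comment> \<open>The two equations hold identically in the parameters. In their derivatives the
      terms with \<open>q2'\<close> drop out, since it is a combination of \<open>p\<close> and
      \<open>q\<close>; what remains concerns \<open>P'\<close> alone and kills first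
      \<open>u 1\<close>, then \<open>u 0\<close>.\<close>
    have "jet (\<lambda>e. Q (P (?t e)) (P (?t e)) (P (?t e)) (q2 (?t e))) 0 0" unfolding c2 by (rule jet_const)
    from conjunct2[OF jet_unique[OF jets[OF jP jP jP j2] this]]
    have "e2 * (3 * Q P' p p q) + Q p p p q2' = 0" by (simp add: multilinear symmetric algebra_simps)
    then have "Q P' p p q = 0" using nz by (simp add: Qq2' h1 S0)
    then have u1: "u 1 = 0" using h2 h3 by (simp add: P'_def multilinear)
    have "jet (\<lambda>e. Q (P (?t e)) (P (?t e)) (q2 (?t e)) (q2 (?t e))) 0 0" unfolding c3 by (rule jet_const)
    from conjunct2[OF jet_unique[OF jets[OF jP jP j2 j2] this]]
    have "e2 * e2 * (2 * Q P' p q q) + 2 * e2 * Q p p q q2' = 0" by (simp add: multilinear symmetric algebra_simps)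
    moreover have "Q p p q p = 0" using h1 by (simp add: symmetric)
    ultimately have "Q P' p q q = 0" using nz by (simp add: Qq2' h4)
    then have u0: "u 0 = 0" using h5 u1 by (simp add: P'_def multilinear)
    define y where "y j = (case j of 0 \<Rightarrow> - x2 | Suc 0 \<Rightarrow> a4 | Suc (Suc 0) \<Rightarrow> b * a2 | Suc (Suc (Suc 0)) \<Rightarrow> b * a1 + a3 * e1 - x1
      | Suc (Suc (Suc (Suc j))) \<Rightarrow> b * e1 * u (Suc (Suc j)))" for j
    have "(\<Sum>j<n+2. y j * f j i) = 0" if "i < n + 2" for i
    proof -
      have "(\<Sum>j<n+2. y j * f j i) = - x2 * p i + (a4 * r i + (b * a2 * w i + ((b * a1 + a3 * e1 - x1) * q i
          + (\<Sum>j<m. b * e1 * u (Suc (Suc j)) * f (Suc (Suc (Suc (Suc j)))) i))))"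
        by (simp add: n sum.lessThan_Suc_shift y_def f0123 del: sum.lessThan_Suc)
      also have "(\<Sum>j<m. b * e1 * u (Suc (Suc j)) * f (Suc (Suc (Suc (Suc j)))) i) = b * e1 * V i"
        by (simp add: V_def sum_fun_apply sum_distrib_left mult.assoc)
      also have "- x2 * p i + (a4 * r i + (b * a2 * w i + ((b * a1 + a3 * e1 - x1) * q i + b * e1 * V i))) = q2' i - (x1 * q i + x2 * p i)"
        by (simp add: q2'_def q1'_def algebra_simps)
      finally show ?thesis using q2'i[OF that] by simp
    qed
    then have y0: "y j = 0" if "j < n + 2" for j using indep_familyD[OF f(1)] that by blast
    have u2: "u (Suc (Suc j)) = 0" if "j < m" for j
      using y0[of "Suc (Suc (Suc (Suc j)))"] that nz n by (simp add: y_def)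
    have u: "u j = 0" if "j < n" for j
      using u0 u1 u2[of "j - 2"] that n by (cases j; cases "j - 1") auto
    have "P (?t e) = p" "U (?t e) = q" for e
      using u0 u1 u2 by (simp_all add: P_def U_def)
    then have gc: "g (?t e) = g 0" for e by (simp add: g_def q2_def q1_def P0 U0)
    have "D i = 0" if "i < n + 2" for i using jet[OF that] jet_unique[OF _ jet_const] unfolding gc by blast
    then have "s * g 0 i = 0" if "i < n + 2" for i using eq[OF that] that by simp
    then have "s = 0 \<or> (\<forall>i<n+2. g 0 i = (0 :: nat \<Rightarrow> 'k) i)" by auto
    moreover have "\<not> (\<forall>i<n+2. g 0 i = (0 :: nat \<Rightarrow> 'k) i)"
    proof
      assume "\<forall>i<n+2. g 0 i = (0 :: nat \<Rightarrow> 'k) i"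
      then have "Q p q q (g 0) = Q p q q 0" by (intro cong4) blast
      then show False using \<alpha> nz h6 by (simp add: multilinear g0 q20')
    qed
    ultimately show "s = 0 \<and> (\<forall>j<n. u j = 0)" using u by blast
  qed
qed

end

subsection \<open>Quartics containing a linear space\<close>

declare add_2_eq_Suc [simp del] add_2_eq_Suc' [simp del]

text \<open>One coordinate vector \<open>z\<close> encodes a pair \<open>(x, y)\<close>: the entries
  from \<open>c\<close> on are coordinates of \<open>x\<close> in the linear space spanned by
  \<open>b c, ..., b (N - 1)\<close>, those below \<open>c\<close> coordinates of \<open>y\<close>
  in a complement. Functions of pairs are thus polynomials in \<open>N\<close> variables.\<close>

definition xpart :: "nat \<Rightarrow> nat \<Rightarrow> (nat \<Rightarrow> nat \<Rightarrow> 'k::comm_ring_1) \<Rightarrow> (nat \<Rightarrow> 'k) \<Rightarrow> nat \<Rightarrow> 'k" where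
  "xpart N c b z = (\<Sum>i\<in>{c..<N}. z i *v b i)"

definition ypart :: "nat \<Rightarrow> (nat \<Rightarrow> nat \<Rightarrow> 'k::comm_ring_1) \<Rightarrow> (nat \<Rightarrow> 'k) \<Rightarrow> nat \<Rightarrow> 'k" where
  "ypart c b z = (\<Sum>j<c. z j *v b j)"

lemma xpart_linear: "xpart N c b (z + z') = xpart N c b z + xpart N c b z'" "xpart N c b (t *v z) = t *v xpart N c b z"
  and ypart_linear: "ypart c b (z + z') = ypart c b z + ypart c b z'" "ypart c b (t *v z) = t *v ypart c b z"
  by (auto simp: xpart_def ypart_def sum_fun_apply algebra_simps sum.distrib sum_distrib_left)

lemma xpart_cong: "(\<And>i. c \<le> i \<Longrightarrow> i < N \<Longrightarrow> z i = z' i) \<Longrightarrow> xpart N c b z = xpart N c b z'"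
  and ypart_cong: "(\<And>i. i < c \<Longrightarrow> z i = z' i) \<Longrightarrow> ypart c b z = ypart c b z'"
  by (auto simp: xpart_def ypart_def intro!: sum.cong)

lemma xpart_zero: "(\<And>i. c \<le> i \<Longrightarrow> i < N \<Longrightarrow> z i = 0) \<Longrightarrow> xpart N c b z = 0"
  and ypart_zero: "(\<And>i. i < c \<Longrightarrow> z i = 0) \<Longrightarrow> ypart c b z = 0"
  by (auto simp: xpart_def ypart_def intro!: sum.neutral)

lemma ypart_uvec: "j < c \<Longrightarrow> ypart c b (uvec j) = b j"
  by (rule ext) (simp add: ypart_def sum_fun_apply uvec_def if_distrib[of "\<lambda>x. x * _"] cong: if_cong)

lemma PFV_xpart: "PFV N (xpart N c b)"
  and PFV_ypart: "c \<le> N \<Longrightarrow> PFV N (ypart c b)"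
  unfolding xpart_def[abs_def] ypart_def[abs_def]
  by (auto intro!: PFV_sum PFV_scale PF_coord PFV_const)

lemma jetV_linear:
  assumes "\<And>z z'. f (z + z') = f z + f z'" "\<And>t z. f (t *v z) = t *v f z"
  shows "jetV (\<lambda>e. f (z + e *v z')) (f z) (f z')"
  unfolding assms by (rule jetV_eq[OF jetV_add[OF jetV_const jetV_scale[OF jet_id jetV_const]]]) simp_all

lemmas jetV_xpart = jetV_linear[of "xpart N c b" for N c b, OF xpart_linear]
lemmas jetV_ypart = jetV_linear[of "ypart c b" for c b, OF ypart_linear]

lemma poly_eq_finite_exceptions:
  fixes P :: "'k::field_char_0 poly"
  assumes "P \<noteq> 0" shows "\<exists>s. poly P s \<noteq> 0"
  using assms poly_all_0_iff_0 by blast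

context quartic_hypersurface
begin

text \<open>Adding \<open>s k\<close> to \<open>q\<close> preserves the earlier conditions;
  \<open>P1\<close> and \<open>P2\<close> are \<open>Q p k q' q'\<close> and
  \<open>Q p q' q' q'\<close> as polynomials in \<open>s\<close>, both nonzero by \<open>h5\<close>,
  so some \<open>s\<close> avoids their zeros. Adding \<open>t p\<close> then moves
  \<open>q'\<close> onto the quartic, by an equation linear in \<open>t\<close>.\<close>

lemma unirational_nondegenerate:
  assumes n: "n = m + 2"
    and S: "\<And>a b c d. a \<in> {p, k, r} \<Longrightarrow> b \<in> {p, k, r} \<Longrightarrow> c \<in> {p, k, r} \<Longrightarrow> d \<in> {p, k, r} \<Longrightarrow> Q a b c d = 0"
    and h1: "Q p p p q = 0" and h2: "Q p p k q = 0" and h3: "Q p p r q \<noteq> 0" and h4: "Q p p q q = 0"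
    and h5: "Q p k k q \<noteq> 0 \<or> Q p k q q \<noteq> 0" and h8: "Q p p p w \<noteq> 0"
  shows "unirational_hypersurface (n + 2) F"
proof -
  note S0 = S[of p p p p, simplified] S[of p p p k, simplified] S[of p p p r, simplified] S[of p p k k, simplified] S[of p k k k, simplified]
    S[of p p k r, simplified]
  define P1 where "P1 = [:Q p k q q, 2 * Q p k k q:]"
  define P2 where "P2 = [:Q p q q q, 3 * Q p k q q, 3 * Q p k k q:]"
  have "P1 * P2 \<noteq> 0" using h5 by (auto simp: P1_def P2_def)
  then obtain s where s: "poly P1 s \<noteq> 0" "poly P2 s \<noteq> 0" using poly_eq_finite_exceptions[of "P1 * P2"] by auto
  define q' where "q' = q + s *v k"
  have 1: "Q p p p q' = 0" "Q k p p q' = 0" "Q r p p q' \<noteq> 0" "Q p p q' q' = 0"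
    using h1 h2 h3 h4 S0 unfolding q'_def by (simp_all add: multilinear symmetric)
  have 2: "Q k p q' q' \<noteq> 0"
    using s(1) S0 unfolding q'_def P1_def by (simp add: multilinear symmetric algebra_simps)
  have 3: "Q p q' q' q' \<noteq> 0"
    using s(2) S0 unfolding q'_def P2_def by (simp add: multilinear symmetric algebra_simps)
  define t where "t = - Q q' q' q' q' / (4 * Q p q' q' q')"
  define q0 where "q0 = q' + t *v p"
  have t: "4 * t * Q p q' q' q' = - Q q' q' q' q'" using 3 by (simp add: t_def)
  have "Q q0 q0 q0 q0 = Q q' q' q' q' + 4 * t * Q p q' q' q'"
    using 1 S0 unfolding q0_def by (simp add: multilinear symmetric algebra_simps)
  then have "Q q0 q0 q0 q0 = 0" by (simp add: t)
  moreover have "Q p p p q0 = 0" "Q k p p q0 = 0" "Q r p p q0 \<noteq> 0" "Q p p q0 q0 = 0"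
    using 1 S0 unfolding q0_def by (simp_all add: multilinear symmetric)
  moreover have "Q k p q0 q0 \<noteq> 0" "Q p q0 q0 q0 \<noteq> 0"
    using 1 2 3 S0 unfolding q0_def by (simp_all add: multilinear symmetric)
  ultimately show ?thesis using unirational_tangent_lines[OF n S] h8 by blast
qed

end

text \<open>The vectors \<open>b i\<close> with \<open>c \<le> i\<close> span the linear space, of
  vector dimension \<open>n + 2 - c\<close>, hence at least three. \<open>A j\<close> is the cubic
  \<open>Q x x x (b j)\<close> on it, and a \<open>D\<close> free of the variables below
  \<open>c\<close> is a polynomial on the linear space.\<close>

locale linear_subspace = quartic_hypersurface n Q F
  for n :: nat and Q :: "(nat \<Rightarrow> 'k::field_char_0) \<Rightarrow> (nat \<Rightarrow> 'k) \<Rightarrow> (nat \<Rightarrow> 'k) \<Rightarrow> (nat \<Rightarrow> 'k) \<Rightarrow> 'k" and F :: "'k mpoly" +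
  fixes c :: nat and b :: "nat \<Rightarrow> nat \<Rightarrow> 'k" and A :: "nat \<Rightarrow> 'k mpoly"
  assumes c: "c + 3 \<le> n + 2" and n: "n \<ge> 2"
    and indep: "indep_family (n + 2) (n + 2) b"
    and isotropic: "Q (xpart (n + 2) c b z1) (xpart (n + 2) c b z2) (xpart (n + 2) c b z3) (xpart (n + 2) c b z4) = 0"
    and in_vars_A: "in_vars (n + 2) (A j)"
    and eval_A: "eval z (A j) = Q (xpart (n + 2) c b z) (xpart (n + 2) c b z) (xpart (n + 2) c b z) (b j)"
    and no_common_factor: "in_vars (n + 2) D \<Longrightarrow> (\<And>j. j < c \<Longrightarrow> free_of j D) \<Longrightarrow> (\<And>j. j < c \<Longrightarrow> D dvd A j) \<Longrightarrow> D dvd 1"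
begin

abbreviation X where "X \<equiv> xpart (n + 2) c b"
abbreviation Y where "Y \<equiv> ypart c b"

definition C where "C = (\<Sum>j<c. Var j * A j)"

lemma eval_C: "eval z C = Q (X z) (X z) (X z) (Y z)"
proof -
  have "Q a a' a'' (\<Sum>j\<in>J. t j *v b j) = (\<Sum>j\<in>J. t j * Q a a' a'' (b j))" for a a' a'' t and J :: "nat set"
    by (induction J rule: infinite_finite_induct) (simp_all only: sum.insert sum.infinite sum.empty zero4 add4 scale4 simp_thms)
  then show ?thesis by (simp add: C_def eval_A ypart_def)
qed

lemma in_vars_C: "in_vars (n + 2) C"
  unfolding C_def by (intro in_vars_sum in_vars_simps in_vars_A) (use c in simp)

definition y0 :: "'k mpoly \<Rightarrow> 'k mpoly" where "y0 = subst (\<lambda>i. if i < c then 0 else Var i)"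

lemma free_of_y0: "j < c \<Longrightarrow> in_vars N p \<Longrightarrow> free_of j (y0 p)"
  unfolding y0_def by (rule free_of_subst) (auto simp: free_of_Var)

lemma y0_A: "y0 (A j) = A j"
proof (rule mpoly_eqI)
  fix z
  have "X (\<lambda>i. eval z (if i < c then 0 else Var i)) = X z" by (rule xpart_cong) auto
  then show "eval z (y0 (A j)) = eval z (A j)" unfolding y0_def eval_subst eval_A by simp
qed

lemma shom_y0: "shom {..<c} (y0 p) = [:y0 p:]"
  by (rule ring_map_eqI[of "\<lambda>p. shom {..<c} (y0 p)" "\<lambda>p. [:y0 p:]"])
    (auto simp: y0_def shom_Var intro!: ring_map_comp[OF ring_map_shom ring_map_subst] ring_map_comp[OF ring_map_pCons ring_map_subst])

text \<open>If all cubics were zero, the coordinate \<open>Var c\<close> of the linear space would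
  be a common factor and not a unit.\<close>

lemma ex_A_nonzero: "\<exists>j<c. A j \<noteq> 0"
proof (rule ccontr)
  assume "\<not> ?thesis"
  then have "Var c dvd (1 :: 'k mpoly)"
    using c by (intro no_common_factor) (auto simp: free_of_Var)
  then have "eval 0 (Var c) dvd eval 0 (1 :: 'k mpoly)" by (rule ring_map_dvd[OF ring_map_eval])
  then show False by simp
qed

text \<open>\<open>C\<close> has degree one in the \<open>y\<close>-coordinates, so one of two
  factors is free of them; putting \<open>y\<close> equal to each \<open>b j\<close> shows that this
  factor divides every \<open>A j\<close>.\<close>

lemma irreducible_C: "irreducible C"
proof -
  have sA: "shom {..<c} (A j) = [:A j:]" for j using shom_y0[of "A j"] by (simp add: y0_A)
  have "shom {..<c} C = (\<Sum>j<c. [:0, Var j:] * [:A j:])"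
    unfolding C_def shom_simps by (rule sum.cong) (auto simp: shom_Var sA)
  also have "\<dots> = [:0, C:]"
    by (rule poly_eqI) (auto simp: C_def coeff_sum coeff_pCons mult.commute intro!: sum.neutral split: nat.splits)
  finally have sC: "shom {..<c} C = [:0, C:]" .
  have sub: "subst (\<lambda>i. if i < c then (if i = j then 1 else 0) else Var i) C = A j" if j: "j < c" for j
  proof (rule mpoly_eqI)
    fix z :: "nat \<Rightarrow> 'k"
    let ?z = "\<lambda>i. eval z (if i < c then (if i = j then 1 else 0) else Var i)"
    have "X ?z = X z" by (rule xpart_cong) auto
    moreover have "Y ?z = Y (uvec j)" by (rule ypart_cong) (simp add: uvec_def)
    moreover have "Y (uvec j) = b j" using j by (rule ypart_uvec)
    ultimately show "eval z (subst (\<lambda>i. if i < c then (if i = j then 1 else 0) else Var i) C) = eval z (A j)"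
      unfolding eval_subst eval_C eval_A by simp
  qed
  have C0: "C \<noteq> 0" 
  proof
    assume "C = 0"
    then have "A j = 0" if "j < c" for j using sub[OF that] by simp
    then show False using ex_A_nonzero by blast
  qed
  have unit: "f dvd 1" if fg: "C = f * g" and deg: "degree (shom {..<c} f) = 0" for f g
  proof (rule no_common_factor)
    have f0: "y0 f = f" using degree_shom_0[OF deg] by (simp add: y0_def)
    show fv: "in_vars (n + 2) f" using in_vars_factor[of "n + 2" f g] in_vars_C fg C0 by simp
    show "free_of j f" if "j < c" for j using free_of_y0[OF that fv] f0 by simp
    show "f dvd A j" if "j < c" for j
    proof -
      let ?s = "subst (\<lambda>i. if i < c then (if i = j then 1 else 0) else Var i)"
      have "?s (y0 f) = y0 f" unfolding y0_def subst_subst by (rule arg_cong[of _ _ "\<lambda>h. subst h f"]) auto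
      then have "?s f = f" by (simp only: f0)
      then have "A j = f * ?s g" using sub[OF that] fg by simp
      then show ?thesis by simp
    qed
  qed
  show ?thesis
  proof (rule irreducibleI)
    show "C \<noteq> 0" by (rule C0)
    show "\<not> C dvd 1"
    proof
      assume "C dvd 1"
      then have "eval 0 C dvd eval 0 (1 :: 'k mpoly)" by (rule ring_map_dvd[OF ring_map_eval])
      moreover have "Y 0 = 0" by (rule ypart_zero) simp
      ultimately show False by (simp add: eval_C multilinear)
    qed
    fix f g assume fg: "C = f * g"
    then have nz: "f \<noteq> 0" "g \<noteq> 0" using C0 by auto
    have "shom {..<c} f * shom {..<c} g = [:0, C:]" using sC fg by simp
    then have "degree (shom {..<c} f) + degree (shom {..<c} g) = degree [:0, C:]"
      using nz by (metis degree_mult_eq shom_eq_0_iff)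
    then have "degree (shom {..<c} f) = 0 \<or> degree (shom {..<c} g) = 0" using C0 by auto
    then show "f dvd 1 \<or> g dvd 1" using unit[OF fg] unit[of g f] fg by (auto simp: mult.commute)
  qed
qed

section \<open>The variety \<open>V\<close>: density of its points, irreducibility, degrees\<close>

definition on_V where "on_V z \<longleftrightarrow> Q (X z) (X z) (X z) (Y z) = 0"
text \<open>The second condition says that the quartic is smooth at \<open>X z\<close>. It is what
  the vector \<open>w\<close> in the nondegenerate construction demands.\<close>

definition on_V' where "on_V' z \<longleftrightarrow> on_V z \<and> (\<exists>w. Q (X z) (X z) (X z) w \<noteq> 0)"

text \<open>The variety \<open>V\<close> is rational over \<open>'k\<close>, because its equation is linear in the \<open>y\<close>-coordinates;
  hence its \<open>'k\<close>-points are dense.\<close>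

lemma C_dvd:
  assumes "\<And>z. on_V' z \<Longrightarrow> eval z f = 0"
  shows "C dvd f"
proof (rule ccontr)
  assume ndvd: "\<not> C dvd f"
  obtain i where i: "i < c" "A i \<noteq> 0" using ex_A_nonzero by blast
  have upd: "eval (z(i := t)) C = eval (z(i := 0)) C + t * eval z (A i)" for z t
  proof -
    have "X (z(i := t)) = X z" "X (z(i := 0)) = X z" using i by (auto intro!: xpart_cong)
    moreover have "Y (z(i := t)) = Y (z(i := 0) + t *v uvec i)" by (rule ypart_cong) (auto simp: uvec_def)
    moreover have "Y (uvec i) = b i" using i by (simp add: ypart_uvec)
    ultimately show ?thesis by (simp add: eval_C eval_A ypart_linear multilinear)
  qed
  have "\<not> free_of i C"
  proof
    assume fr: "free_of i C"
    have "eval z (A i) = 0" for z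
      using upd[of z 1] eval_free_of[OF fr, of z] by simp
    then show False using i eval_eq_0_imp_eq_0 by blast
  qed
  then obtain R x y where R: "R \<noteq> 0" "free_of i R" "R = x * C + y * f" using elimination[OF irreducible_C _ ndvd] by blast
  have "eval z (A i * R) = 0" for z
  proof (cases "eval z (A i) = 0")
    case False
    \<comment> \<open>Solves the equation of \<open>V\<close> for the coordinate \<open>i\<close>,
      on which \<open>R\<close> does not depend.\<close>
    define t where "t = - eval (z(i := 0)) C / eval z (A i)"
    let ?z = "z(i := t)"
    have C0: "eval ?z C = 0" using upd[of z t] False by (simp add: t_def)
    have "X ?z = X z" using i by (auto intro!: xpart_cong)
    then have "on_V' ?z" using C0 False unfolding on_V'_def on_V_def eval_C eval_A by auto
    then have "eval ?z R = 0" using assms C0 R(3) by simp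
    then show ?thesis using eval_free_of[OF R(2)] by simp
  qed simp
  then have "A i * R = 0" by (rule eval_eq_0_imp_eq_0)
  then show False using i R(1) by simp
qed

lemma V_factor:
  assumes "PF (n + 2) f" "\<And>z. on_V' z \<Longrightarrow> f z = 0"
  obtains g where "\<And>z. f z = Q (X z) (X z) (X z) (Y z) * eval z g"
proof -
  obtain p where p: "\<And>z. f z = eval z p" using assms(1) by (auto simp: PF_def)
  then have "C dvd p" using assms(2) by (intro C_dvd) simp
  then obtain g where "p = C * g" by (rule dvdE)
  then show ?thesis using p by (intro that[of g]) (simp add: eval_C)
qed

text \<open>\<open>C\<close> is prime, so it divides one of the factors. That factor vanishes on all
  of \<open>V\<close>, although the hypothesis concerns only the points of
  \<open>on_V'\<close>.\<close>

lemma V_irreducible: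
  assumes "PF (n + 2) f" "PF (n + 2) g" "\<And>z. on_V' z \<Longrightarrow> f z * g z = 0"
  shows "(\<forall>z. on_V z \<longrightarrow> f z = 0) \<or> (\<forall>z. on_V z \<longrightarrow> g z = 0)"
proof -
  obtain p where p: "\<And>z. f z = eval z p" using assms(1) by (auto simp: PF_def)
  obtain q where q: "\<And>z. g z = eval z q" using assms(2) by (auto simp: PF_def)
  have "C dvd p * q" by (rule C_dvd) (use assms(3) p q in simp)
  then have "C dvd p \<or> C dvd q" using irreducible_dvd_mult_iff[OF irreducible_C] by blast
  then show ?thesis by (auto simp: p q on_V_def eval_C[symmetric] elim!: dvdE)
qed

definition scale_x where "scale_x t z = (\<lambda>i. if i < c then z i else t * z i)"

lemma X_scale_x: "X (scale_x t z) = t *v X z" and Y_scale_x: "Y (scale_x t z) = Y z"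
proof -
  have "X (scale_x t z) = X (t *v z)" by (rule xpart_cong) (simp add: scale_x_def)
  then show "X (scale_x t z) = t *v X z" by (simp add: xpart_linear)
qed (rule ypart_cong, simp add: scale_x_def)

text \<open>Multiples of \<open>C\<close> contain only terms of degree at least three in
  \<open>x\<close>; the coefficients of \<open>t ^ k\<close> under the rescaling of \<open>x\<close>
  are compared.\<close>

lemma V_degree:
  assumes "PF (n + 2) f" "\<And>z. on_V' z \<Longrightarrow> f z = 0" "\<And>t z. f (scale_x t z) = t ^ k * f z" "k < 3"
  shows "f z = 0"
proof -
  obtain g where g: "\<And>z. f z = Q (X z) (X z) (X z) (Y z) * eval z g" using V_factor[OF assms(1,2)] by blast
  define P where "P = curve (\<lambda>i. if i < c then [:z i:] else [:0, z i:]) g"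
  have P: "poly P t = eval (scale_x t z) g" for t
    unfolding P_def poly_curve scale_x_def by (rule arg_cong[of _ _ "\<lambda>x. eval x g"]) auto
  have "poly (monom (f z) k) t = poly (monom (Q (X z) (X z) (X z) (Y z)) 3 * P) t" for t
    using assms(3)[of t z] g[of "scale_x t z"]
    by (simp add: poly_monom P X_scale_x Y_scale_x multilinear power3_eq_cube ac_simps)
  then have "monom (f z) k = monom (Q (X z) (X z) (X z) (Y z)) 3 * P" by (simp add: poly_eq_poly_eq_iff[symmetric] fun_eq_iff)
  then have "coeff (monom (f z) k) k = coeff (monom (Q (X z) (X z) (X z) (Y z)) 3 * P) k" by simp
  then show ?thesis using assms(4) by (simp add: coeff_monom_mult)
qed

definition pair where "pair x y = (\<lambda>i. if i < c then y i else x i)"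

lemma X_pair [simp]: "X (pair x y) = X x" and Y_pair [simp]: "Y (pair x y) = Y y"
  by (auto simp: pair_def intro!: xpart_cong ypart_cong)

lemma PFVX: "PFV (n + 2) X" and PFVY: "PFV (n + 2) Y"
  using c by (auto intro: PFV_xpart PFV_ypart)

lemmas PFs = PF_add PF_mult PF_diff PF_uminus PF_const PF PFV_add PFV_scale PFV_const PFVX PFVY

end

section \<open>Tangent directions along \<open>V\<close>\<close>

context linear_subspace
begin

text \<open>A third of the differential, with respect to \<open>x\<close> in the direction
  \<open>s\<close>, of the cubic \<open>Q x x x y\<close>.\<close>

definition m where "m z s = Q (X z) (X z) s (Y z)"
text \<open>The combination of \<open>u\<close> and \<open>r\<close> that \<open>m z\<close>
  annihilates. It is polynomial in \<open>z\<close>, so it provides a tangent vector at all points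
  of \<open>V\<close> simultaneously and can be differentiated.\<close>

definition tv where "tv u r z = m z r *v u + (- m z u) *v r"

lemma PF_m: "PF (n + 2) (\<lambda>z. m z s)"
  unfolding m_def by (intro PFs)

lemma PFV_tv: "PFV (n + 2) (tv u r)"
  unfolding tv_def[abs_def] by (intro PFs PF_m)

lemma m_linear: "m z (s + s') = m z s + m z s'" "m z (t *v s) = t * m z s"
  by (simp_all add: m_def multilinear)

lemma m_tv: "m z (tv u r z) = 0"
  by (simp add: tv_def m_linear)

lemma m_scale_x: "m (scale_x t z) s = t ^ 2 * m z s"
  by (simp add: m_def X_scale_x Y_scale_x multilinear power2_eq_square ac_simps)

lemma tv_scale_x: "tv u r (scale_x t z) = t ^ 2 *v tv u r z"
  by (rule ext) (simp add: tv_def m_scale_x algebra_simps)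

lemma jet_along:
  "jetV (\<lambda>e. X (z + e *v z')) (X z) (X z')" "jetV (\<lambda>e. Y (z + e *v z')) (Y z) (Y z')"
  by (rule jetV_xpart jetV_ypart)+

text \<open>The function is a multiple of the equation of \<open>V\<close>, which vanishes to first
  order in a tangent direction; by the product rule so does the function.\<close>

lemma tangent_derivative:
  assumes f: "PF (n + 2) f" "\<And>z. on_V' z \<Longrightarrow> f z = 0"
    and z: "on_V z" "3 * m z (X z') + Q (X z) (X z) (X z) (Y z') = 0"
    and J: "jet (\<lambda>e. f (z + e *v z')) a d"
  shows "d = 0"
proof -
  obtain g where g: "\<And>z. f z = Q (X z) (X z) (X z) (Y z) * eval z g" using V_factor[OF f] by blast
  have "jet (\<lambda>e. Q (X (z + e *v z')) (X (z + e *v z')) (X (z + e *v z')) (Y (z + e *v z'))) 0 0"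
    by (rule jet_eq[OF jets[OF jet_along(1) jet_along(1) jet_along(1) jet_along(2)]])
      (use z in \<open>simp_all add: on_V_def m_def symmetric\<close>)
  from jet_mult[OF this jet_line[of z z' g]] have "jet (\<lambda>e. f (z + e *v z')) 0 0" by (simp add: g)
  then show ?thesis using jet_unique[OF J] by blast
qed

lemma jet_m:
  "jet (\<lambda>e. m (z + e *v z') s) (m z s) (2 * Q (X z') (X z) s (Y z) + Q (X z) (X z) s (Y z'))"
  unfolding m_def
  by (rule jet_eq[OF jets[OF jet_along(1) jet_along(1) jetV_const jet_along(2)]])
    (simp_all add: zero3, simp add: symmetric)

lemma jet_tv:
  "jetV (\<lambda>e. tv u r (z + e *v z')) (tv u r z)
    ((2 * Q (X z') (X z) r (Y z) + Q (X z) (X z) r (Y z')) *v u + (- (2 * Q (X z') (X z) u (Y z) + Q (X z) (X z) u (Y z'))) *v r)"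
proof -
  have neg: "jet (\<lambda>e. - h e) (- a) (- b')" if "jet h a b'" for h :: "'k \<Rightarrow> 'k" and a b'
    using jet_diff[OF jet_const[of 0] that] by simp
  show ?thesis unfolding tv_def
    by (rule jetV_eq[OF jetV_add[OF jetV_scale[OF jet_m jetV_const] jetV_scale[OF neg[OF jet_m] jetV_const]]]) simp_all
qed

text \<open>\<open>m z s\<close> has degree two in \<open>x\<close>: vanishing on \<open>V\<close>
  it would vanish identically, and taking \<open>s\<close> equal to \<open>x\<close> would make the
  equation of \<open>V\<close> zero.\<close>

lemma ex_m_nonzero: "\<exists>z s. on_V z \<and> m z (X s) = 1"
proof (rule ccontr)
  assume contra: "\<not> ?thesis"
  have 0: "m z (X s) = 0" if "on_V z" for z s
  proof (rule ccontr)
    assume "m z (X s) \<noteq> 0"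
    then have "m z (X ((1 / m z (X s)) *v s)) = 1" by (simp add: xpart_linear m_linear)
    then show False using contra that by blast
  qed
  have "m z (X s) = 0" for z s
    by (rule V_degree[OF PF_m, of _ 2]) (use 0 m_scale_x on_V'_def in auto)
  then have "eval z C = 0" for z by (simp add: eval_C m_def)
  then have "C = 0" by (rule eval_eq_0_imp_eq_0)
  then show False using irreducible_C by (simp add: irreducible_def)
qed

end

text \<open>The assumption says that \<open>unirational_nondegenerate\<close> applies to no vectors \<open>X p, X k, X r, q, w\<close>.\<close>

locale degenerate_linear_subspace = linear_subspace +
  assumes degenerate: "Q (X p) (X p) (X p) w \<noteq> 0 \<Longrightarrow> Q (X p) (X p) (X p) q = 0 \<Longrightarrow> Q (X p) (X p) (X k) q = 0 \<Longrightarrow>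
    Q (X p) (X p) (X r) q \<noteq> 0 \<Longrightarrow> Q (X p) (X p) q q = 0 \<Longrightarrow> Q (X p) (X k) (X k) q = 0 \<and> Q (X p) (X k) q q = 0"
begin

text \<open>The condition \<open>Q p p q q = 0\<close> is attained by adding a multiple of
  \<open>X r\<close> to \<open>q\<close>; the other conditions survive because \<open>Q\<close>
  vanishes on the linear space.\<close>

lemma degenerate':
  assumes "Q (X p) (X p) (X p) w \<noteq> 0" "Q (X p) (X p) (X p) q = 0" "Q (X p) (X p) (X k) q = 0" "Q (X p) (X p) (X r) q \<noteq> 0"
  shows "Q (X p) (X k) (X k) q = 0" and "Q (X p) (X k) (X r) q = 0 \<Longrightarrow> Q (X p) (X k) q q = 0"
proof -
  define t where "t = - Q (X p) (X p) q q / (2 * Q (X p) (X p) (X r) q)"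
  define q' where "q' = q + t *v X r"
  have t: "2 * t * Q (X p) (X p) (X r) q = - Q (X p) (X p) q q" using assms(4) by (simp add: t_def)
  have s: "Q (X p) (X p) q (X r) = Q (X p) (X p) (X r) q" "Q (X p) (X k) q (X r) = Q (X p) (X k) (X r) q" by (rule sym3)+
  have "Q (X p) (X p) q' q' = Q (X p) (X p) q q + 2 * t * Q (X p) (X p) (X r) q"
    unfolding q'_def by (simp add: multilinear isotropic s)
  then have 1: "Q (X p) (X p) q' q' = 0" by (simp add: t)
  have "Q (X p) (X k) (X k) q' = 0 \<and> Q (X p) (X k) q' q' = 0"
    using assms by (intro degenerate[OF assms(1) _ _ _ 1, of _ r]) (simp_all add: q'_def multilinear isotropic)
  then show "Q (X p) (X k) (X k) q = 0" "Q (X p) (X k) (X r) q = 0 \<Longrightarrow> Q (X p) (X k) q q = 0"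
    by (simp_all add: q'_def multilinear isotropic s)
qed

text \<open>Fix \<open>y\<close>: the kernel of \<open>m z\<close> is the tangent hyperplane at
  \<open>x\<close> of the cubic \<open>Q x x x y\<close>, and \<open>Q x v v y\<close> is its second
  fundamental form. Degeneracy with \<open>p = x\<close>, \<open>k = v\<close>, \<open>q = y\<close>
  says that it vanishes. If \<open>m z\<close> is zero on the linear space, so is
  \<open>tv\<close>.\<close>

lemma second_fundamental_form: "on_V' z \<Longrightarrow> Q (X z) (tv (X u) (X r) z) (tv (X u) (X r) z) (Y z) = 0"
proof -
  assume z: "on_V' z"
  define v where "v = m z (X r) *v u + (- m z (X u)) *v r"
  have v: "tv (X u) (X r) z = X v" by (simp add: tv_def v_def xpart_linear)
  have mv: "m z (X v) = 0" using m_tv[of z "X u" "X r"] by (simp add: v)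
  show ?thesis
  proof (cases "\<exists>s. m z (X s) \<noteq> 0")
    case True
    then show ?thesis using degenerate'(1)[of z _ "Y z" v] z mv unfolding v on_V'_def on_V_def m_def by blast
  next
    case False
    then have "v = 0" by (auto simp: v_def)
    then show ?thesis unfolding v by (simp add: xpart_zero multilinear)
  qed
qed

text \<open>\<open>second_fundamental_form\<close> is differentiated along \<open>(v, 0)\<close>,
  where \<open>v\<close> is the value of \<open>tv\<close>; this is a tangent direction of
  \<open>V\<close>. The contributions of the derivative of \<open>tv\<close> cancel by symmetry of
  \<open>Q\<close>.\<close>

lemma tangent_hyperplane: "on_V z \<Longrightarrow> Q (tv (X u) (X r) z) (tv (X u) (X r) z) (tv (X u) (X r) z) (Y z) = 0"
proof -
  assume z: "on_V z"
  let ?f = "\<lambda>z. Q (X z) (tv (X u) (X r) z) (tv (X u) (X r) z) (Y z)"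
  define v where "v = m z (X r) *v u + (- m z (X u)) *v r"
  have v: "tv (X u) (X r) z = X v" by (simp add: tv_def v_def xpart_linear)
  define z' where "z' = pair v 0"
  have z': "X z' = X v" "Y z' = 0" by (auto simp: z'_def ypart_zero)
  have tan: "3 * m z (X z') + Q (X z) (X z) (X z) (Y z') = 0"
    using m_tv[of z "X u" "X r"] by (simp add: z' v multilinear)
  have "PF (n + 2) ?f" by (intro PFs PFV_tv)
  note tangent_derivative[OF this second_fundamental_form z tan jets[OF jet_along(1) jet_tv jet_tv jet_along(2)]]
  then have "Q (X v) (X v) (X v) (Y z) + 2 * (2 * Q (X v) (X z) (X r) (Y z) * Q (X z) (X u) (X v) (Y z)
      - 2 * Q (X v) (X z) (X u) (Y z) * Q (X z) (X r) (X v) (Y z)) = 0"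
    by (simp add: z' v multilinear symmetric algebra_simps)
  moreover have "Q (X z) (X u) (X v) (Y z) = Q (X v) (X z) (X u) (Y z)" "Q (X z) (X r) (X v) (Y z) = Q (X v) (X z) (X r) (Y z)"
    by (metis symmetric)+
  ultimately show ?thesis by (simp add: v)
qed

text \<open>Obtained by differentiating \<open>tangent_hyperplane\<close> along \<open>V\<close>, in a direction that changes \<open>Y z\<close> to first
  order by \<open>Y y\<close> and \<open>X z\<close> only by a multiple of \<open>X r\<close>.\<close>

lemma restriction_to_hyperplane:
  assumes z: "on_V z" "m z (X r) = 1" and v: "m z (X v) = 0"
  shows "Q (X v) (X v) (X v) (Y y) = 3 * Q (X v) (X v) (X r) (Y z) *
    (Q (X z) (X z) (X v) (Y y) - 2 / 3 * Q (X z) (X z) (X z) (Y y) * Q (X z) (X r) (X v) (Y z))"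
proof -
  let ?f = "\<lambda>z. Q (tv (X v) (X r) z) (tv (X v) (X r) z) (tv (X v) (X r) z) (Y z)"
  \<comment> \<open>The value for which \<open>(t r, y)\<close> is tangent to \<open>V\<close>, in
    view of \<open>m z (X r) = 1\<close>; it is the origin of the factor
    \<open>2 / 3\<close>.\<close>
  define t where "t = - Q (X z) (X z) (X z) (Y y) / 3"
  define z' where "z' = pair (t *v r) y"
  have z': "X z' = t *v X r" "Y z' = Y y" by (simp_all add: z'_def xpart_linear)
  have tan: "3 * m z (X z') + Q (X z) (X z) (X z) (Y z') = 0"
    using z(2) by (simp add: z' m_linear t_def)
  have "PF (n + 2) ?f" by (intro PFs PFV_tv)
  note D = tangent_derivative[OF this tangent_hyperplane z(1) tan jets[OF jet_tv jet_tv jet_tv jet_along(2)]]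
  have tv: "tv (X v) (X r) z = X v" using z(2) v by (simp add: tv_def)
  have 0: "Q (X v) (X v) (X v) (Y z) = 0" using tangent_hyperplane[OF z(1), of v r] by (simp add: tv)
  have t: "Q (X z) (X z) (X z) (Y y) = - 3 * t" by (simp add: t_def)
  have "Q (X v) (X v) (X v) (Y y) = 3 * Q (X v) (X v) (X r) (Y z) *
    (Q (X z) (X z) (X v) (Y y) + 2 * t * Q (X z) (X r) (X v) (Y z))"
    using D 0 by (simp add: on_V'_def z' tv multilinear symmetric algebra_simps)
  then show ?thesis by (simp add: t)
qed

text \<open>Otherwise the linear form \<open>m z\<close> would divide every cubic: write
  \<open>x\<close> as \<open>x'\<close> in the hyperplane plus \<open>\<mu>\<close> times
  \<open>r\<close>; every term of \<open>Q x x x (b j)\<close> other than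
  \<open>Q x' x' x' (b j)\<close> contains \<open>\<mu>\<close>.\<close>

lemma ex_nonzero_on_hyperplane:
  assumes r: "m z (X r) = 1"
  shows "\<exists>v y. m z (X v) = 0 \<and> Q (X v) (X v) (X v) (Y y) \<noteq> 0"
proof (rule ccontr)
  assume contra: "\<not> ?thesis"
  have "PF (n + 2) (\<lambda>x. m z (X x))" unfolding m_def by (intro PFs)
  then obtain D0 where D0: "in_vars (n + 2) D0" "\<And>x. eval x D0 = m z (X x)" by (auto simp: PF_def)
  define D where "D = y0 D0"
  have D: "eval x D = m z (X x)" for x
  proof -
    have "X (\<lambda>i. eval x (if i < c then 0 else Var i)) = X x" by (rule xpart_cong) auto
    then show ?thesis unfolding D_def y0_def eval_subst D0 by simp
  qed
  have "D dvd 1"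
  proof (rule no_common_factor)
    show "in_vars (n + 2) D" unfolding D_def y0_def by (rule in_vars_subst[OF _ D0(1)]) simp
    show "free_of j D" if "j < c" for j unfolding D_def by (rule free_of_y0[OF that D0(1)])
    show "D dvd A j" if j: "j < c" for j
    proof -
      define x' where "x' x = X x + (- m z (X x)) *v X r" for x
      have "PF (n + 2) (\<lambda>x. 3 * Q (x' x) (x' x) (X r) (b j) + 3 * m z (X x) * Q (x' x) (X r) (X r) (b j) + m z (X x) * m z (X x) * Q (X r) (X r) (X r) (b j))"
        unfolding x'_def m_def by (intro PFs)
      then obtain E where E: "\<And>x. eval x E = 3 * Q (x' x) (x' x) (X r) (b j) + 3 * m z (X x) * Q (x' x) (X r) (X r) (b j) + m z (X x) * m z (X x) * Q (X r) (X r) (X r) (b j)"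
        by (auto simp: PF_def)
      have "A j = D * E"
      proof (rule mpoly_eqI)
        fix x
        define \<mu> where "\<mu> = m z (X x)"
        have x'X: "x' x = X (x + (- \<mu>) *v r)" by (simp add: x'_def \<mu>_def xpart_linear)
        have "m z (x' x) = 0" using r by (simp add: x'_def m_linear)
        then have 0: "Q (x' x) (x' x) (x' x) (b j) = 0"
          using contra ypart_uvec[OF j, of b] unfolding x'X by metis
        have Xx: "X x = x' x + \<mu> *v X r" by (auto simp: x'_def \<mu>_def)
        have "eval x (A j) = Q (x' x + \<mu> *v X r) (x' x + \<mu> *v X r) (x' x + \<mu> *v X r) (b j)" unfolding eval_A by (simp only: Xx[symmetric])
        also have "\<dots> = \<mu> * (3 * Q (x' x) (x' x) (X r) (b j) + 3 * \<mu> * Q (x' x) (X r) (X r) (b j) + \<mu> * \<mu> * Q (X r) (X r) (X r) (b j))"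
          by (simp add: multilinear symmetric 0[simplified symmetric] algebra_simps)
        also have "\<dots> = eval x (D * E)" by (simp add: D E \<mu>_def)
        finally show "eval x (A j) = eval x (D * E)" .
      qed
      then show ?thesis by simp
    qed
  qed
  then have "eval 0 D dvd eval 0 (1 :: 'a mpoly)" by (rule ring_map_dvd[OF ring_map_eval])
  then show False by (simp add: D m_def xpart_zero multilinear)
qed

text \<open>For each \<open>x\<close> on \<open>V\<close> the vector \<open>tv\<close> formed from
  \<open>u\<close> and \<open>w\<close> lies in the hyperplane at \<open>z\<close>, where the cubics
  factor as \<open>q\<close> times \<open>L\<close>, and also in the tangent hyperplane at
  \<open>x\<close>, where the cubic belonging to \<open>x\<close> vanishes. So \<open>q * L\<close>
  is zero along \<open>V\<close>, and irreducibility leaves two cases.\<close>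

lemma proportional_derivatives:
  assumes z: "on_V z" "m z (X r) = 1" and uw: "m z (X u) = 0" "m z (X w) = 0"
    and nz: "Q (X u) (X u) (X u) (Y y1) \<noteq> 0"
  shows "\<exists>k. \<forall>x. m x (X w) = k * m x (X u)"
proof -
  define q where "q v = 3 * Q v v (X r) (Y z)" for v
  define L where "L y v = Q (X z) (X z) v (Y y) - 2 / 3 * Q (X z) (X z) (X z) (Y y) * Q (X z) (X r) v (Y z)" for y v
  define B where "B = 3 * Q (X u) (X w) (X r) (Y z)"
  have restr: "Q (X v) (X v) (X v) (Y y) = q (X v) * L y (X v)" if "m z (X v) = 0" for v y
    unfolding q_def L_def by (rule restriction_to_hyperplane[OF z that])
  have nz': "q (X u) \<noteq> 0" "L y1 (X u) \<noteq> 0" using nz restr[OF uw(1), of y1] by auto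
  let ?tv = "tv (X u) (X w)"
  have PF_q: "PF (n + 2) (\<lambda>x. q (?tv x))" unfolding q_def by (intro PFs PFV_tv)
  have PF_L: "PF (n + 2) (\<lambda>x. L x (?tv x))" unfolding L_def by (intro PFs PFV_tv)
  have qL: "q (?tv x) * L x (?tv x) = 0" if "on_V' x" for x
  proof -
    have "?tv x = X (m x (X w) *v u + (- m x (X u)) *v w)" by (simp add: tv_def xpart_linear)
    moreover have "m z (?tv x) = 0" using uw by (simp add: tv_def m_linear)
    ultimately have "Q (?tv x) (?tv x) (?tv x) (Y x) = q (?tv x) * L x (?tv x)" using restr by metis
    then show ?thesis using tangent_hyperplane[of x u w] that by (simp add: on_V'_def)
  qed
  have V'V: "on_V' x \<Longrightarrow> on_V x" for x by (simp add: on_V'_def)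
  consider (a) "\<forall>x. on_V x \<longrightarrow> L x (?tv x) = 0" | (b) "\<forall>x. on_V x \<longrightarrow> q (?tv x) = 0"
    using V_irreducible[OF PF_q PF_L qL] by blast
  then show ?thesis
  proof cases
    case a
    have "L x (?tv x) = 0" for x
    proof (rule V_degree[OF PF_L, of 2])
      show "L (scale_x t x) (?tv (scale_x t x)) = t ^ 2 * L x (?tv x)" for t x
        by (simp add: L_def tv_scale_x Y_scale_x multilinear algebra_simps)
    qed (use a V'V in auto)
    then have a': "L x (X u) * m x (X w) = L x (X w) * m x (X u)" for x
      by (simp add: L_def tv_def multilinear algebra_simps)
    \<comment> \<open>The factorization of the cubic, differentiated at \<open>u\<close> in the
      direction \<open>w\<close>.\<close>
    have polar: "3 * Q (X u) (X u) (X w) (Y y) = q (X u) * L y (X w) + 2 * B * L y (X u)" for y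
    proof -
      have jX: "jetV (\<lambda>t. X (u + t *v w)) (X u) (X w)" by (rule jetV_xpart)
      have "jet (\<lambda>t. L y (X (u + t *v w))) (L y (X u)) (L y (X w))"
        unfolding L_def
        by (rule jet_eq[OF jet_diff[OF jets[OF jetV_const jetV_const jX jetV_const] jet_mult[OF jet_const jets[OF jetV_const jetV_const jX jetV_const]]]])
          (simp_all add: multilinear)
      moreover have "jet (\<lambda>t. q (X (u + t *v w))) (q (X u)) (2 * B)"
        unfolding q_def B_def
        by (rule jet_eq[OF jet_mult[OF jet_const jets[OF jX jX jetV_const jetV_const]]])
          (simp_all add: multilinear symmetric)
      ultimately have J1: "jet (\<lambda>t. q (X (u + t *v w)) * L y (X (u + t *v w))) (q (X u) * L y (X u)) (q (X u) * L y (X w) + 2 * B * L y (X u))"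
        using jet_mult by blast
      have "m z (X (u + t *v w)) = 0" for t using uw by (simp add: xpart_linear m_linear)
      then have "q (X (u + t *v w)) * L y (X (u + t *v w)) = Q (X (u + t *v w)) (X (u + t *v w)) (X (u + t *v w)) (Y y)" for t
        using restr by simp
      with J1 have J1': "jet (\<lambda>t. Q (X (u + t *v w)) (X (u + t *v w)) (X (u + t *v w)) (Y y)) (q (X u) * L y (X u)) (q (X u) * L y (X w) + 2 * B * L y (X u))"
        by simp
      have J2: "jet (\<lambda>t. Q (X (u + t *v w)) (X (u + t *v w)) (X (u + t *v w)) (Y y)) (Q (X u) (X u) (X u) (Y y)) (3 * Q (X u) (X u) (X w) (Y y))"
        by (rule jet_eq[OF jets[OF jX jX jX jetV_const]]) (simp_all add: multilinear symmetric)
      show ?thesis using jet_unique[OF J1' J2] by simp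
    qed
    have L_add: "L y v + L y' v = L (y + y') v" for y y' v
      by (simp add: L_def ypart_linear multilinear algebra_simps)
    \<comment> \<open>At the pair \<open>(u, y)\<close> the value of \<open>m\<close> in the
      direction \<open>w\<close> is \<open>Q u u w y\<close>, so \<open>a'\<close> computes it a
      second time; comparison with \<open>polar\<close> gives \<open>k y = 0\<close> wherever
      \<open>L y\<close> is nonzero at \<open>u\<close>.\<close>
    define k where "k y = q (X u) * L y (X w) - B * L y (X u)" for y
    have k: "k y = 0" for y
    proof -
      have *: "k y = 0" if "L y (X u) \<noteq> 0" for y
      proof -
        have Lp: "L (pair u y) v = L y v" and mp: "m (pair u y) v = Q (X u) (X u) v (Y y)" for v
          by (simp_all add: L_def m_def)
        have "L y (X u) * Q (X u) (X u) (X w) (Y y) = L y (X w) * (q (X u) * L y (X u))"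
          using a'[of "pair u y"] unfolding Lp mp restr[OF uw(1)] .
        then have "L y (X u) * (3 * Q (X u) (X u) (X w) (Y y)) = 3 * L y (X w) * (q (X u) * L y (X u))"
          by simp
        then have "L y (X u) * (2 * k y) = 0"
          unfolding polar k_def by algebra
        then show ?thesis using that by simp
      qed
      show ?thesis
      proof (cases "L y (X u) = 0")
        case True
        then have "L (y + y1) (X u) \<noteq> 0" using nz' by (simp flip: L_add)
        then have "k (y + y1) = 0" by (rule *)
        moreover have "k (y + y1) = k y + k y1" by (simp add: k_def algebra_simps flip: L_add)
        ultimately show ?thesis using *[OF nz'(2)] by simp
      qed (rule *)
    qed
    define h where "h x = m x (X w) - B / q (X u) * m x (X u)" for x
    have *: "h x = 0" if "L x (X u) \<noteq> 0" for x
    proof -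
      have "L x (X w) = B / q (X u) * L x (X u)" using k[of x] nz' by (simp add: k_def field_simps)
      then have "L x (X u) * h x = 0" using a'[of x] by (simp add: h_def algebra_simps)
      then show ?thesis using that by simp
    qed
    have "h x = 0" for x
    proof (cases "L x (X u) = 0")
      case True
      \<comment> \<open>\<open>L\<close> depends on the \<open>y\<close>-part only, and
        \<open>h\<close> is linear in it: an exceptional \<open>y\<close> is a difference of two
        values that are not exceptional.\<close>
      have "L (pair x (x + y1)) (X u) = L x (X u) + L y1 (X u)" "L (pair x y1) (X u) = L y1 (X u)"
        unfolding L_add by (simp_all add: L_def)
      then have "h (pair x (x + y1)) = 0" "h (pair x y1) = 0" using True nz' by (auto intro!: *)
      moreover have "h (pair x (x + y1)) = h x + h (pair x y1)"
        by (simp add: h_def m_def ypart_linear multilinear algebra_simps)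
      ultimately show ?thesis by simp
    qed (rule *)
    then have "m x (X w) = B / q (X u) * m x (X u)" for x by (simp add: h_def)
    then show ?thesis by blast
  next
    case b
    \<comment> \<open>A quarter of the discriminant of the quadratic form \<open>q\<close> on the
      span of \<open>u\<close> and \<open>w\<close>; \<open>W\<close> below completes the
      square.\<close>
    define \<delta> where "\<delta> = B * B - q (X u) * q (X w)"
    define W where "W x = m x (X w) * q (X u) - m x (X u) * B" for x
    have W2: "W x * W x = m x (X u) * m x (X u) * \<delta>" if "on_V x" for x
    proof -
      have "q (?tv x) = m x (X w) * m x (X w) * q (X u) - 2 * m x (X w) * m x (X u) * B + m x (X u) * m x (X u) * q (X w)"
        by (simp add: q_def B_def tv_def multilinear symmetric algebra_simps)
      then have "q (X u) * (m x (X w) * m x (X w) * q (X u) - 2 * m x (X w) * m x (X u) * B + m x (X u) * m x (X u) * q (X w)) = 0"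
        using b that by simp
      then show ?thesis by (simp add: W_def \<delta>_def algebra_simps)
    qed
    have W_scale: "W (scale_x t x) = t ^ 2 * W x" for t x by (simp add: W_def m_scale_x algebra_simps)
    have PF_W: "PF (n + 2) W" unfolding W_def[abs_def] by (intro PFs PF_m)
    show ?thesis
    proof (cases "\<exists>s. s * s = \<delta>")
      case True
      then obtain s where s: "s * s = \<delta>" by blast
      let ?f = "\<lambda>s x. W x - s * m x (X u)"
      have PFf: "PF (n + 2) (?f s)" for s by (intro PFs PF_m PF_W)
      have prod: "?f s x * ?f (- s) x = 0" if "on_V' x" for x
      proof -
        have "W x * W x = m x (X u) * m x (X u) * (s * s)" using W2[OF V'V[OF that]] s by simp
        then show ?thesis by algebra
      qed
      obtain s' where s': "\<forall>x. on_V x \<longrightarrow> ?f s' x = 0"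
        using V_irreducible[OF PFf[of s] PFf[of "- s"] prod] by blast
      have "?f s' x = 0" for x
        by (rule V_degree[OF PFf, of _ 2]) (use s' V'V in \<open>auto simp: W_scale m_scale_x algebra_simps\<close>)
      then have "m x (X w) = (B + s') / q (X u) * m x (X u)" for x using nz' by (simp add: W_def field_simps)
      then show ?thesis by blast
    next
      case False
      \<comment> \<open>Without a square root of \<open>\<delta>\<close> the relation forces both
        derivatives to vanish at every point of \<open>V\<close> over the field, and by density
        identically for \<open>w\<close>.\<close>
      have u0: "m x (X u) = 0" if "on_V x" for x
      proof (rule ccontr)
        assume "m x (X u) \<noteq> 0"
        then have "(W x / m x (X u)) * (W x / m x (X u)) = \<delta>" using W2[OF that] by (simp add: field_simps)
        then show False using False by blast
      qed
      have w0: "m x (X w) = 0" if "on_V x" for x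
        using W2[OF that] u0[OF that] nz' by (simp add: W_def)
      have "m x (X w) = 0" for x
        by (rule V_degree[OF PF_m, of _ 2]) (use w0 V'V m_scale_x in auto)
      then have "m x (X w) = 0 * m x (X u)" for x by simp
      then show ?thesis by blast
    qed
  qed
qed

text \<open>Three basis vectors of the linear space are projected along \<open>r\<close> into the
  hyperplane. As \<open>u\<close> and \<open>r\<close> span at most a plane, one projection is not a
  multiple of \<open>u\<close>, and subtracting from it the multiple of \<open>u\<close> with the
  same derivatives leaves a common vertex of the cubics.\<close>

lemma ex_vertex: "\<exists>v. (\<exists>i<n + 2. X v i \<noteq> 0) \<and> (\<forall>x. m x (X v) = 0)"
proof -
  obtain z r where z: "on_V z" "m z (X r) = 1" using ex_m_nonzero by blast
  obtain u y1 where u: "m z (X u) = 0" "Q (X u) (X u) (X u) (Y y1) \<noteq> 0" using ex_nonzero_on_hyperplane[OF z(2)] by blast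
  define w where "w i = uvec i + (- m z (X (uvec i))) *v r" for i
  have mw: "m z (X (w i)) = 0" for i using z by (simp add: w_def xpart_linear m_linear)
  have Xb: "X (uvec i) = b i" if "c \<le> i" "i < n + 2" for i
    using that by (intro ext) (simp add: xpart_def sum_fun_apply uvec_def if_distrib[of "\<lambda>x. x * _"] cong: if_cong)
  have "\<exists>i\<in>{c, c+1, c+2}. \<forall>k. \<exists>l<n+2. X (w i) l \<noteq> k * X u l"
  proof (rule ccontr)
    assume "\<not> ?thesis"
    then have "\<forall>i\<in>{c, c+1, c+2}. \<exists>k. \<forall>l<n+2. X (w i) l = k * X u l" by blast
    then obtain k where k: "\<And>i l. i \<in> {c, c+1, c+2} \<Longrightarrow> l < n+2 \<Longrightarrow> X (w i) l = k i * X u l" by metis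
    \<comment> \<open>The coordinates of \<open>b i\<close> with respect to \<open>u\<close> and
      \<open>r\<close>; three such vectors in dimension two are dependent.\<close>
    define f where "f i j = (if j = (0::nat) then k i else m z (b i))" for i j
    obtain x where x: "\<exists>i\<in>{c,c+1,c+2}. x i \<noteq> 0" "\<forall>j\<in>{0,1}. (\<Sum>i\<in>{c,c+1,c+2}. x i * f i j) = 0"
      using homogeneous_system[of "{0, 1::nat}" "{c,c+1,c+2}" f] by auto
    define x' where "x' i = (if i \<in> {c,c+1,c+2} then x i else 0)" for i
    have bl: "b i l = k i * X u l + m z (b i) * X r l" if "i \<in> {c,c+1,c+2}" "l < n + 2" for i l
      using k[OF that] that c Xb[of i] by (auto simp: w_def xpart_linear diff_eq_eq)
    have "(\<Sum>i<n+2. x' i * b i l) = 0" if l: "l < n + 2" for l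
    proof -
      have "(\<Sum>i<n+2. x' i * b i l) = (\<Sum>i\<in>{c,c+1,c+2}. x i * b i l)"
        by (rule sum.mono_neutral_cong_right) (use c in \<open>auto simp: x'_def\<close>)
      also have "\<dots> = (\<Sum>i\<in>{c,c+1,c+2}. (x i * f i 0) * X u l + (x i * f i 1) * X r l)"
        by (rule sum.cong) (use bl l in \<open>auto simp: f_def algebra_simps\<close>)
      also have "\<dots> = (\<Sum>i\<in>{c,c+1,c+2}. x i * f i 0) * X u l + (\<Sum>i\<in>{c,c+1,c+2}. x i * f i 1) * X r l"
        by (simp only: sum.distrib sum_distrib_right)
      also have "\<dots> = 0" using x(2) by simp
      finally show ?thesis .
    qed
    then have "x' i = 0" if "i < n + 2" for i using indep_familyD[OF indep] that by blast
    moreover obtain i where i: "i \<in> {c,c+1,c+2}" "x i \<noteq> 0" using x(1) by blast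
    moreover have "i < n + 2" using i c by auto
    ultimately have "x' i = 0" by blast
    then show False using i by (simp add: x'_def)
  qed
  then obtain i where i: "\<And>k. \<exists>l<n+2. X (w i) l \<noteq> k * X u l" by blast
  obtain k where k: "\<And>x. m x (X (w i)) = k * m x (X u)" using proportional_derivatives[OF z u(1) mw u(2)] by blast
  have "m x (X (w i + (- k) *v u)) = 0" for x using k[of x] by (simp add: xpart_linear m_linear)
  moreover have "\<exists>l<n+2. X (w i + (- k) *v u) l \<noteq> 0" using i[of k] by (simp add: xpart_linear)
  ultimately show ?thesis by blast
qed

text \<open>For a vertex \<open>v\<close>, \<open>Q x x' v s\<close> vanishes for \<open>x\<close>,
  \<open>x'\<close> in the linear space and all \<open>s\<close>. So the side condition of
  \<open>degenerate'(2)\<close> holds with \<open>k = v\<close> and yields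
  \<open>Q x v y y = 0\<close>, first along \<open>V\<close>, then identically, the degree in
  \<open>x\<close> being one. Decomposing \<open>s\<close> and \<open>t\<close> leaves no term of
  \<open>Q v v s t\<close>.\<close>

lemma ex_triple_point: "\<exists>v. (\<exists>i<n + 2. v i \<noteq> 0) \<and> (\<forall>i\<ge>n + 2. v i = 0) \<and> (\<forall>s t. Q v v s t = 0)"
proof -
  obtain v where "(\<exists>i<n + 2. X v i \<noteq> 0) \<and> (\<forall>x. m x (X v) = 0)" using ex_vertex by (elim exE)
  then have v: "\<exists>i<n + 2. X v i \<noteq> 0" "\<And>x. m x (X v) = 0" by simp_all
  have m0: "Q (X x) (X x) (X v) (Y y) = 0" for x y using v(2)[of "pair x y"] by (simp add: m_def)
  have XX: "Q (X x) (X x') (X v) (Y y) = 0" for x x' y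
    using m0[of "x + x'" y] m0[of x y] m0[of x' y] by (simp add: xpart_linear multilinear symmetric)
  have decomp: "\<exists>x. \<forall>i<n+2. s i = (X x + Y x) i" for s
  proof -
    obtain x where x: "\<forall>i<n+2. s i = (\<Sum>j<n+2. x j * b j i)" using indep_family_spans[OF indep] by blast
    have "{..<n+2} = {c..<n+2} \<union> {..<c}" "{c..<n+2} \<inter> {..<c} = {}" using c by auto
    then have "(\<Sum>j<n+2. x j * b j i) = (X x + Y x) i" for i
      by (simp add: xpart_def ypart_def sum_fun_apply sum.union_disjoint)
    then show ?thesis using x by (intro exI[of _ x]) simp
  qed
  have XXs: "Q (X x) (X x') (X v) s = 0" for x x' s
  proof -
    obtain a where "\<forall>i<n+2. s i = (X a + Y a) i" using decomp by blast
    then have "Q (X x) (X x') (X v) s = Q (X x) (X x') (X v) (X a + Y a)" by (intro cong4) blast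
    then show ?thesis by (simp add: multilinear isotropic XX)
  qed
  obtain z0 where z0: "Q (X z0) (X z0) (X z0) (Y z0) \<noteq> 0"
  proof -
    have "C \<noteq> 0" using irreducible_C by (simp add: irreducible_def)
    then show ?thesis using that eval_eq_0_imp_eq_0[of C] unfolding eval_C by blast
  qed
  let ?f = "\<lambda>z. Q (X z) (X v) (Y z) (Y z)"
  have PFf: "PF (n + 2) ?f" by (intro PFs)
  have V'V: "on_V' x \<Longrightarrow> on_V x" for x by (simp add: on_V'_def)
  have "?f z * m z (X z0) = 0" if z: "on_V' z" for z
  proof (cases "m z (X z0) = 0")
    case False
    obtain w where "Q (X z) (X z) (X z) w \<noteq> 0" using z by (auto simp: on_V'_def)
    then have "?f z = 0"
      by (rule degenerate'(2)[where r = z0 and q = "Y z"])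
        (use z False XX[of z z0 z] m0[of z z] in \<open>auto simp: on_V'_def on_V_def m_def symmetric\<close>)
    then show ?thesis by simp
  qed simp
  then consider "\<forall>z. on_V z \<longrightarrow> ?f z = 0" | "\<forall>z. on_V z \<longrightarrow> m z (X z0) = 0"
    using V_irreducible[OF PFf PF_m] by blast
  then have f0: "?f z = 0" for z
  proof cases
    case 1
    show ?thesis
      by (rule V_degree[OF PFf, of 1]) (use 1 V'V in \<open>auto simp: X_scale_x Y_scale_x multilinear\<close>)
  next
    case 2
    have "m z (X z0) = 0" for z
      by (rule V_degree[OF PF_m, of _ 2]) (use 2 V'V m_scale_x in auto)
    then show ?thesis using z0 by (simp add: m_def)
  qed
  have XYY: "Q (X x) (X v) (Y y) (Y y') = 0" for x y y'
    using f0[of "pair x (y + y')"] f0[of "pair x y"] f0[of "pair x y'"] by (simp add: ypart_linear multilinear symmetric)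
  have triple: "Q (X v) (X v) s t = 0" for s t
  proof -
    obtain a where a: "\<forall>i<n+2. s i = (X a + Y a) i" using decomp by blast
    obtain a' where a': "\<forall>i<n+2. t i = (X a' + Y a') i" using decomp by blast
    have "Q (X v) (X v) s t = Q (X v) (X v) s (X a' + Y a')" by (rule cong4) (use a' in blast)
    also have "\<dots> = Q (X v) (X v) (X a' + Y a') s" by (rule sym3)
    also have "\<dots> = Q (X v) (X v) (X a' + Y a') (X a + Y a)" by (rule cong4) (use a in blast)
    also have "\<dots> = Q (X v) (X a') (X v) (X a + Y a) + Q (X v) (X v) (Y a') (X a) + Q (X v) (X v) (Y a') (Y a)"
      by (simp add: multilinear symmetric)
    also have "Q (X v) (X v) (Y a') (X a) = Q (X v) (X a) (X v) (Y a')" by (metis symmetric)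
    finally show ?thesis by (simp add: XXs XYY)
  qed
  \<comment> \<open>\<open>is_cone\<close> asks for a vector that is zero from \<open>n + 2\<close>
    on, so the irrelevant entries are cut off.\<close>
  define v' where "v' i = (if i < n + 2 then X v i else 0)" for i
  have "Q v' v' s t = 0" for s t
  proof -
    have *: "Q v' a s t = Q (X v) a s t" for a by (rule cong) (simp add: v'_def)
    have "Q v' v' s t = Q v' (X v) s t" unfolding * by (subst (1 2) sym1) (rule *)
    then show ?thesis using triple * by simp
  qed
  moreover have "\<exists>i<n + 2. v' i \<noteq> 0" using v(1) by (auto simp: v'_def)
  ultimately show ?thesis by (intro exI[of _ v']) (simp add: v'_def)
qed

end

subsection \<open>Chains of prime ideals\<close>

definition vars_in :: "nat \<Rightarrow> nat \<Rightarrow> 'k::comm_ring_1 mpoly \<Rightarrow> bool" where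
  "vars_in l u p \<longleftrightarrow> in_vars u p \<and> (\<forall>i<l. free_of i p)"

lemma vars_in_simps [simp]: "vars_in l u 0" "vars_in l u 1" "vars_in l u (Const c)"
  "vars_in l u p \<Longrightarrow> vars_in l u q \<Longrightarrow> vars_in l u (p + q)"
  "vars_in l u p \<Longrightarrow> vars_in l u q \<Longrightarrow> vars_in l u (p * q)"
  "vars_in l u p \<Longrightarrow> vars_in l u q \<Longrightarrow> vars_in l u (p - q)"
  "vars_in l u p \<Longrightarrow> vars_in l u (- p)"
  by (simp_all add: vars_in_def)

lemma vars_in_Var: "vars_in l u (Var i) \<longleftrightarrow> l \<le> i \<and> i < u"
  by (auto simp: vars_in_def free_of_Var not_less)

lemma vars_in_mono: "vars_in l u p \<Longrightarrow> u \<le> u' \<Longrightarrow> vars_in l u' p"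
  by (auto simp: vars_in_def elim: in_vars_mono)

lemma vars_in_subst: "in_vars N p \<Longrightarrow> (\<And>i. i < N \<Longrightarrow> vars_in l u (g i)) \<Longrightarrow> vars_in l u (subst g p)"
  unfolding vars_in_def by (auto intro!: in_vars_subst[of N] free_of_subst[of N])

lemma subst_vars_in: "vars_in l u p \<Longrightarrow> (\<And>i. l \<le> i \<Longrightarrow> i < u \<Longrightarrow> g i = Var i) \<Longrightarrow> subst g p = p"
proof -
  assume p: "vars_in l u p" and g: "\<And>i. l \<le> i \<Longrightarrow> i < u \<Longrightarrow> g i = Var i"
  have "subst (\<lambda>i. if i < l' then g i else Var i) p = p" if "l' \<le> l" for l'
    using that
  proof (induction l')
    case (Suc l')
    have "subst (\<lambda>i. if i < Suc l' then g i else Var i) p = subst (\<lambda>i. if i < Suc l' then g i else Var i) (subst (Var(l' := 0)) p)"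
      using subst_free_of[of l' p 0] p Suc.prems by (simp add: vars_in_def)
    also have "\<dots> = subst (\<lambda>i. if i < l' then g i else Var i) (subst (Var(l' := 0)) p)"
      unfolding subst_subst by (rule arg_cong[of _ _ "\<lambda>f. subst f p"]) (auto simp: less_Suc_eq)
    also have "\<dots> = p" using subst_free_of[of l' p 0] p Suc by (simp add: vars_in_def)
    finally show ?case .
  qed (simp cong: if_cong)
  from this[of l] have "subst (\<lambda>i. if i < l then g i else Var i) p = p" by simp
  moreover have "subst g p = subst (\<lambda>i. if i < l then g i else Var i) p"
    by (rule subst_cong[of u]) (use p g in \<open>auto simp: vars_in_def\<close>)
  ultimately show ?thesis by simp
qed

lemma is_idealD:
  assumes "is_ideal N I"
  shows "a \<in> I \<Longrightarrow> in_vars N a" "0 \<in> I" "a \<in> I \<Longrightarrow> b \<in> I \<Longrightarrow> a + b \<in> I" "in_vars N r \<Longrightarrow> a \<in> I \<Longrightarrow> r * a \<in> I"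
    "a \<in> I \<Longrightarrow> - a \<in> I" "a \<in> I \<Longrightarrow> b \<in> I \<Longrightarrow> a - b \<in> I" "in_vars N r \<Longrightarrow> a \<in> I \<Longrightarrow> a * r \<in> I"
proof -
  show 1: "a \<in> I \<Longrightarrow> in_vars N a" "0 \<in> I" "a \<in> I \<Longrightarrow> b \<in> I \<Longrightarrow> a + b \<in> I" "in_vars N r \<Longrightarrow> a \<in> I \<Longrightarrow> r * a \<in> I" for a b r
    using assms by (auto simp: is_ideal_def)
  show 2: "a \<in> I \<Longrightarrow> - a \<in> I" for a using 1(4)[of "- 1" a] by simp
  show "a \<in> I \<Longrightarrow> b \<in> I \<Longrightarrow> a - b \<in> I" using 1(3)[of a "- b"] 2[of b] by simp
  show "in_vars N r \<Longrightarrow> a \<in> I \<Longrightarrow> a * r \<in> I" using 1(4)[of r a] by (simp add: mult.commute)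
qed

lemma subst_congruent:
  assumes I: "is_ideal N I" and g: "\<And>i. i < N \<Longrightarrow> in_vars N (g i)" "\<And>i. i < N \<Longrightarrow> in_vars N (g' i)"
    "\<And>i. i < N \<Longrightarrow> g i - g' i \<in> I" and p: "in_vars N p"
  shows "subst g p - subst g' p \<in> I"
proof -
  define r :: "nat \<Rightarrow> 'a mpoly" where "r i = (if i < N then Var i else 0)" for i
  have iv: "in_vars N (subst g (subst r q))" "in_vars N (subst g' (subst r q))" for q
  proof -
    have "in_vars N (subst r q)" by (induction q rule: mpoly_induct) (auto simp: r_def)
    then show "in_vars N (subst g (subst r q))" "in_vars N (subst g' (subst r q))" using g by (auto intro: in_vars_subst)
  qed
  have "subst g (subst r q) - subst g' (subst r q) \<in> I" for q
  proof (induction q rule: mpoly_induct)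
    case (Var i) then show ?case using g is_idealD(2)[OF I] by (simp add: r_def)
  next
    case (add p q)
    then show ?case using is_idealD(3)[OF I add] by (simp add: algebra_simps)
  next
    case (mult p q)
    have "subst g (subst r (p * q)) - subst g' (subst r (p * q)) =
      subst g (subst r q) * (subst g (subst r p) - subst g' (subst r p)) + subst g' (subst r p) * (subst g (subst r q) - subst g' (subst r q))"
      by (simp add: algebra_simps)
    then show ?case using is_idealD(3,4)[OF I] mult iv by metis
  qed (simp add: is_idealD(2)[OF I])
  moreover have "subst r p = p" using subst_cong[OF p, of r Var] by (simp add: r_def)
  ultimately show ?thesis by metis
qed

lemma ideal_adjoin:
  assumes I: "is_ideal N I" and a: "in_vars N a"
  shows "is_ideal N {x + r * a | x r. x \<in> I \<and> in_vars N r}" (is "is_ideal N ?J")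
    "I \<subseteq> {x + r * a | x r. x \<in> I \<and> in_vars N r}" "a \<in> {x + r * a | x r. x \<in> I \<and> in_vars N r}"
proof -
  show "I \<subseteq> ?J"
  proof
    fix x assume "x \<in> I"
    moreover have "x = x + 0 * a" by simp
    ultimately show "x \<in> ?J" using in_vars_simps(1) by blast
  qed
  have "a = 0 + 1 * a" by simp
  then show "a \<in> ?J" using is_idealD(2)[OF I] in_vars_simps(2) by blast
  show "is_ideal N ?J" unfolding is_ideal_def
  proof (intro conjI ballI allI impI subsetI)
    fix y assume "y \<in> ?J" then show "y \<in> {p. in_vars N p}" using a is_idealD(1)[OF I] by auto
  next
    show "0 \<in> ?J" using \<open>I \<subseteq> ?J\<close> is_idealD(2)[OF I] by blast
  next
    fix y z assume "y \<in> ?J" "z \<in> ?J"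
    then obtain x r x' r' where "y = x + r * a" "z = x' + r' * a" "x \<in> I" "x' \<in> I" "in_vars N r" "in_vars N r'" by blast
    moreover then have "y + z = (x + x') + (r + r') * a" by (simp add: algebra_simps)
    ultimately show "y + z \<in> ?J" using is_idealD(3)[OF I] in_vars_simps(4) by blast
  next
    fix s y :: "'a mpoly" assume s: "in_vars N s" and "y \<in> ?J"
    then obtain x r where "y = x + r * a" "x \<in> I" "in_vars N r" by blast
    moreover then have "s * y = s * x + (s * r) * a" by (simp add: algebra_simps)
    ultimately show "s * y \<in> ?J" using is_idealD(4)[OF I] in_vars_simps(5) s by blast
  qed
qed

text \<open>An ideal maximal among those that avoid a multiplicative set is prime.\<close>

lemma ex_prime_ideal:
  assumes I: "is_ideal N I" and W: "1 \<in> W" "\<And>a b. a \<in> W \<Longrightarrow> b \<in> W \<Longrightarrow> a * b \<in> W" and disj: "I \<inter> W = {}"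
  obtains P where "is_prime_ideal N P" "I \<subseteq> P" "P \<inter> W = {}"
proof -
  define \<A> where "\<A> = {J. is_ideal N J \<and> I \<subseteq> J \<and> J \<inter> W = {}}"
  have "\<exists>M\<in>\<A>. \<forall>J\<in>\<A>. M \<subseteq> J \<longrightarrow> J = M"
  proof (rule subset_Zorn_nonempty)
    show "\<A> \<noteq> {}" using I disj by (auto simp: \<A>_def)
    fix \<C> assume ne: "\<C> \<noteq> {}" and chain: "subset.chain \<A> \<C>"
    then have sub: "\<And>J. J \<in> \<C> \<Longrightarrow> is_ideal N J \<and> I \<subseteq> J \<and> J \<inter> W = {}" and tot: "\<And>J K. J \<in> \<C> \<Longrightarrow> K \<in> \<C> \<Longrightarrow> J \<subseteq> K \<or> K \<subseteq> J"
      unfolding subset_chain_def \<A>_def by blast+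
    have "is_ideal N (\<Union>\<C>)" unfolding is_ideal_def
    proof (intro conjI ballI allI impI subsetI)
      fix x assume "x \<in> \<Union>\<C>" then show "x \<in> {p. in_vars N p}" using sub is_idealD(1) by blast
    next
      show "0 \<in> \<Union>\<C>" using ne sub is_idealD(2) by blast
    next
      fix a b assume "a \<in> \<Union>\<C>" "b \<in> \<Union>\<C>"
      then obtain J K where "J \<in> \<C>" "K \<in> \<C>" "a \<in> J" "b \<in> K" by blast
      then show "a + b \<in> \<Union>\<C>" using tot[of J K] sub is_idealD(3) by blast
    next
      fix r a :: "'a mpoly" assume "in_vars N r" "a \<in> \<Union>\<C>" then show "r * a \<in> \<Union>\<C>" using sub is_idealD(4) by blast
    qed
    then show "\<Union>\<C> \<in> \<A>" using ne sub unfolding \<A>_def by blast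
  qed
  then obtain M where MA: "M \<in> \<A>" and max': "\<And>J. J \<in> \<A> \<Longrightarrow> M \<subseteq> J \<Longrightarrow> J = M" by blast
  have M: "is_ideal N M" "I \<subseteq> M" "M \<inter> W = {}" using MA by (simp_all add: \<A>_def)
  have max: "J = M" if "is_ideal N J" "M \<subseteq> J" "J \<inter> W = {}" for J
    by (rule max'[OF _ that(2)]) (use that M(2) in \<open>simp add: \<A>_def\<close>)
  have meets: "\<exists>x r. x \<in> M \<and> in_vars N r \<and> x + r * a \<in> W" if a: "in_vars N a" "a \<notin> M" for a
  proof (rule ccontr)
    assume "\<not> ?thesis"
    then have "{x + r * a | x r. x \<in> M \<and> in_vars N r} \<inter> W = {}" by blast
    then show False using max[OF ideal_adjoin(1,2)[OF M(1) a(1)]] ideal_adjoin(3)[OF M(1) a(1)] a(2) by blast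
  qed
  have "is_prime_ideal N M" unfolding is_prime_ideal_def
  proof (intro conjI allI impI)
    show "1 \<notin> M" using M W by blast
    fix a b assume a: "in_vars N a" and b: "in_vars N b" and ab: "a * b \<in> M"
    show "a \<in> M \<or> b \<in> M"
    proof (rule ccontr)
      assume "\<not> ?thesis"
      then obtain x r y s where *: "x \<in> M" "in_vars N r" "x + r * a \<in> W" "y \<in> M" "in_vars N s" "y + s * b \<in> W"
        using meets[OF a] meets[OF b] by blast
      have "(x + r * a) * (y + s * b) = x * (y + s * b) + (r * a) * y + (r * s) * (a * b)" by (simp add: algebra_simps)
      moreover have "x * (y + s * b) \<in> M" "(r * a) * y \<in> M" "(r * s) * (a * b) \<in> M"
        by (rule is_idealD(7)[OF M(1)] is_idealD(4)[OF M(1)]; simp add: * a b ab is_idealD(1)[OF M(1)])+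
      ultimately have "(x + r * a) * (y + s * b) \<in> M" by (simp only: is_idealD(3)[OF M(1)])
      then show False using W(2)[OF *(3,6)] M(3) by blast
    qed
  qed (rule M(1))
  then show ?thesis using M that by blast
qed

text \<open>Modulo \<open>P\<close> only the variables from \<open>c\<close> up to \<open>u\<close>
  survive, and \<open>Var c\<close> satisfies a monic cubic equation over the others.\<close>

lemma cubic_reduction:
  fixes P :: "'k::field mpoly set"
  assumes P: "is_ideal N P" and c: "c < N" "\<And>j. j < c \<Longrightarrow> Var j \<in> P" "\<And>i. u \<le> i \<Longrightarrow> i < N \<Longrightarrow> Var i \<in> P" "u \<le> N" "c < u"
    and d: "vars_in (Suc c) u d0" "vars_in (Suc c) u d1" "vars_in (Suc c) u d2"
    and M: "Var c ^ 3 - (d0 + d1 * Var c + d2 * Var c ^ 2) \<in> P" and g: "in_vars N g"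
  shows "\<exists>g0 g1 g2. vars_in (Suc c) u g0 \<and> vars_in (Suc c) u g1 \<and> vars_in (Suc c) u g2 \<and>
    g - (g0 + g1 * Var c + g2 * Var c ^ 2) \<in> P"
proof -
  let ?w = "Var c :: 'k mpoly"
  let ?q = "\<lambda>g0 g1 g2. g0 + g1 * ?w + g2 * ?w ^ 2"
  define r :: "nat \<Rightarrow> 'k mpoly" where "r i = (if i < N then Var i else 0)" for i
  have iv: "in_vars N (subst r q)" for q by (induction q rule: mpoly_induct) (auto simp: r_def)
  have up: "vars_in (Suc c) u p \<Longrightarrow> in_vars N p" for p using c by (auto simp: vars_in_def elim: in_vars_mono)
  have "\<exists>g0 g1 g2. vars_in (Suc c) u g0 \<and> vars_in (Suc c) u g1 \<and> vars_in (Suc c) u g2 \<and> subst r q - ?q g0 g1 g2 \<in> P" for q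
  proof (induction q rule: mpoly_induct)
    case (Const a)
    show ?case by (intro exI[of _ "Const a"] exI[of _ 0]) (simp add: is_idealD(2)[OF P])
  next
    case (Var i)
    consider "i < c" | "i = c" | "c < i" "i < u" | "u \<le> i" "i < N" | "N \<le> i" by linarith
    then show ?case
    proof cases
      case 1 then show ?thesis using c by (intro exI[of _ 0]) (simp add: r_def)
    next
      case 2 then show ?thesis using c by (intro exI[of _ 0] exI[of _ 1] conjI vars_in_simps) (simp add: r_def is_idealD(2)[OF P])
    next
      case 3 then show ?thesis using c by (intro exI[of _ "Var i"] exI[of _ 0]) (simp add: r_def is_idealD(2)[OF P] vars_in_Var)
    next
      case 4 then show ?thesis using c by (intro exI[of _ 0]) (simp add: r_def)
    next
      case 5 then show ?thesis by (intro exI[of _ 0]) (simp add: r_def is_idealD(2)[OF P])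
    qed
  next
    case (add p q)
    then obtain a0 a1 a2 b0 b1 b2 where a: "vars_in (Suc c) u a0" "vars_in (Suc c) u a1" "vars_in (Suc c) u a2" "subst r p - ?q a0 a1 a2 \<in> P"
      and b: "vars_in (Suc c) u b0" "vars_in (Suc c) u b1" "vars_in (Suc c) u b2" "subst r q - ?q b0 b1 b2 \<in> P" by blast
    have "subst r (p + q) - ?q (a0 + b0) (a1 + b1) (a2 + b2) = (subst r p - ?q a0 a1 a2) + (subst r q - ?q b0 b1 b2)"
      by (simp add: algebra_simps)
    then have "subst r (p + q) - ?q (a0 + b0) (a1 + b1) (a2 + b2) \<in> P" using is_idealD(3)[OF P a(4) b(4)] by (simp only:)
    then show ?case using a b by (intro exI[of _ "a0 + b0"] exI[of _ "a1 + b1"] exI[of _ "a2 + b2"]) simp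
  next
    case (mult p q)
    then obtain a0 a1 a2 b0 b1 b2 where a: "vars_in (Suc c) u a0" "vars_in (Suc c) u a1" "vars_in (Suc c) u a2" "subst r p - ?q a0 a1 a2 \<in> P"
      and b: "vars_in (Suc c) u b0" "vars_in (Suc c) u b1" "vars_in (Suc c) u b2" "subst r q - ?q b0 b1 b2 \<in> P" by blast
    \<comment> \<open>\<open>k4\<close> is the coefficient of the fourth power of
      \<open>Var c\<close> in the product; \<open>k3\<close> is that of the third power after the
      fourth has been reduced.\<close>
    define k3 where "k3 = a1 * b2 + a2 * b1 + a2 * b2 * d2"
    define k4 where "k4 = a2 * b2"
    define e0 where "e0 = a0 * b0 + k3 * d0"
    define e1 where "e1 = a0 * b1 + a1 * b0 + k4 * d0 + k3 * d1"
    define e2 where "e2 = a0 * b2 + a1 * b1 + a2 * b0 + k4 * d1 + k3 * d2"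
    have eq: "subst r (p * q) - ?q e0 e1 e2 = subst r q * (subst r p - ?q a0 a1 a2) + ?q a0 a1 a2 * (subst r q - ?q b0 b1 b2)
       + (k3 + k4 * ?w) * (?w ^ 3 - ?q d0 d1 d2)"
      unfolding subst_simps e0_def e1_def e2_def k3_def k4_def by algebra
    have iw: "in_vars N ?w" using c by simp
    have 1: "in_vars N (?q a0 a1 a2)" using up[OF a(1)] up[OF a(2)] up[OF a(3)] iw by simp
    have 2: "in_vars N (k3 + k4 * ?w)"
      using up[OF a(2)] up[OF a(3)] up[OF b(2)] up[OF b(3)] up[OF d(3)] iw by (simp add: k3_def k4_def)
    have "subst r (p * q) - ?q e0 e1 e2 \<in> P" unfolding eq
      by (rule is_idealD(3)[OF P is_idealD(3)[OF P is_idealD(4)[OF P iv a(4)] is_idealD(4)[OF P 1 b(4)]] is_idealD(4)[OF P 2 M]])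
    moreover have "vars_in (Suc c) u e0" "vars_in (Suc c) u e1" "vars_in (Suc c) u e2"
      using a b d by (simp_all add: e0_def e1_def e2_def k3_def k4_def)
    ultimately show ?case by blast
  qed
  from this[of g] show ?thesis using subst_cong[OF g, of r Var] by (simp add: r_def)
qed

text \<open>The determinant, expanded along the first column, equals the combination of the rows
  applied to \<open>(1, w, v)\<close> with the same cofactors, since these annihilate the other two
  columns.\<close>

lemma cramer_first_column:
  fixes w v :: "'a::comm_ring_1"
  shows "m00 * (m11 * m22 - m12 * m21) + m10 * (m02 * m21 - m01 * m22) + m20 * (m01 * m12 - m02 * m11) =
    (m11 * m22 - m12 * m21) * (m00 + m01 * w + m02 * v) + (m02 * m21 - m01 * m22) * (m10 + m11 * w + m12 * v) +
    (m01 * m12 - m02 * m11) * (m20 + m21 * w + m22 * v)"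
  by (simp add: algebra_simps)

text \<open>By \<open>cubic_reduction\<close>, multiplication by \<open>g\<close> modulo \<open>P\<close> is given by a \<open>3 \<times> 3\<close> matrix on
  \<open>1, Var c, Var c ^ 2\<close> with entries in the free variables; the determinant trick shows that putting \<open>Var u\<close>
  to zero imposes no relation on the remaining ones.\<close>

lemma prime_step:
  fixes P :: "'k::field mpoly set"
  assumes P: "is_ideal N P" and c: "c < N" "\<And>j. j < c \<Longrightarrow> Var j \<in> P" "\<And>i. Suc u \<le> i \<Longrightarrow> i < N \<Longrightarrow> Var i \<in> P" "Suc u \<le> N" "c < u"
    and d: "vars_in (Suc c) N d0" "vars_in (Suc c) N d1" "vars_in (Suc c) N d2"
    and M: "Var c ^ 3 - (d0 + d1 * Var c + d2 * Var c ^ 2) \<in> P"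
    and P0: "\<And>f. f \<in> P \<Longrightarrow> vars_in (Suc c) (Suc u) f \<Longrightarrow> f = 0"
    and s: "s = f + g * Var u" "f \<in> P" "in_vars N g" "vars_in (Suc c) u s"
  shows "s = 0"
proof -
  let ?w = "Var c :: 'k mpoly" and ?x = "Var u :: 'k mpoly"
  let ?q = "\<lambda>g0 g1 g2. g0 + g1 * ?w + g2 * ?w ^ 2"
  have up: "in_vars N p" if "vars_in (Suc c) (Suc u) p" for p :: "'k mpoly"
    by (rule in_vars_mono[OF _ c(4)]) (use that in \<open>simp add: vars_in_def\<close>)
  have iw: "in_vars N ?w" using c(1) by simp
  define \<tau> where "\<tau> = subst (\<lambda>i. if i < Suc u then Var i else (0 :: 'k mpoly))"
  have \<tau>: "p - \<tau> p \<in> P" "vars_in (Suc c) (Suc u) (\<tau> p)" if "vars_in (Suc c) N p" for p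
  proof -
    have pv: "in_vars N p" using that by (simp add: vars_in_def)
    have "subst Var p - \<tau> p \<in> P" unfolding \<tau>_def
      by (rule subst_congruent[OF P _ _ _ pv]) (simp_all add: is_idealD(2)[OF P] c(3))
    then show "p - \<tau> p \<in> P" by simp
    have "subst (\<lambda>i. if i < Suc c then 0 else Var i) p = p" by (rule subst_vars_in[OF that]) auto
    then have "\<tau> p = \<tau> (subst (\<lambda>i. if i < Suc c then 0 else Var i) p)" by (rule arg_cong[OF sym])
    also have "\<dots> = subst (\<lambda>i. if Suc c \<le> i \<and> i < Suc u then Var i else 0) p"
      unfolding \<tau>_def subst_subst by (rule arg_cong[of _ _ "\<lambda>f. subst f p"]) (auto simp: not_less)
    finally show "vars_in (Suc c) (Suc u) (\<tau> p)" by (simp add: vars_in_subst[OF pv] vars_in_Var)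
  qed
  have M': "?w ^ 3 - ?q (\<tau> d0) (\<tau> d1) (\<tau> d2) \<in> P"
  proof -
    have eq: "?w ^ 3 - ?q (\<tau> d0) (\<tau> d1) (\<tau> d2) = (?w ^ 3 - ?q d0 d1 d2) + (d0 - \<tau> d0) + ?w * (d1 - \<tau> d1) + ?w ^ 2 * (d2 - \<tau> d2)"
      by (simp add: algebra_simps)
    show ?thesis unfolding eq
      by (intro is_idealD(3)[OF P] is_idealD(4)[OF P] M \<tau>(1) d) (simp_all add: iw c(1) power2_eq_square)
  qed
  have red: "\<exists>g0 g1 g2. vars_in (Suc c) (Suc u) g0 \<and> vars_in (Suc c) (Suc u) g1 \<and> vars_in (Suc c) (Suc u) g2 \<and> g - ?q g0 g1 g2 \<in> P"
    if "in_vars N g" for g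
    by (rule cubic_reduction[OF P c(1) _ _ c(4) less_SucI[OF c(5)] \<tau>(2)[OF d(1)] \<tau>(2)[OF d(2)] \<tau>(2)[OF d(3)] M' that])
      (use c(2,3) in auto)
  obtain a0 a1 a2 where a: "vars_in (Suc c) (Suc u) a0" "vars_in (Suc c) (Suc u) a1" "vars_in (Suc c) (Suc u) a2" "g - ?q a0 a1 a2 \<in> P"
    using red[OF s(3)] by blast
  obtain b0 b1 b2 where b: "vars_in (Suc c) (Suc u) b0" "vars_in (Suc c) (Suc u) b1" "vars_in (Suc c) (Suc u) b2" "g * ?w - ?q b0 b1 b2 \<in> P"
    using red[of "g * ?w"] s(3) iw by auto
  obtain e0 e1 e2 where e: "vars_in (Suc c) (Suc u) e0" "vars_in (Suc c) (Suc u) e1" "vars_in (Suc c) (Suc u) e2" "g * ?w ^ 2 - ?q e0 e1 e2 \<in> P"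
    using red[of "g * ?w ^ 2"] s(3) iw by auto
  have ix: "in_vars N ?x" using c(4) by simp
  have row: "s * v - ?x * ?q h0 h1 h2 \<in> P" if "g * v - ?q h0 h1 h2 \<in> P" "in_vars N v" for v h0 h1 h2
  proof -
    have eq: "s * v - ?x * ?q h0 h1 h2 = v * f + ?x * (g * v - ?q h0 h1 h2)" unfolding s(1) by algebra
    show ?thesis unfolding eq using that s ix by (intro is_idealD(3)[OF P] is_idealD(4)[OF P])
  qed
  have r0: "s - ?x * ?q a0 a1 a2 \<in> P" using row[of 1 a0 a1 a2] a by simp
  have r1: "s * ?w - ?x * ?q b0 b1 b2 \<in> P" using row[of ?w b0 b1 b2] b iw by simp
  have r2: "s * ?w ^ 2 - ?x * ?q e0 e1 e2 \<in> P" using row[of "?w ^ 2" e0 e1 e2] e iw by simp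
  \<comment> \<open>The matrix \<open>s - Var u * M\<close>, where \<open>M\<close> describes
    multiplication by \<open>g\<close> on \<open>1, Var c, Var c ^ 2\<close>; it sends this vector
    into \<open>P\<close>.\<close>
  define m00 m01 m02 where "m00 = s - ?x * a0" "m01 = - (?x * a1)" "m02 = - (?x * a2)"
  define m10 m11 m12 where "m10 = - (?x * b0)" "m11 = s - ?x * b1" "m12 = - (?x * b2)"
  define m20 m21 m22 where "m20 = - (?x * e0)" "m21 = - (?x * e1)" "m22 = s - ?x * e2"
  note m_defs = m00_m01_m02_def m10_m11_m12_def m20_m21_m22_def
  have rows: "m00 + m01 * ?w + m02 * ?w ^ 2 \<in> P" "m10 + m11 * ?w + m12 * ?w ^ 2 \<in> P" "m20 + m21 * ?w + m22 * ?w ^ 2 \<in> P"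
    using r0 r1 r2 by (simp_all add: m_defs algebra_simps)
  define \<Delta> where "\<Delta> = m00 * (m11 * m22 - m12 * m21) + m10 * (m02 * m21 - m01 * m22) + m20 * (m01 * m12 - m02 * m11)"
  have sv: "vars_in (Suc c) (Suc u) s" using s(4) by (rule vars_in_mono) simp
  have xv: "vars_in (Suc c) (Suc u) ?x" using c(5) by (simp add: vars_in_Var)
  have mv: "vars_in (Suc c) (Suc u) m00" "vars_in (Suc c) (Suc u) m01" "vars_in (Suc c) (Suc u) m02"
    "vars_in (Suc c) (Suc u) m10" "vars_in (Suc c) (Suc u) m11" "vars_in (Suc c) (Suc u) m12"
    "vars_in (Suc c) (Suc u) m20" "vars_in (Suc c) (Suc u) m21" "vars_in (Suc c) (Suc u) m22"
    unfolding m_defs using a b e sv xv by simp_all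
  have "\<Delta> \<in> P" unfolding \<Delta>_def cramer_first_column[of m00 m11 m22 m12 m21 m10 m02 m01 m20 ?w "?w ^ 2"]
    by (intro is_idealD(3)[OF P] is_idealD(4)[OF P] rows up) (simp_all add: mv)
  moreover have "vars_in (Suc c) (Suc u) \<Delta>" unfolding \<Delta>_def by (simp add: mv)
  ultimately have "\<Delta> = 0" by (rule P0)
  \<comment> \<open>At \<open>Var u = 0\<close> the matrix becomes \<open>s\<close> times the
    identity, with determinant \<open>s ^ 3\<close>.\<close>
  moreover have "subst (Var(u := 0)) s = s" by (rule subst_vars_in[OF s(4)]) auto
  then have "subst (Var(u := 0)) \<Delta> = s * (s * s)" by (simp add: \<Delta>_def m_defs)
  ultimately show ?thesis by simp
qed

text \<open>Modulo the first \<open>c\<close> variables and \<open>D\<close>, the variable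
  \<open>Var c\<close> is integral over the polynomials in the remaining ones. These are added to
  the ideal one by one from the last; each \<open>P k\<close> meets the polynomials in those not yet
  added only in 0, so the next variable is new.\<close>

lemma prime_chain:
  fixes D :: "'k::field mpoly"
  assumes c: "c < N" and D: "in_vars N D" "\<And>j. j < c \<Longrightarrow> free_of j D" "\<not> free_of c D"
    and d: "vars_in (Suc c) N d0" "vars_in (Suc c) N d1" "vars_in (Suc c) N d2"
    and E: "in_vars N E" "Var c ^ 3 - (d0 + d1 * Var c + d2 * Var c ^ 2) = E * D"
  shows "\<exists>P. (\<forall>k\<le>N - Suc c. is_prime_ideal N (P k) \<and> (\<forall>j<c. Var j \<in> P k) \<and> D \<in> P k) \<and>
    (\<forall>k<N - Suc c. P k \<subseteq> P (Suc k) \<and> Var (N - Suc k) \<in> P (Suc k) - P k)"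
proof -
  let ?h = "N - Suc c"
  define W where "W u = {f :: 'k mpoly. vars_in (Suc c) u f \<and> f \<noteq> 0}" for u
  have W: "1 \<in> W u" "a \<in> W u \<Longrightarrow> b \<in> W u \<Longrightarrow> a * b \<in> W u" for u a b by (auto simp: W_def)
  \<comment> \<open>The guard \<open>k \<le> ?h\<close> makes every step solvable, as dependent
    choice requires, although only finitely many steps matter.\<close>
  define \<Phi> where "\<Phi> k P \<longleftrightarrow> (k \<le> ?h \<longrightarrow> is_prime_ideal N P \<and> (\<forall>j<c. Var j \<in> P) \<and> D \<in> P \<and>
      (\<forall>i. N - k \<le> i \<longrightarrow> i < N \<longrightarrow> Var i \<in> P) \<and> P \<inter> W (N - k) = {})" for k P
  define \<Psi> where "\<Psi> k (P :: 'k mpoly set) P' \<longleftrightarrow> (k < ?h \<longrightarrow> P \<subseteq> P' \<and> Var (N - Suc k) \<in> P' - P)" for k P P'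
  have base: "\<exists>P. \<Phi> 0 P"
  proof -
    \<comment> \<open>The ideal generated by \<open>D\<close> and the first \<open>c\<close>
      variables, described by substitution so that membership is easy to decide.\<close>
    define I0 where "I0 = {f. in_vars N f \<and> D dvd subst (\<lambda>i. if i < c then 0 else Var i) f}"
    have I0: "is_ideal N I0" unfolding is_ideal_def I0_def by auto
    have disj: "I0 \<inter> W N = {}"
    proof (rule ccontr)
      assume "I0 \<inter> W N \<noteq> {}"
      then obtain f where f: "D dvd subst (\<lambda>i. if i < c then 0 else Var i) f" "vars_in (Suc c) N f" "f \<noteq> 0"
        by (auto simp: I0_def W_def)
      have "subst (\<lambda>i. if i < c then 0 else Var i) f = f" by (rule subst_vars_in[OF f(2)]) auto
      then obtain e where "f = D * e" using f(1) by (metis dvdE)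
      then have "free_of c D" using free_of_factor[of c D e] f(2,3) by (simp add: vars_in_def)
      then show False using D(3) by simp
    qed
    obtain P where P: "is_prime_ideal N P" "I0 \<subseteq> P" "P \<inter> W N = {}" by (rule ex_prime_ideal[OF I0 W disj])
    have "D \<in> I0" unfolding I0_def using D(1,2) subst_vars_in[of c N D "\<lambda>i. if i < c then 0 else Var i"]
      by (simp add: vars_in_def)
    moreover have "Var j \<in> I0" if "j < c" for j using that c by (simp add: I0_def)
    ultimately show ?thesis using P unfolding \<Phi>_def by (intro exI[of _ P]) auto
  qed
  have step: "\<exists>P'. \<Phi> (Suc k) P' \<and> \<Psi> k P P'" if "\<Phi> k P" for k P
  proof (cases "Suc k \<le> ?h")
    case True
    then have P: "is_prime_ideal N P" "\<And>j. j < c \<Longrightarrow> Var j \<in> P" "D \<in> P" "\<And>i. N - k \<le> i \<Longrightarrow> i < N \<Longrightarrow> Var i \<in> P" "P \<inter> W (N - k) = {}"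
      using that by (auto simp: \<Phi>_def)
    have Pi: "is_ideal N P" using P(1) by (simp add: is_prime_ideal_def)
    define u where "u = N - Suc k"
    have u: "N - k = Suc u" "Suc u \<le> N" "c < u" using True by (auto simp: u_def)
    have "in_vars N (Var u :: 'k mpoly)" using u by simp
    note J = ideal_adjoin[OF Pi this]
    let ?J = "{x + r * Var u | x r. x \<in> P \<and> in_vars N r}"
    have disj: "?J \<inter> W u = {}"
    proof (rule ccontr)
      assume "?J \<inter> W u \<noteq> {}"
      then obtain x r where xr: "x \<in> P" "in_vars N r" "vars_in (Suc c) u (x + r * Var u)" "x + r * Var u \<noteq> 0" by (auto simp: W_def)
      have MP: "Var c ^ 3 - (d0 + d1 * Var c + d2 * Var c ^ 2) \<in> P" unfolding E(2) by (rule is_idealD(4)[OF Pi E(1) P(3)])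
      have P4: "Var i \<in> P" if "Suc u \<le> i" "i < N" for i using P(4) u(1) that by simp
      have P0: "f = 0" if "f \<in> P" "vars_in (Suc c) (Suc u) f" for f using P(5) u(1) that unfolding W_def by auto
      have "x + r * Var u = 0"
        by (rule prime_step[OF Pi c P(2) P4 u(2,3) d MP P0 refl xr(1,2,3)])
      then show False using xr(4) by simp
    qed
    obtain P' where P': "is_prime_ideal N P'" "?J \<subseteq> P'" "P' \<inter> W u = {}" by (rule ex_prime_ideal[OF J(1) W disj])
    have sub: "P \<subseteq> P'" "Var u \<in> P'" using J P' by blast+
    have "Var u \<in> W (N - k)" using u by (simp add: W_def vars_in_Var Var_neq_0)
    then have "Var u \<notin> P" using P(5) by blast
    then have "\<Psi> k P P'" using sub unfolding \<Psi>_def u_def[symmetric] by blast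
    have "Var i \<in> P'" if "u \<le> i" "i < N" for i
    proof (cases "i = u")
      case False
      then have "N - k \<le> i" using that u by simp
      then show ?thesis using P(4) that sub by blast
    qed (use sub in simp)
    then have "\<Phi> (Suc k) P'"
      using P'(1,3) sub P(2,3) unfolding \<Phi>_def u_def[symmetric] by blast
    then show ?thesis using \<open>\<Psi> k P P'\<close> by blast
  qed (auto simp: \<Phi>_def \<Psi>_def)
  obtain P where P: "\<And>k. \<Phi> k (P k)" "\<And>k. \<Psi> k (P k) (P (Suc k))"
    using dependent_nat_choice[of \<Phi> \<Psi>, OF base step] by blast
  have "is_prime_ideal N (P k) \<and> (\<forall>j<c. Var j \<in> P k) \<and> D \<in> P k" if "k \<le> ?h" for k
    using P(1)[of k] that unfolding \<Phi>_def by blast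
  moreover have "P k \<subseteq> P (Suc k) \<and> Var (N - Suc k) \<in> P (Suc k) - P k" if "k < ?h" for k
    using P(2)[of k] that unfolding \<Psi>_def by blast
  ultimately show ?thesis by blast
qed

subsection \<open>Partial derivatives and linear forms\<close>

text \<open>The truncated subtraction of exponents does no harm: where the exponent of
  \<open>i\<close> is zero, so is the factor in front.\<close>

lemma grad_mon_Var:
  "grad (mon Var m) x (uvec i) = of_nat (Poly_Mapping.lookup m i) * mon x (m - Poly_Mapping.single i 1)"
proof (induction "mdeg m" arbitrary: m)
  case 0
  then have "m = 0" by (auto simp: mdeg_def in_keys_iff poly_mapping_eq_iff fun_eq_iff)
  then show ?case using grad_simps(1)[of 1 x "uvec i"] by simp
next
  case (Suc d)
  have "Poly_Mapping.keys m \<noteq> {}" using Suc(2) by (auto simp: mdeg_def)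
  then obtain j where j: "j \<in> Poly_Mapping.keys m" by blast
  define m' where "m' = m - Poly_Mapping.single j 1"
  have m: "m = Poly_Mapping.single j 1 + m'"
    by (rule poly_mapping_eqI) (use j in \<open>auto simp: m'_def lookup_add lookup_minus lookup_single when_def in_keys_iff\<close>)
  have "d = mdeg m'" using Suc(2) mdeg_add[of "Poly_Mapping.single j 1" m'] m by simp
  note IH = Suc(1)[OF this]
  have E: "eval x (mon Var m') = mon x m'" by (simp add: mon_def)
  have G: "grad (mon Var m) x (uvec i) = x j * (of_nat (Poly_Mapping.lookup m' i) * mon x (m' - Poly_Mapping.single i 1)) + uvec i j * mon x m'"
    unfolding m mon_add mon_single power_one_right grad_simps E IH by simp
  show ?case
  proof (cases "Poly_Mapping.lookup m' i = 0")
    case True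
    have "m - Poly_Mapping.single i 1 = m'" if "j = i"
      by (rule poly_mapping_eqI) (use that in \<open>auto simp: m lookup_add lookup_minus lookup_single when_def\<close>)
    then show ?thesis unfolding G using True by (auto simp: uvec_def m lookup_add lookup_single when_def)
  next
    case False
    define m2 where "m2 = m' - Poly_Mapping.single i 1"
    have m': "m' = Poly_Mapping.single i 1 + m2"
      by (rule poly_mapping_eqI) (use False in \<open>auto simp: m2_def lookup_add lookup_minus lookup_single when_def\<close>)
    have "m - Poly_Mapping.single i 1 = Poly_Mapping.single j 1 + m2"
      by (rule poly_mapping_eqI) (auto simp: m m' lookup_add lookup_minus lookup_single when_def)
    then show ?thesis unfolding G m2_def[symmetric]
      by (simp add: mon_add uvec_def algebra_simps) (simp add: m m' mon_add lookup_add lookup_single when_def algebra_simps)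
  qed
qed

lemma grad_sum: "grad (sum f A) x z = (\<Sum>a\<in>A. grad (f a) x z)"
  using grad_simps(1)[of 0 x z] by (induction A rule: infinite_finite_induct) simp_all

lemma eval_pderiv_var: "eval x (pderiv_var i p) = grad p x (uvec i)"
proof -
  have "eval x (pderiv_var i p) = (\<Sum>m\<in>Poly_Mapping.keys p. grad (Const (Poly_Mapping.lookup p m) * mon Var m) x (uvec i))"
    unfolding pderiv_var_def eval_simps
    by (rule sum.cong) (simp_all only: eval_single grad_simps grad_mon_Var eval_Const, simp_all add: mult_ac)
  also have "\<dots> = grad p x (uvec i)" unfolding grad_sum[symmetric] mpoly_sum_mon[symmetric] ..
  finally show ?thesis .
qed

lemma eval_linear_form:
  assumes "in_vars N L" "homogeneous 1 L"
  shows "eval x L = (\<Sum>k<N. eval (uvec k) L * x k)"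
proof -
  let ?K = "Poly_Mapping.keys L"
  have "\<exists>k<N. \<forall>x :: nat \<Rightarrow> 'a. mon x m = x k" if m: "m \<in> ?K" for m
  proof -
    have "mdeg m = Suc 0" using assms m by (simp add: homogeneous_def)
    from mon_split[where 'b = 'a, OF this] obtain k m' where
      k: "k \<in> Poly_Mapping.keys m" "\<forall>x :: nat \<Rightarrow> 'a. mon x m = x k * mon x m'" "mdeg m' = 0" by (elim exE conjE)
    have "m' = 0" using k(3) by (auto simp: mdeg_def in_keys_iff poly_mapping_eq_iff fun_eq_iff)
    then show ?thesis using k assms(1) m by (intro exI[of _ k]) (auto simp: in_vars_def)
  qed
  then obtain k where k: "\<And>m. m \<in> ?K \<Longrightarrow> k m < N" "\<And>m x. m \<in> ?K \<Longrightarrow> mon (x :: nat \<Rightarrow> 'a) m = x (k m)" by metis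
  have E: "eval x L = (\<Sum>m\<in>?K. Poly_Mapping.lookup L m * x (k m))" for x :: "nat \<Rightarrow> 'a"
    unfolding eval_mon by (rule sum.cong) (auto simp: k)
  have "eval x L = (\<Sum>m\<in>?K. \<Sum>j<N. Poly_Mapping.lookup L m * (x j * uvec j (k m)))"
    unfolding E sum_distrib_left[symmetric] by (rule sum.cong) (auto simp: sum_uvec k)
  also have "\<dots> = (\<Sum>j<N. eval (uvec j) L * x j)"
    unfolding E sum_distrib_right by (subst sum.swap) (simp add: mult_ac)
  finally show ?thesis .
qed

text \<open>Vectors dual to the forms, together with \<open>s\<close>, are completed to a basis;
  from the vectors of index at least \<open>c\<close> their components along the dual vectors are
  subtracted. This leaves \<open>s\<close> unchanged, as the forms vanish on it.\<close>

lemma adapted_basis: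
  fixes l :: "nat \<Rightarrow> nat \<Rightarrow> 'k::field"
  assumes l: "indep_family N c l" and c: "c < N" and s: "\<And>j. j < c \<Longrightarrow> (\<Sum>k<N. l j k * s k) = 0" "i0 < N" "s i0 \<noteq> 0"
  shows "\<exists>b. indep_family N N b \<and> b c = s \<and> (\<forall>i<N. \<forall>j<c. (\<Sum>k<N. l j k * b i k) = (if i = j then 1 else 0))"
proof -
  let ?l = "\<lambda>j x. \<Sum>k<N. l j k * x k"
  have lsum: "?l j (\<lambda>k. \<Sum>i\<in>I. y i * v i k) = (\<Sum>i\<in>I. y i * ?l j (v i))" for j y v and I :: "nat set"
    unfolding sum_distrib_left by (subst sum.swap) (simp add: mult_ac)
  have lzero: "?l j v = 0" if "\<And>k. k < N \<Longrightarrow> v k = 0" for j v using that by simp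
  obtain l' where l': "indep_family N N l'" "\<And>j. j < c \<Longrightarrow> l' j = l j" using indep_family_extend[OF l] c by auto
  obtain b0 where b0: "\<And>i j. i < N \<Longrightarrow> j < N \<Longrightarrow> (\<Sum>k<N. l' i k * b0 j k) = (if i = j then 1 else 0)"
    using dual_family[OF l'(1)] by blast
  have lb0: "?l j (b0 i) = (if i = j then 1 else 0)" if "j < c" "i < N" for i j
    using b0[of j i] l'(2)[of j] that c by auto
  define f where "f i = (if i < c then b0 i else s)" for i
  have "indep_family N (Suc c) f" unfolding indep_family_def
  proof (intro allI impI)
    fix x j assume x: "\<forall>i<N. (\<Sum>j<Suc c. x j * f j i) = 0" and j: "j < Suc c"
    have xj: "x j = 0" if "j < c" for j
    proof -
      have "0 = (\<Sum>i<Suc c. x i * ?l j (f i))" unfolding lsum[symmetric] by (rule lzero[symmetric]) (use x in blast)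
      also have "\<dots> = (\<Sum>i<Suc c. if i = j then x i else 0)"
        by (rule sum.cong) (use that c s(1)[OF that] lb0[OF that] in \<open>auto simp: f_def\<close>)
      also have "\<dots> = x j" using that by simp
      finally show ?thesis by simp
    qed
    moreover have "x c * s i0 = 0" using x s(2) xj by (simp add: f_def)
    ultimately show "x j = 0" using s(3) j by (auto simp: less_Suc_eq)
  qed
  then obtain f' where f': "indep_family N N f'" "\<And>j. j < Suc c \<Longrightarrow> f' j = f j" using indep_family_extend[of N "Suc c" f] c by auto
  define b where "b i = (if i < c then f' i else (\<lambda>k. f' i k - (\<Sum>j<c. ?l j (f' i) * f' j k)))" for i
  have lf': "?l j (f' i) = (if i = j then 1 else 0)" if "j < c" "i < c" for i j
    using f'(2)[of i] lb0[of j i] that c by (auto simp: f_def)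
  have lb: "?l j (b i) = (if i = j then 1 else 0)" if "j < c" "i < N" for i j
  proof (cases "i < c")
    case True then show ?thesis using lf' that by (simp add: b_def)
  next
    case False
    have "?l j (b i) = ?l j (f' i) - ?l j (\<lambda>k. \<Sum>j<c. ?l j (f' i) * f' j k)"
      using False by (simp add: b_def algebra_simps sum_subtractf)
    also have "\<dots> = 0" unfolding lsum using that(1) by (simp add: lf' if_distrib[of "\<lambda>x. _ * x"] cong: if_cong)
    finally show ?thesis using False that by auto
  qed
  have "b c = s"
  proof
    fix k
    have fc: "f' c = s" using f'(2)[of c] by (simp add: f_def)
    have "(\<Sum>j<c. ?l j (f' c) * f' j k) = 0" unfolding fc by (rule sum.neutral) (use s(1) in auto)
    then show "b c k = s k" by (simp add: b_def fc)
  qed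
  moreover have "indep_family N N b" unfolding indep_family_def
  proof (intro allI impI)
    fix x j assume x: "\<forall>i<N. (\<Sum>j<N. x j * b j i) = 0" and j: "j < N"
    have xj: "x j = 0" if "j < c" for j
    proof -
      have "0 = (\<Sum>i<N. x i * ?l j (b i))" unfolding lsum[symmetric] by (rule lzero[symmetric]) (use x in blast)
      also have "\<dots> = (\<Sum>i<N. if i = j then x i else 0)" by (rule sum.cong) (use that lb in auto)
      also have "\<dots> = x j" using that c by simp
      finally show ?thesis by simp
    qed
    \<comment> \<open>Turns a relation between the corrected vectors \<open>b\<close> into one
      between the basis \<open>f'\<close>.\<close>
    define y where "y i = (if i < c then - (\<Sum>t\<in>{c..<N}. x t * ?l i (f' t)) else x i)" for i
    have split: "{..<N} = {..<c} \<union> {c..<N}" using c by auto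
    have su: "sum g {..<N} = sum g {..<c} + sum g {c..<N}" for g :: "nat \<Rightarrow> 'k"
      unfolding split by (rule sum.union_disjoint) auto
    have "(\<Sum>j<N. y j * f' j i) = (\<Sum>j<N. x j * b j i)" for i
    proof -
      have "(\<Sum>j<N. y j * f' j i) = (\<Sum>j\<in>{c..<N}. x j * f' j i) - (\<Sum>j<c. (\<Sum>t\<in>{c..<N}. x t * ?l j (f' t)) * f' j i)"
        unfolding su[of "\<lambda>j. y j * f' j i"] by (simp add: y_def sum_negf)
      also have "(\<Sum>j<c. (\<Sum>t\<in>{c..<N}. x t * ?l j (f' t)) * f' j i) = (\<Sum>t\<in>{c..<N}. x t * (\<Sum>j<c. ?l j (f' t) * f' j i))"
        unfolding sum_distrib_right[of _ "{c..<N}"] by (subst sum.swap) (simp add: sum_distrib_left[of "x t" _ "{..<c}" for t] mult.assoc)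
      also have "(\<Sum>j\<in>{c..<N}. x j * f' j i) - \<dots> = (\<Sum>j\<in>{c..<N}. x j * b j i)"
        unfolding sum_subtractf[symmetric] by (rule sum.cong) (auto simp: b_def right_diff_distrib)
      also have "\<dots> = (\<Sum>j<N. x j * b j i)" unfolding su[of "\<lambda>j. x j * b j i"] using xj by simp
      finally show ?thesis .
    qed
    then have "y j = 0" using indep_familyD[OF f'(1), of y] x j by simp
    then show "x j = 0" using xj by (cases "j < c") (auto simp: y_def)
  qed
  ultimately show ?thesis using lb by blast
qed

lemma PF_vars_in:
  assumes "PF N f" "\<And>z z'. (\<And>i. l \<le> i \<Longrightarrow> i < N \<Longrightarrow> z i = z' i) \<Longrightarrow> f z = f z'"
  shows "\<exists>e. vars_in l N e \<and> (\<forall>z. eval z e = f z)"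
proof -
  obtain p where p: "in_vars N p" "\<And>z. f z = eval z p" using assms(1) by (auto simp: PF_def)
  let ?g = "\<lambda>i. if i < l then 0 else Var i"
  have "vars_in l N (subst ?g p)" by (rule vars_in_subst[OF p(1)]) (auto simp: vars_in_Var)
  moreover have "eval z (subst ?g p) = f z" for z
    unfolding eval_subst p(2)[symmetric] by (rule assms(2)) auto
  ultimately show ?thesis by blast
qed

text \<open>The form is expanded along lines \<open>x + t y\<close>; in characteristic zero the
  values at \<open>t = 1, -1, 2\<close> separate the coefficients.\<close>

lemma (in quartic_form) polarize:
  assumes S: "\<And>x y. S x \<Longrightarrow> S y \<Longrightarrow> S (x + y)" "\<And>t x. S x \<Longrightarrow> S (t *v x)" "\<And>x. S x \<Longrightarrow> Q x x x x = 0"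
    and "S u" "S v" "S w" "S z"
  shows "Q u v w z = 0"
proof -
  have 1: "Q x x x y = 0" if xy: "S x" "S y" for x y
  proof -
    have "4 * t * Q x x x y + 6 * t ^ 2 * Q x x y y + 4 * t ^ 3 * Q x y y y = 0" for t
    proof -
      have "Q (x + t *v y) (x + t *v y) (x + t *v y) (x + t *v y) = 0" using xy S by blast
      then show ?thesis using S(3)[OF xy(1)] S(3)[OF xy(2)] by (simp add: multilinear symmetric power2_eq_square power3_eq_cube algebra_simps)
    qed
    from this[of 1] this[of "-1"] this[of 2]
    have "4 * Q x x x y + 6 * Q x x y y + 4 * Q x y y y = 0" "- 4 * Q x x x y + 6 * Q x x y y - 4 * Q x y y y = 0"
      "8 * Q x x x y + 24 * Q x x y y + 32 * Q x y y y = 0" by simp_all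
    then have "24 * Q x x x y = 0" by algebra
    then show ?thesis by simp
  qed
  have 2: "Q x x a y = 0" if xy: "S x" "S y" "S a" for x y a
  proof -
    have "3 * t * Q x x a y + 3 * t ^ 2 * Q x a a y = 0" for t
    proof -
      have "Q (x + t *v a) (x + t *v a) (x + t *v a) y = 0" using xy S 1 by blast
      then show ?thesis using 1[OF xy(1,2)] 1[OF xy(3,2)] by (simp add: multilinear symmetric power2_eq_square algebra_simps)
    qed
    from this[of 1] this[of "-1"] have "3 * Q x x a y + 3 * Q x a a y = 0" "- 3 * Q x x a y + 3 * Q x a a y = 0" by simp_all
    then have "6 * Q x x a y = 0" by algebra
    then show ?thesis by simp
  qed
  have "Q (u + v) (u + v) w z = 0" using 2 S assms by blast
  then have "2 * Q u v w z = 0" using 2 assms by (simp add: multilinear symmetric)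
  then show ?thesis by simp
qed

lemma is_ideal_sum: "is_ideal N I \<Longrightarrow> (\<And>a. a \<in> A \<Longrightarrow> f a \<in> I) \<Longrightarrow> sum f A \<in> I"
  by (induction A rule: infinite_finite_induct) (auto simp: is_idealD(2,3))

lemma gen_ideal_subset: "is_ideal N I \<Longrightarrow> S \<subseteq> I \<Longrightarrow> gen_ideal N S \<subseteq> I"
  by (auto simp: gen_ideal_def)

lemma gen_ideal_vanishes:
  assumes "F \<in> gen_ideal N S" "\<And>f. f \<in> S \<Longrightarrow> in_vars N f" "\<And>f. f \<in> S \<Longrightarrow> eval x f = 0"
  shows "eval x F = 0"
proof -
  have "is_ideal N {f. in_vars N f \<and> eval x f = 0}" unfolding is_ideal_def by auto
  then have "gen_ideal N S \<subseteq> {f. in_vars N f \<and> eval x f = 0}" by (rule gen_ideal_subset) (use assms in auto)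
  then show ?thesis using assms(1) by blast
qed

lemma prime_ideal_vimage:
  assumes P: "is_prime_ideal N P" and g: "\<And>i. i < N \<Longrightarrow> in_vars N (g i)"
  shows "is_prime_ideal N {f. in_vars N f \<and> subst g f \<in> P}"
proof -
  have I: "is_ideal N P" using P by (simp add: is_prime_ideal_def)
  have iv: "in_vars N f \<Longrightarrow> in_vars N (subst g f)" for f by (rule in_vars_subst[OF g])
  show ?thesis unfolding is_prime_ideal_def is_ideal_def
  proof (intro conjI allI impI ballI)
    fix a b assume "in_vars N a" "in_vars N b" "a * b \<in> {f. in_vars N f \<and> subst g f \<in> P}"
    then show "a \<in> {f. in_vars N f \<and> subst g f \<in> P} \<or> b \<in> {f. in_vars N f \<and> subst g f \<in> P}"
      using P iv unfolding is_prime_ideal_def by simp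
  qed (use P iv in \<open>auto simp: is_idealD[OF I] is_prime_ideal_def\<close>)
qed

subsection \<open>The singular locus along the linear subspace\<close>

lemma is_ideal_dvd: "is_ideal N I \<Longrightarrow> D \<in> I \<Longrightarrow> in_vars N f \<Longrightarrow> D dvd f \<Longrightarrow> f \<in> I" for f :: "'k::field mpoly"
proof -
  assume I: "is_ideal N I" "D \<in> I" and f: "in_vars N f" "D dvd f"
  obtain e where e: "f = e * D" using f(2) by (metis dvdE mult.commute)
  show "f \<in> I"
  proof (cases "f = 0")
    case False
    then have "in_vars N e" using in_vars_factor[of N e D] f(1) e by simp
    then show ?thesis unfolding e by (rule is_idealD(4)[OF I(1) _ I(2)])
  qed (simp add: is_idealD(2)[OF I(1)])
qed

lemma in_vars_pderiv_var: "in_vars N p \<Longrightarrow> in_vars N (pderiv_var i p)"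
  unfolding pderiv_var_def
proof (rule in_vars_sum)
  assume p: "in_vars N p"
  fix m assume m: "m \<in> Poly_Mapping.keys p"
  have "Poly_Mapping.keys (m - Poly_Mapping.single i 1) \<subseteq> Poly_Mapping.keys m"
    by (auto simp: in_keys_iff lookup_minus)
  then show "in_vars N (Poly_Mapping.single (m - Poly_Mapping.single i 1) (of_nat (Poly_Mapping.lookup m i) * Poly_Mapping.lookup p m))"
    using p m by (auto simp: in_vars_def split: if_splits)
qed

lemma sum_lessThan_split: "c \<le> N \<Longrightarrow> sum f {..<N} = sum f {..<c} + sum f {c..<N}" for c N :: nat
  using sum.atLeastLessThan_concat[of 0 c N f] by (simp add: lessThan_atLeast0)

context quartic_form
begin

text \<open>If \<open>Q (b c) (b c) (b c) (b j)\<close> is nonzero, \<open>A j\<close> is a cubic in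
  \<open>Var c\<close> with constant leading coefficient. Its divisor \<open>D\<close> then involves
  \<open>Var c\<close>, being otherwise a divisor of that constant, and divides a monic cubic as
  \<open>prime_chain\<close> demands. If all \<open>A j\<close> are zero, \<open>Var c\<close>
  replaces \<open>D\<close>.\<close>

lemma prime_chain_above:
  fixes b :: "nat \<Rightarrow> nat \<Rightarrow> 'k" and A :: "nat \<Rightarrow> 'k mpoly"
  assumes c: "c < N" and A: "\<And>j. in_vars N (A j)" "\<And>j z. eval z (A j) = Q (xpart N c b z) (xpart N c b z) (xpart N c b z) (b j)"
    and s: "(\<forall>j<c. A j = 0) \<or> (\<exists>j<c. Q (b c) (b c) (b c) (b j) \<noteq> 0)"
    and D: "in_vars N D" "\<And>j. j < c \<Longrightarrow> free_of j D" "\<And>j. j < c \<Longrightarrow> D dvd A j" "\<not> D dvd 1"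
  shows "\<exists>P. (\<forall>k\<le>N - Suc c. is_prime_ideal N (P k) \<and> (\<forall>j<c. Var j \<in> P k \<and> A j \<in> P k)) \<and>
    (\<forall>k<N - Suc c. P k \<subseteq> P (Suc k) \<and> Var (N - Suc k) \<in> P (Suc k) - P k)"
proof -
  obtain D' d0 d1 d2 E :: "'k mpoly" where D': "in_vars N D'" "\<And>j. j < c \<Longrightarrow> free_of j D'" "\<not> free_of c D'"
      "vars_in (Suc c) N d0" "vars_in (Suc c) N d1" "vars_in (Suc c) N d2"
      "in_vars N E" "Var c ^ 3 - (d0 + d1 * Var c + d2 * Var c ^ 2) = E * D'" "\<And>j. j < c \<Longrightarrow> D' dvd A j"
  proof (cases "\<forall>j<c. A j = 0")
    case True
    show ?thesis
      by (rule that[of "Var c" 0 0 0 "Var c ^ 2"]) (use c True in \<open>auto simp: free_of_Var power2_eq_square power3_eq_cube\<close>)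
  next
    case False
    then obtain j where j: "j < c" "Q (b c) (b c) (b c) (b j) \<noteq> 0" using s by blast
    define a where "a = Q (b c) (b c) (b c) (b j)"
    let ?X = "xpart N (Suc c) b"
    have X: "xpart N c b z = z c *v b c + ?X z" for z
      unfolding xpart_def using c by (simp add: sum.atLeast_Suc_lessThan)
    have coeff: "\<exists>e. vars_in (Suc c) N e \<and> (\<forall>z. eval z e = f (?X z))" if "PF N (\<lambda>z. f (?X z))" for f
    proof (rule PF_vars_in[OF that])
      fix z z' :: "nat \<Rightarrow> 'k" assume "\<And>i. Suc c \<le> i \<Longrightarrow> i < N \<Longrightarrow> z i = z' i"
      then have "?X z = ?X z'" by (rule xpart_cong)
      then show "f (?X z) = f (?X z')" by simp
    qed
    obtain e0 where e0: "vars_in (Suc c) N e0" "\<And>z. eval z e0 = Q (?X z) (?X z) (?X z) (b j)"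
      using coeff[of "\<lambda>x. Q x x x (b j)", OF PF[OF PFV_xpart PFV_xpart PFV_xpart PFV_const]] by (elim exE conjE) simp
    obtain e1 where e1: "vars_in (Suc c) N e1" "\<And>z. eval z e1 = 3 * Q (b c) (?X z) (?X z) (b j)"
      using coeff[of "\<lambda>x. 3 * Q (b c) x x (b j)", OF PF_mult[OF PF_const PF[OF PFV_const PFV_xpart PFV_xpart PFV_const]]] by (elim exE conjE) simp
    obtain e2 where e2: "vars_in (Suc c) N e2" "\<And>z. eval z e2 = 3 * Q (b c) (b c) (?X z) (b j)"
      using coeff[of "\<lambda>x. 3 * Q (b c) (b c) x (b j)", OF PF_mult[OF PF_const PF[OF PFV_const PFV_const PFV_xpart PFV_const]]] by (elim exE conjE) simp
    have Aj: "A j = Const a * Var c ^ 3 + e2 * Var c ^ 2 + e1 * Var c + e0"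
      by (rule mpoly_eqI)
        (simp add: A(2) X e0 e1 e2 a_def multilinear symmetric power2_eq_square power3_eq_cube algebra_simps)
    obtain E' where E': "A j = D * E'" using D(3)[OF j(1)] by (elim dvdE)
    have A0: "A j \<noteq> 0"
    proof
      assume "A j = 0"
      moreover have "xpart N c b (uvec c) = b c" unfolding X using xpart_zero[of "Suc c" N "uvec c" b] by (simp add: uvec_def)
      ultimately show False using A(2)[of "uvec c" j] j(2) by simp
    qed
    have iE': "in_vars N E'" using in_vars_factor[of N E' D] A0 A(1)[of j] E' by (simp add: mult.commute)
    have "\<not> free_of c D"
    proof
      assume "free_of c D"
      then have "coeff (toU c (D * E')) 3 = D * coeff (toU c E') 3" by (simp add: free_of_def)
      moreover have "coeff (toU c (A j)) 3 = Const a"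
        using e0(1) e1(1) e2(1) unfolding Aj
        by (simp add: vars_in_def free_of_def toU_Var power2_eq_square power3_eq_cube numeral_3_eq_3)
      ultimately have "D dvd Const a" using E' by (metis dvd_triv_left)
      moreover have "Const a dvd 1" by (rule unit_Const) (use j in \<open>simp add: a_def\<close>)
      ultimately show False using D(4) dvd_trans by blast
    qed
    moreover have "Var c ^ 3 - ((- (Const (1 / a) * e0)) + (- (Const (1 / a) * e1)) * Var c + (- (Const (1 / a) * e2)) * Var c ^ 2)
      = (Const (1 / a) * E') * D"
    proof -
      have a1: "1 / a * a = 1" using j by (simp add: a_def)
      have "Const (1 / a) * Const a = Const (1 / a * a)" by (rule Const_hom(4)[symmetric])
      also have "\<dots> = 1" unfolding a1 by simp
      finally have "Const (1 / a) * Const a = 1" .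
      moreover have "Const (1 / a) * (D * E') = Const (1 / a) * Const a * Var c ^ 3 + Const (1 / a) * e2 * Var c ^ 2 + Const (1 / a) * e1 * Var c + Const (1 / a) * e0"
        unfolding E'[symmetric] Aj by (simp add: algebra_simps)
      ultimately show ?thesis by (simp add: algebra_simps)
    qed
    ultimately show ?thesis
      by (intro that[of D "- (Const (1 / a) * e0)" "- (Const (1 / a) * e1)" "- (Const (1 / a) * e2)" "Const (1 / a) * E'"])
        (use D(1-3) iE' e0(1) e1(1) e2(1) in simp_all)
  qed
  obtain P where P: "\<And>k. k \<le> N - Suc c \<Longrightarrow> is_prime_ideal N (P k) \<and> (\<forall>j<c. Var j \<in> P k) \<and> D' \<in> P k"
    "\<And>k. k < N - Suc c \<Longrightarrow> P k \<subseteq> P (Suc k) \<and> Var (N - Suc k) \<in> P (Suc k) - P k"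
    using prime_chain[OF c D'(1-8)] by blast
  have "A j \<in> P k" if "j < c" "k \<le> N - Suc c" for j k
    by (rule is_ideal_dvd[of N "P k" D']) (use P(1)[OF that(2)] D'(9)[OF that(1)] A(1) in \<open>simp_all add: is_prime_ideal_def\<close>)
  then show ?thesis using P by (intro exI[of _ P]) blast
qed

end

text \<open>The zeros of \<open>D\<close> in \<open>\<Lambda>\<close> would be singular points of
  the quartic. The \<open>h + 1\<close> primes of \<open>prime_chain_above\<close>, pulled back
  along the change of coordinates, form a chain above the equations of the singular locus in
  \<open>\<Lambda>\<close>; a projective dimension at most \<open>h - 2\<close> means Krull
  dimension at most \<open>h - 1\<close> and excludes it.\<close>

lemma (in quartic_hypersurface) no_common_factor:
  fixes b :: "nat \<Rightarrow> nat \<Rightarrow> 'k" and A L :: "nat \<Rightarrow> 'k mpoly"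
  assumes h: "h \<ge> 2" "h + c = n + 1" and L: "\<And>j. j < c \<Longrightarrow> in_vars (n + 2) (L j)"
    "\<And>j x. j < c \<Longrightarrow> eval x (L j) = (\<Sum>k<n + 2. l j k * x k)"
    and b: "indep_family (n + 2) (n + 2) b" "\<And>i j. i < n + 2 \<Longrightarrow> j < c \<Longrightarrow> (\<Sum>k<n + 2. l j k * b i k) = (if i = j then 1 else 0)"
    and isotropic: "\<And>z1 z2 z3 z4. Q (xpart (n + 2) c b z1) (xpart (n + 2) c b z2) (xpart (n + 2) c b z3) (xpart (n + 2) c b z4) = 0"
    and A: "\<And>j. in_vars (n + 2) (A j)" "\<And>j z. eval z (A j) = Q (xpart (n + 2) c b z) (xpart (n + 2) c b z) (xpart (n + 2) c b z) (b j)"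
    and s: "(\<forall>j<c. A j = 0) \<or> (\<exists>j<c. Q (b c) (b c) (b c) (b j) \<noteq> 0)"
    and dim: "proj_dim_le (n + 2) (L ` {..<c} \<union> sing_eqs (n + 2) F) (h - 2)"
    and D: "in_vars (n + 2) D" "\<And>j. j < c \<Longrightarrow> free_of j D" "\<And>j. j < c \<Longrightarrow> D dvd A j"
  shows "D dvd 1"
proof (rule ccontr)
  assume "\<not> D dvd 1"
  let ?N = "n + 2"
  let ?X = "xpart ?N c b"
  have c: "c < ?N" and hc: "?N - Suc c = h" using h by auto
  obtain P where P: "\<And>k. k \<le> h \<Longrightarrow> is_prime_ideal ?N (P k)" "\<And>k j. k \<le> h \<Longrightarrow> j < c \<Longrightarrow> Var j \<in> P k"
      "\<And>k j. k \<le> h \<Longrightarrow> j < c \<Longrightarrow> A j \<in> P k"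
      "\<And>k. k < h \<Longrightarrow> P k \<subseteq> P (Suc k)" "\<And>k. k < h \<Longrightarrow> Var (?N - Suc k) \<in> P (Suc k) - P k"
    using prime_chain_above[OF c A s D \<open>\<not> D dvd 1\<close>] unfolding hc by blast
  have I: "is_ideal ?N (P k)" if "k \<le> h" for k using P(1)[OF that] by (simp add: is_prime_ideal_def)
  \<comment> \<open>\<open>g\<close> passes to coordinates with respect to \<open>b\<close>;
    \<open>gX\<close> is its restriction to the linear space. They agree modulo \<open>P k\<close>,
    which contains the first \<open>c\<close> variables, so membership can be tested on the linear
    space.\<close>
  define g where "g i = (\<Sum>j<?N. Const (b j i) * Var j)" for i
  define gX where "gX i = (\<Sum>j\<in>{c..<?N}. Const (b j i) * Var j)" for i
  have ivg: "in_vars ?N (g i)" "in_vars ?N (gX i)" for i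
    unfolding g_def gX_def by (auto intro!: in_vars_sum in_vars_simps(5))
  have eg: "eval z (g i) = (\<Sum>j<?N. b j i * z j)" "eval z (gX i) = ?X z i" for z i
    by (simp_all add: g_def gX_def xpart_def sum_fun_apply mult.commute)
  define P' where "P' k = {f. in_vars ?N f \<and> subst g f \<in> P k}" for k
  have P': "is_prime_ideal ?N (P' k)" if "k \<le> h" for k
    unfolding P'_def by (rule prime_ideal_vimage[OF P(1)[OF that] ivg(1)])
  have diff: "g i - gX i \<in> P k" if "k \<le> h" for i k
  proof -
    have "g i = (\<Sum>j<c. Const (b j i) * Var j) + gX i"
      unfolding g_def gX_def by (rule sum_lessThan_split) (use c in simp)
    then have "g i - gX i = (\<Sum>j<c. Const (b j i) * Var j)" by simp
    also have "\<dots> \<in> P k" using that by (intro is_ideal_sum[OF I] is_idealD(4)[OF I] P) auto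
    finally show ?thesis .
  qed
  have mem: "f \<in> P' k" if f: "in_vars ?N f" and B: "\<And>z. eval (?X z) f = eval z B" "B \<in> P k" and k: "k \<le> h" for f B k
  proof -
    have "subst g f - subst gX f \<in> P k" by (rule subst_congruent[OF I[OF k] ivg diff[OF k] f])
    moreover have "subst gX f = B" by (rule mpoly_eqI) (simp add: eval_subst eg B(1))
    ultimately have "subst g f - B + B \<in> P k" using is_idealD(3)[OF I[OF k]] B(2) by blast
    then show ?thesis using f by (simp add: P'_def)
  qed
  have strict: "P' k \<subset> P' (Suc k)" if k: "k < h" for k
  proof -
    \<comment> \<open>The linear form dual to \<open>b ?m\<close> is a preimage of the variable that
      distinguishes consecutive primes.\<close>
    obtain b' where b': "\<And>i j. i < ?N \<Longrightarrow> j < ?N \<Longrightarrow> (\<Sum>k<?N. b i k * b' j k) = (if i = j then 1 else 0)"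
      using dual_family[OF b(1)] by blast
    let ?m = "?N - Suc k"
    define f where "f = (\<Sum>i<?N. Const (b' ?m i) * Var i)"
    have "subst g f = Var ?m"
    proof (rule mpoly_eqI)
      fix z
      have "eval z (subst g f) = (\<Sum>i<?N. \<Sum>j<?N. z j * (b j i * b' ?m i))"
        by (simp add: eval_subst f_def eg sum_distrib_left mult_ac)
      also have "\<dots> = (\<Sum>j<?N. z j * (\<Sum>i<?N. b j i * b' ?m i))" by (subst sum.swap) (simp add: sum_distrib_left)
      also have "\<dots> = (\<Sum>j<?N. z j * (if j = ?m then 1 else 0))" by (rule sum.cong) (simp_all add: b')
      also have "\<dots> = z ?m" by (simp add: if_distrib[of "(*) _"] cong: if_cong)
      finally show "eval z (subst g f) = eval z (Var ?m)" by simp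
    qed
    moreover have "in_vars ?N f" unfolding f_def by (auto intro!: in_vars_sum in_vars_simps(5))
    ultimately have "f \<in> P' (Suc k) - P' k" using P(5)[OF k] by (simp add: P'_def)
    moreover have "P' k \<subseteq> P' (Suc k)" using P(4)[OF k] by (auto simp: P'_def)
    ultimately show ?thesis by blast
  qed
  have XF: "eval (?X z) F = 0" for z unfolding eval_F by (rule isotropic)
  have ivF: "in_vars ?N F" using F by (simp add: irreducible_form_def)
  have gens: "L ` {..<c} \<union> sing_eqs ?N F \<subseteq> P' k" if k: "k \<le> h" for k
  proof
    fix f assume "f \<in> L ` {..<c} \<union> sing_eqs ?N F"
    then consider j where "j < c" "f = L j" | "f = F" | i where "i < ?N" "f = pderiv_var i F" by (auto simp: sing_eqs_def)
    then show "f \<in> P' k"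
    proof cases
      case (1 j)
      have "subst g (L j) = Var j"
      proof (rule mpoly_eqI)
        fix z
        have "eval z (subst g (L j)) = (\<Sum>k<?N. \<Sum>i<?N. z i * (l j k * b i k))"
          using 1 by (simp add: eval_subst L(2) eg sum_distrib_left mult_ac)
        also have "\<dots> = (\<Sum>i<?N. z i * (\<Sum>k<?N. l j k * b i k))" by (subst sum.swap) (simp add: sum_distrib_left)
        also have "\<dots> = (\<Sum>i<?N. z i * (if i = j then 1 else 0))" by (rule sum.cong) (use 1 b(2) in simp_all)
        also have "\<dots> = z j" using 1 c by (simp add: if_distrib[of "(*) _"] cong: if_cong)
        finally show "eval z (subst g (L j)) = eval z (Var j)" by simp
      qed
      then show ?thesis using 1 L(1) P(2)[OF k] by (simp add: P'_def)
    next
      case 2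
      then show ?thesis using mem[OF ivF, of 0 k] XF is_idealD(2)[OF I[OF k]] k by simp
    next
      case (3 i)
      \<comment> \<open>In the expansion of the unit vector in the basis \<open>b\<close>, the
        components in the linear space contribute nothing to the partial derivative there; it is a
        combination of the \<open>A j\<close>.\<close>
      obtain y where y: "\<And>t. t < ?N \<Longrightarrow> uvec i t = (\<Sum>j<?N. y j * b j t)" using indep_family_spans[OF b(1), of "uvec i"] by blast
      define B where "B = (\<Sum>j<c. Const (4 * y j) * A j)"
      have "eval (?X z) f = eval z B" for z
      proof -
        have "(\<Sum>j<?N. y j *v b j) = (\<Sum>j<c. y j *v b j) + ?X y"
          unfolding xpart_def by (rule sum_lessThan_split) (use c in simp)
        then have "Q (?X z) (?X z) (?X z) (uvec i) = Q (?X z) (?X z) (?X z) ((\<Sum>j<c. y j *v b j) + ?X y)"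
          using y by (intro cong4) (metis (no_types, lifting) sum.cong sum_fun_apply vscale_apply)
        also have "\<dots> = (\<Sum>j<c. y j * Q (?X z) (?X z) (?X z) (b j))"
        proof -
          have "Q u v w (\<Sum>j<d. y j *v b j) = (\<Sum>j<d. y j * Q u v w (b j))" for u v w and d :: nat
            by (induction d) (simp_all only: sum.lessThan_Suc lessThan_0 sum.empty multilinear)
          then show ?thesis by (simp add: add4 isotropic)
        qed
        finally show ?thesis unfolding 3 eval_pderiv_var grad_F B_def by (simp add: A(2) sum_distrib_left mult.assoc)
      qed
      moreover have "B \<in> P k" unfolding B_def
        by (intro is_ideal_sum[OF I[OF k]] is_idealD(4)[OF I[OF k]]) (use k P(3) in auto)
      moreover have "in_vars ?N f" unfolding 3 by (rule in_vars_pderiv_var[OF ivF])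
      ultimately show ?thesis using mem k by blast
    qed
  qed
  have "gen_ideal ?N (L ` {..<c} \<union> sing_eqs ?N F) \<subseteq> P' k" if "k \<le> h" for k
    by (rule gen_ideal_subset[OF _ gens[OF that]]) (use P'[OF that] in \<open>simp add: is_prime_ideal_def\<close>)
  then have "\<not> krull_dim_le ?N (gen_ideal ?N (L ` {..<c} \<union> sing_eqs ?N F)) (Suc (h - 2))"
    unfolding krull_dim_le_def not_not using P' strict h(1) by (intro exI[of _ P']) auto
  then show False using dim by (simp add: proj_dim_le_def)
qed

lemma linear_forms_family:
  fixes L :: "nat \<Rightarrow> 'k::field_char_0 mpoly"
  assumes "indep_linear_forms N c L"
  shows "indep_family N c (\<lambda>j k. eval (uvec k) (L j))"
    and "j < c \<Longrightarrow> eval x (L j) = (\<Sum>k<N. eval (uvec k) (L j) * x k)"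
proof -
  show L: "eval x (L j) = (\<Sum>k<N. eval (uvec k) (L j) * x k)" if "j < c" for x j
    using assms that by (intro eval_linear_form) (auto simp: indep_linear_forms_def)
  show "indep_family N c (\<lambda>j k. eval (uvec k) (L j))" unfolding indep_family_def
  proof (rule allI, rule impI)
    fix a :: "nat \<Rightarrow> 'k" assume a: "\<forall>k<N. (\<Sum>j<c. a j * eval (uvec k) (L j)) = 0"
    have "(\<Sum>j<c. Const (a j) * L j) = 0"
    proof (rule eval_eq_0_imp_eq_0)
      fix x
      have "eval x (\<Sum>j<c. Const (a j) * L j) = (\<Sum>j<c. \<Sum>k<N. x k * (a j * eval (uvec k) (L j)))"
        using L by (simp add: sum_distrib_left mult_ac)
      also have "\<dots> = (\<Sum>k<N. x k * (\<Sum>j<c. a j * eval (uvec k) (L j)))" by (subst sum.swap) (simp add: sum_distrib_left)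
      also have "\<dots> = 0" using a by simp
      finally show "eval x (\<Sum>j<c. Const (a j) * L j) = 0" .
    qed
    then show "\<forall>j<c. a j = 0" using assms by (simp add: indep_linear_forms_def)
  qed
qed

text \<open>A failure of the degeneracy condition supplies the vectors for
  \<open>unirational_nondegenerate\<close>. In the degenerate case the triple point \<open>v\<close>
  has some \<open>x\<close> with \<open>Q v x x x\<close> nonzero, since otherwise translation by
  \<open>v\<close> would preserve the quartic, making it a cone.\<close>

lemma (in linear_subspace) unirational:
  assumes "\<not> is_cone (n + 2) F"
  shows "unirational_hypersurface (n + 2) F"
proof (cases "degenerate_linear_subspace n Q F c b A")
  case True
  then interpret degenerate_linear_subspace n Q F c b A .
  obtain v i where v: "i < n + 2" "v i \<noteq> 0" "\<And>i. i \<ge> n + 2 \<Longrightarrow> v i = 0" "\<And>s t. Q v v s t = 0"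
    using ex_triple_point by blast
  have "\<exists>x. Q v x x x \<noteq> 0"
  proof (rule ccontr)
    assume *: "\<nexists>x. Q v x x x \<noteq> 0"
    have "eval (\<lambda>i. x i + t * v i) F = eval x F" for x t
    proof -
      have "(\<lambda>i. x i + t * v i) = x + t *v v" by (simp add: fun_eq_iff)
      moreover have "Q (x + t *v v) (x + t *v v) (x + t *v v) (x + t *v v) = Q x x x x"
        using *[simplified, rule_format, of x] v(4)[of x x] v(4)[of v x] v(4)[of v v] by (simp add: multilinear symmetric)
      ultimately show ?thesis by (simp add: eval_F)
    qed
    then show False using assms v unfolding is_cone_def by blast
  qed
  then show ?thesis using unirational_triple_point[of i v] v by blast
next
  case False
  then obtain p w q k r where *: "Q (X p) (X p) (X p) w \<noteq> 0" "Q (X p) (X p) (X p) q = 0" "Q (X p) (X p) (X k) q = 0"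
    "Q (X p) (X p) (X r) q \<noteq> 0" "Q (X p) (X p) q q = 0" "Q (X p) (X k) (X k) q \<noteq> 0 \<or> Q (X p) (X k) q q \<noteq> 0"
    unfolding degenerate_linear_subspace_def degenerate_linear_subspace_axioms_def using linear_subspace_axioms by blast
  show ?thesis
  proof (rule unirational_nondegenerate[OF _ _ *(2,3,4,5,6,1)])
    show "n = (n - 2) + 2" using n by simp
    fix a b' c' d assume "a \<in> {X p, X k, X r}" "b' \<in> {X p, X k, X r}" "c' \<in> {X p, X k, X r}" "d \<in> {X p, X k, X r}"
    then show "Q a b' c' d = 0" by (elim insertE emptyE; simp only: isotropic)
  qed
qed

theorem theorem3p20:
  fixes F :: "'k::field_char_0 mpoly"
    and n h c :: nat
    and L :: "nat \<Rightarrow> 'k mpoly"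
  assumes "n \<ge> 3" and "h \<ge> 2"
    and quartic: "irreducible_form (n + 2) 4 F"
    and Lambda: "h + c = n + 1" "indep_linear_forms (n + 2) c L"
    and contains: "F \<in> gen_ideal (n + 2) (L ` {..<c})"
    and sing: "proj_dim_le (n + 2) (L ` {..<c} \<union> sing_eqs (n + 2) F) (h - 2)"
    and not_cone: "\<not> is_cone (n + 2) F"
  shows "unirational_hypersurface (n + 2) F"
proof -
  let ?N = "n + 2"
  have c: "c < ?N" using Lambda(1) by simp
  have "in_vars ?N F" "homogeneous 4 F" using quartic by (simp_all add: irreducible_form_def)
  then obtain Q where Q: "quartic_form ?N Q" "\<And>x. eval x F = Q x x x x" by (rule ex_quartic_form) blast
  interpret quartic_hypersurface n Q F
    by (rule quartic_hypersurface.intro[OF Q(1)], unfold_locales) (rule quartic, rule Q(2))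
  define l where "l j k = eval (uvec k) (L j)" for j k
  have l: "indep_family ?N c l" and eval_L: "\<And>j x. j < c \<Longrightarrow> eval x (L j) = (\<Sum>k<?N. l j k * x k)"
    unfolding l_def by (rule linear_forms_family[OF Lambda(2)], rule linear_forms_family[OF Lambda(2)])
  have in_vars_L: "in_vars ?N (L j)" if "j < c" for j using Lambda(2) that by (simp add: indep_linear_forms_def)
  define S where "S x \<longleftrightarrow> (\<forall>j<c. (\<Sum>k<?N. l j k * x k) = 0)" for x
  have S_add: "S (x + y)" if "S x" "S y" for x y using that by (simp add: S_def distrib_left sum.distrib)
  have S_scale: "S (t *v x)" if "S x" for t x
    using that by (simp add: S_def mult.left_commute[of _ t] flip: sum_distrib_left)
  have S_sum: "S (\<Sum>i\<in>I. t i *v x i)" if "\<And>i. i \<in> I \<Longrightarrow> S (x i)" for I :: "nat set" and t x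
    using that by (induction I rule: infinite_finite_induct) (auto simp: S_def[of 0] intro: S_add S_scale)
  have "Q x x x x = 0" if "S x" for x
    unfolding Q(2)[symmetric]
    by (rule gen_ideal_vanishes[OF contains]) (use that in_vars_L in \<open>auto simp: eval_L S_def\<close>)
  then have S_isotropic: "Q x y z w = 0" if "S x" "S y" "S z" "S w" for x y z w
    using polarize[of S x y z w] S_add S_scale that by blast
  \<comment> \<open>The vector \<open>s\<close> becomes \<open>b c\<close>: at it some cubic is
    nonzero, unless all of them vanish on the linear space, in which case any nonzero
    \<open>s\<close> will do.\<close>
  have "\<exists>s. S s \<and> (\<exists>i<?N. s i \<noteq> 0) \<and> ((\<exists>w. Q s s s w \<noteq> 0) \<or> (\<forall>x w. S x \<longrightarrow> Q x x x w = 0))"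
  proof (cases "\<exists>s w. S s \<and> Q s s s w \<noteq> 0")
    case True
    then obtain s w where s: "S s" "Q s s s w \<noteq> 0" by blast
    have "\<exists>i<?N. s i \<noteq> 0"
    proof (rule ccontr)
      assume "\<not> ?thesis"
      then have "Q s s s w = Q 0 s s w" by (intro cong) simp
      then show False using s(2) by (simp add: zero)
    qed
    then show ?thesis using s by blast
  next
    case False
    obtain s where "\<exists>i<?N. s i \<noteq> 0" "S s"
      using homogeneous_system[of "{..<c}" "{..<?N}" "\<lambda>k j. l j k"] c by (auto simp: S_def mult.commute[of "l _ _"])
    then show ?thesis using False by blast
  qed
  then obtain s i0 where s: "S s" "i0 < ?N" "s i0 \<noteq> 0" "(\<exists>w. Q s s s w \<noteq> 0) \<or> (\<forall>x w. S x \<longrightarrow> Q x x x w = 0)"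
    by blast
  have "(\<Sum>k<?N. l j k * s k) = 0" if "j < c" for j using s(1) that by (simp add: S_def)
  from adapted_basis[OF l c this s(2,3)] obtain b where b: "indep_family ?N ?N b" "b c = s"
    "\<And>i j. i < ?N \<Longrightarrow> j < c \<Longrightarrow> (\<Sum>k<?N. l j k * b i k) = (if i = j then 1 else 0)" by blast
  let ?X = "xpart ?N c b"
  have SX: "S (?X z)" for z unfolding xpart_def by (rule S_sum) (auto simp: S_def b(3))
  note isotropic = S_isotropic[OF SX SX SX SX]
  have "\<exists>A. in_vars ?N A \<and> (\<forall>z. eval z A = Q (?X z) (?X z) (?X z) (b j))" for j
    using PF[of ?N ?X ?X ?X "\<lambda>_. b j", OF PFV_xpart PFV_xpart PFV_xpart PFV_const] by (auto simp: PF_def)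
  then obtain A where A: "\<And>j. in_vars ?N (A j)" "\<And>j z. eval z (A j) = Q (?X z) (?X z) (?X z) (b j)" by metis
  have sA: "(\<forall>j<c. A j = 0) \<or> (\<exists>j<c. Q (b c) (b c) (b c) (b j) \<noteq> 0)"
    using s(4)
  proof
    assume "\<forall>x w. S x \<longrightarrow> Q x x x w = 0"
    then have "A j = 0" for j by (intro eval_eq_0_imp_eq_0) (simp add: A(2) SX)
    then show ?thesis by blast
  next
    assume "\<exists>w. Q s s s w \<noteq> 0"
    then obtain w where w: "Q s s s w \<noteq> 0" by blast
    obtain y where y: "\<And>i. i < ?N \<Longrightarrow> w i = (\<Sum>j<?N. y j * b j i)" using indep_family_spans[OF b(1), of w] by blast
    have "Q s s s w = Q s s s (\<Sum>j<?N. y j *v b j)" by (rule cong4) (simp add: y sum_fun_apply)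
    also have "\<dots> = (\<Sum>j<?N. y j * Q s s s (b j))"
    proof -
      have "Q s s s (\<Sum>j<d. y j *v b j) = (\<Sum>j<d. y j * Q s s s (b j))" for d :: nat
        by (induction d) (simp_all only: sum.lessThan_Suc lessThan_0 sum.empty multilinear)
      then show ?thesis .
    qed
    finally obtain j where j: "j < ?N" "Q s s s (b j) \<noteq> 0" using w by (metis (no_types, lifting) lessThan_iff mult_zero_right sum.neutral)
    \<comment> \<open>A basis vector of index at least \<open>c\<close> lies in the linear space,
      where \<open>Q\<close> is zero.\<close>
    have "j < c"
    proof (rule ccontr)
      assume "\<not> j < c"
      then have "S (b j)" using j(1) by (auto simp: S_def b(3))
      then show False using S_isotropic[OF s(1) s(1) s(1)] j(2) by blast
    qed
    then show ?thesis using j b(2) by auto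
  qed
  have "linear_subspace n Q F c b A"
  proof unfold_locales
    show "c + 3 \<le> n + 2" "n \<ge> 2" using assms(1,2) Lambda(1) by simp_all
    show "D dvd 1" if "in_vars ?N D" "\<And>j. j < c \<Longrightarrow> free_of j D" "\<And>j. j < c \<Longrightarrow> D dvd A j" for D
      using no_common_factor[OF \<open>h \<ge> 2\<close> Lambda(1) in_vars_L eval_L b(1,3) isotropic A sA sing that] by blast
  qed (rule b(1) isotropic A)+
  then show ?thesis using linear_subspace.unirational not_cone by blast
qed

end
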